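(* Let $d<0$ be a square-free integer such that $\mathcal O_d$ is a principal ideal domain, and let $N\ge3$. If $d\equiv1\pmod4$ assume also that $N$ is even. Then the association $Z\mapsto\mathcal A_Z$ determines a one to one correspondence between the real points $X_{\mathbb R}$ of $X=\Gamma_N\backslash\mathfrak h_2$ and the moduli space $V(d,N)$ consisting of isomorphism classes of principally polarized abelian surfaces with anti-holomorphic multiplication by $\mathcal O_d$ and (compatible) level $N$ structure.
   Context: Transpose is written ${}^tA$. $\mathcal O_d$ is the ring of integers of $\mathbb Q(\sqrt d)$; $\Gamma(N)\subset\mathbf{Sp}(4,\mathbb Z)$ is the principal congruence subgroup of level $N$. If $d\not\equiv1\pmod 4$ put $\beta=\begin{pmatrix}0&1\\d&0\end{pmatrix}$; if $d=4m+1$ put $\beta=\begin{pmatrix}1&2\\2m&-1\end{pmatrix}$. Put $N_\beta=\begin{pmatrix}\beta&0\\0&{}^t\beta\end{pmatrix}$. $\mathbf{Sp}(4,\mathbb R)$ consists of real block matrices $\begin{pmatrix}A&B\\C&D\end{pmatrix}$ with ${}^tAD-{}^tCB=I$ and ${}^tAC$, ${}^tBD$ symmetric, acting on the Siegel space $\mathfrak h_2$ (symmetric $2\times2$ complex $Z$ with $\mathrm{Im}\,Z>0$) by $(AZ+B)(CZ+D)^{-1}$. Involutions: $\widehat g=N_\beta gN_\beta^{-1}$ on $\mathbf{Sp}(4,\mathbb R)$ and $\widehat Z=\beta\overline Z\,{}^t\beta^{-1}$ on $\mathfrak h_2$; $\widehat{gZ}=\widehat g\widehat Z$. $\Gamma_N=\Gamma(N)\cap\{\widehat\gamma:\gamma\in\Gamma(N)\}$.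 $X_{\mathbb R}$ is the fixed point set of the anti-holomorphic involution of $X$ induced by $Z\mapsto\widehat Z$; its points are the images of the $\Gamma_N$-real points, i.e. those $Z\in\mathfrak h_2$ with $\widehat Z=\gamma Z$ for some $\gamma\in\Gamma_N$ (unique since $\Gamma_N$ is torsion-free). A principally polarized abelian surface is a pair $(A=\mathbb C^2/L,\ H=R+iQ)$ with $H$ a positive definite Hermitian form on $\mathbb C^2$ ($R,Q$ its real and imaginary parts, $R(u,v)=Q(iu,v)$) and $L$ a lattice admitting a symplectic $\mathbb Z$-basis, i.e. one in which $Q$ has matrix $\begin{pmatrix}0&I\\-I&0\end{pmatrix}$. An anti-holomorphic multiplication by $\mathcal O_d$ is a complex anti-linear $\kappa:\mathbb C^2\to\mathbb C^2$ (the action of $\sqrt d$) with $\kappa^2=dI$; $Q(\kappa u,\kappa v)=d\,Q(u,v)$ for all $u,v$; $\kappa(L)\subset L$; and, if $d\equiv1\pmod4$, $\frac12(\kappa+I)(L)\subset L$. A level $N$ structure is a basis $\{U_1,U_2,V_1,V_2\}$ of the $N$-torsion of $A$ for which there is a symplectic basis $\{u_1,u_2,v_1,v_2\}$ of $L$ (a lift) with $U_i\equiv u_i/N$, $V_i\equiv v_i/N$ mod $L$. It is compatible with $\kappa$ if for some (hence any) lift, with $F:\mathbb R^4\to\mathbb C^2$ the real linear map sending the standard basis $e_1,e_2,f_1,f_2$ to $u_1,u_2,v_1,v_2$, one has $\kappa F(x)\equiv F({}^tN_\beta x)$ mod $L$ for all $x\in\frac1N\mathbb Z^4$. An isomorphism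 $(A,H,\kappa,\{U_i,V_j\})\cong(A'=\mathbb C^2/L',H',\kappa',\{U_i',V_j'\})$ is a complex linear $\psi:\mathbb C^2\to\mathbb C^2$ with $\psi(L)=L'$, $\psi_*H=H'$, $\psi\kappa\psi^{-1}=\kappa'$, and $\psi(u_i/N)\equiv u_i'/N$, $\psi(v_j/N)\equiv v_j'/N$ mod $L'$ for some (hence any) lifts of the level structures. For $Z\in\mathfrak h_2$ let $F_Z:\mathbb R^2\oplus\mathbb R^2\to\mathbb C^2$, $F_Z(x,y)=Zx+y$, $L_Z=F_Z(\mathbb Z^2\oplus\mathbb Z^2)$, $A_Z=\mathbb C^2/L_Z$, $H_Z(u,v)={}^tu(\mathrm{Im}\,Z)^{-1}\bar v$. If $Z$ is $\Gamma_N$-real with $\widehat Z=\gamma Z$, $\gamma\in\Gamma_N$, let $\kappa_Z=F_Z\circ{}^t(N_\beta\gamma)\circ F_Z^{-1}$ and $\mathcal A_Z=(A_Z,H_Z,\kappa_Z,\{F_Z(e_i/N),F_Z(f_j/N)\})$. *)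

theory Defs
  imports
    "HOL-Analysis.Analysis"
    "HOL-Algebra.Ring_Divisibility"
    "HOL-Computational_Algebra.Polynomial"
    "HOL-Computational_Algebra.Squarefree"
begin

section \<open>The ring of integers of an imaginary quadratic field\<close>

definition quadratic_field :: "int \<Rightarrow> complex set" where
  "quadratic_field d = {of_rat a + of_rat b * csqrt (of_int d) | a b. True}"

definition quadratic_integers :: "int \<Rightarrow> complex ring" where
  "quadratic_integers d =
     \<lparr>carrier = {x \<in> quadratic_field d. algebraic_int x},
      mult = (*), one = 1, zero = 0, add = (+)\<rparr>"


section \<open>Block matrices and the symplectic group\<close>

text \<open>The index type \<open>2 + 2\<close> is the disjoint sum of two two-element types, so that
  a vector over it is a pair of vectors of length two (the basis vectors
  \<open>e\<^sub>1, e\<^sub>2\<close> have index \<open>Inl 1, Inl 2\<close>, and \<open>f\<^sub>1, f\<^sub>2\<close> have index \<open>Inr 1, Inr 2\<close>)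
  and a square matrix over it consists of four two by two blocks.\<close>

type_synonym mat4 = "real^(2+2)^(2+2)"

definition block :: "real^2^2 \<Rightarrow> real^2^2 \<Rightarrow> real^2^2 \<Rightarrow> real^2^2 \<Rightarrow> mat4" where
  "block A B C D = (\<chi> i j. case (i, j) of
       (Inl a, Inl b) \<Rightarrow> A $ a $ b
     | (Inl a, Inr b) \<Rightarrow> B $ a $ b
     | (Inr a, Inl b) \<Rightarrow> C $ a $ b
     | (Inr a, Inr b) \<Rightarrow> D $ a $ b)"

definition blkA :: "mat4 \<Rightarrow> real^2^2" where "blkA g = (\<chi> a b. g $ Inl a $ Inl b)"
definition blkB :: "mat4 \<Rightarrow> real^2^2" where "blkB g = (\<chi> a b. g $ Inl a $ Inr b)"
definition blkC :: "mat4 \<Rightarrow> real^2^2" where "blkC g = (\<chi> a b. g $ Inr a $ Inl b)"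
definition blkD :: "mat4 \<Rightarrow> real^2^2" where "blkD g = (\<chi> a b. g $ Inr a $ Inr b)"

definition sym_mat :: "'a^'n^'n \<Rightarrow> bool" where
  "sym_mat M \<longleftrightarrow> transpose M = M"

definition Sp4_real :: "mat4 set" where
  "Sp4_real = {g.
     transpose (blkA g) ** blkD g - transpose (blkC g) ** blkB g = mat 1 \<and>
     sym_mat (transpose (blkA g) ** blkC g) \<and>
     sym_mat (transpose (blkB g) ** blkD g)}"

definition Sp4_int :: "mat4 set" where
  "Sp4_int = {g \<in> Sp4_real. \<forall>i j. g $ i $ j \<in> \<int>}"

definition principal_congruence :: "nat \<Rightarrow> mat4 set" where
  "principal_congruence N =
     {g \<in> Sp4_int. \<forall>i j. \<exists>k::int. g $ i $ j - mat 1 $ i $ j = of_int (int N * k)}"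

text \<open>If \<open>d = 4 m + 1\<close> then \<open>m = d div 4\<close>, also for negative \<open>d\<close>.\<close>

definition beta :: "int \<Rightarrow> real^2^2" where
  "beta d = (if d mod 4 = 1
     then vector [vector [1, 2], vector [2 * of_int (d div 4), -1]]
     else vector [vector [0, 1], vector [of_int d, 0]])"

definition N_beta :: "int \<Rightarrow> mat4" where
  "N_beta d = block (beta d) 0 0 (transpose (beta d))"

definition hat_Sp :: "int \<Rightarrow> mat4 \<Rightarrow> mat4" where
  "hat_Sp d g = N_beta d ** g ** matrix_inv (N_beta d)"

definition Gamma_N :: "int \<Rightarrow> nat \<Rightarrow> mat4 set" where
  "Gamma_N d N = principal_congruence N \<inter> hat_Sp d ` principal_congruence N"


section \<open>The Siegel space and the real points of its quotient\<close>

definition siegel :: "(complex^2^2) set" where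
  "siegel = {Z. sym_mat Z \<and> (\<forall>x::real^2. x \<noteq> 0 \<longrightarrow> 0 < x \<bullet> (map_matrix Im Z *v x))}"

definition siegel_act :: "mat4 \<Rightarrow> complex^2^2 \<Rightarrow> complex^2^2" where
  "siegel_act g Z =
     (map_matrix of_real (blkA g) ** Z + map_matrix of_real (blkB g)) **
     matrix_inv (map_matrix of_real (blkC g) ** Z + map_matrix of_real (blkD g))"

definition hat_siegel :: "int \<Rightarrow> complex^2^2 \<Rightarrow> complex^2^2" where
  "hat_siegel d Z =
     map_matrix of_real (beta d) ** map_matrix cnj Z **
     matrix_inv (transpose (map_matrix of_real (beta d)))"

definition orbit_rel :: "int \<Rightarrow> nat \<Rightarrow> ((complex^2^2) \<times> (complex^2^2)) set" where
  "orbit_rel d N =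
     {(Z, W). Z \<in> siegel \<and> W \<in> siegel \<and> (\<exists>g\<in>Gamma_N d N. W = siegel_act g Z)}"

definition X_quot :: "int \<Rightarrow> nat \<Rightarrow> (complex^2^2) set set" where
  "X_quot d N = siegel // orbit_rel d N"

text \<open>The involution on \<open>X\<close> sends the orbit of \<open>Z\<close> to the orbit of the image of \<open>Z\<close>,
  which as a set of points is the image of the orbit.\<close>

definition X_involution :: "int \<Rightarrow> (complex^2^2) set \<Rightarrow> (complex^2^2) set" where
  "X_involution d c = hat_siegel d ` c"

definition X_real :: "int \<Rightarrow> nat \<Rightarrow> (complex^2^2) set set" where
  "X_real d N = {c \<in> X_quot d N. X_involution d c = c}"


section \<open>Abelian surfaces with anti-holomorphic multiplication and level structure\<close>

definition int_vecs :: "(real^(2+2)) set" where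
  "int_vecs = {x. \<forall>i. x $ i \<in> \<int>}"

text \<open>The real linear map sending the standard basis to the family \<open>b\<close>.\<close>

definition frame :: "(2+2 \<Rightarrow> complex^2) \<Rightarrow> real^(2+2) \<Rightarrow> complex^2" where
  "frame b x = (\<Sum>i\<in>UNIV. (x $ i) *\<^sub>R b i)"

definition lattice_basis :: "(complex^2) set \<Rightarrow> (2+2 \<Rightarrow> complex^2) \<Rightarrow> bool" where
  "lattice_basis L b \<longleftrightarrow> inj b \<and> independent (range b) \<and> L = frame b ` int_vecs"

definition pos_def_hermitian :: "(complex^2 \<Rightarrow> complex^2 \<Rightarrow> complex) \<Rightarrow> bool" where
  "pos_def_hermitian H \<longleftrightarrow>
     (\<forall>v. Vector_Spaces.linear (*s) (*) (\<lambda>u. H u v)) \<and>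
     (\<forall>u v. H v u = cnj (H u v)) \<and>
     (\<forall>u. u \<noteq> 0 \<longrightarrow> 0 < Re (H u u))"

definition imag_form ::
    "(complex^2 \<Rightarrow> complex^2 \<Rightarrow> complex) \<Rightarrow> complex^2 \<Rightarrow> complex^2 \<Rightarrow> real" where
  "imag_form H u v = Im (H u v)"

definition symplectic_basis ::
    "(complex^2) set \<Rightarrow> (complex^2 \<Rightarrow> complex^2 \<Rightarrow> complex) \<Rightarrow> (2+2 \<Rightarrow> complex^2) \<Rightarrow> bool" where
  "symplectic_basis L H b \<longleftrightarrow> lattice_basis L b \<and>
     (\<forall>i j. imag_form H (b i) (b j) = block 0 (mat 1) (- mat 1) 0 $ i $ j)"

definition pp_abelian_surface ::
    "(complex^2) set \<Rightarrow> (complex^2 \<Rightarrow> complex^2 \<Rightarrow> complex) \<Rightarrow> bool" where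
  "pp_abelian_surface L H \<longleftrightarrow> pos_def_hermitian H \<and> (\<exists>b. symplectic_basis L H b)"

definition antilinear :: "(complex^2 \<Rightarrow> complex^2) \<Rightarrow> bool" where
  "antilinear k \<longleftrightarrow>
     (\<forall>u v. k (u + v) = k u + k v) \<and> (\<forall>c u. k (c *s u) = cnj c *s k u)"

definition antiholomorphic_mult ::
    "int \<Rightarrow> (complex^2) set \<Rightarrow> (complex^2 \<Rightarrow> complex^2 \<Rightarrow> complex) \<Rightarrow>
     (complex^2 \<Rightarrow> complex^2) \<Rightarrow> bool" where
  "antiholomorphic_mult d L H k \<longleftrightarrow>
     antilinear k \<and>
     (\<forall>u. k (k u) = of_int d *\<^sub>R u) \<and>
     (\<forall>u v. imag_form H (k u) (k v) = of_int d * imag_form H u v) \<and>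
     k ` L \<subseteq> L \<and>
     (d mod 4 = 1 \<longrightarrow> (\<lambda>u. (1/2) *\<^sub>R (k u + u)) ` L \<subseteq> L)"

text \<open>The point of the torus \<open>\<complex>\<^sup>2 / L\<close> represented by \<open>v\<close>.\<close>

definition torus_pt :: "(complex^2) set \<Rightarrow> complex^2 \<Rightarrow> (complex^2) set" where
  "torus_pt L v = {w. w - v \<in> L}"

definition torsion_pts :: "nat \<Rightarrow> (complex^2) set \<Rightarrow> (complex^2) set set" where
  "torsion_pts N L = {torus_pt L v | v. real N *\<^sub>R v \<in> L}"

text \<open>\<open>U\<close> is a basis of the \<open>N\<close>-torsion as a module over the integers modulo \<open>N\<close>;
  linear combinations of points of the torus are formed on representatives.\<close>

definition torsion_basis :: "nat \<Rightarrow> (complex^2) set \<Rightarrow> (2+2 \<Rightarrow> (complex^2) set) \<Rightarrow> bool" where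
  "torsion_basis N L U \<longleftrightarrow>
     (\<forall>i. U i \<in> torsion_pts N L) \<and>
     (\<forall>P\<in>torsion_pts N L. \<exists>!k::2+2 \<Rightarrow> nat. (\<forall>i. k i < N) \<and>
        (\<exists>u. (\<forall>i. u i \<in> U i) \<and> P = torus_pt L (\<Sum>i\<in>UNIV. real (k i) *\<^sub>R u i)))"

definition is_lift ::
    "nat \<Rightarrow> (complex^2) set \<Rightarrow> (complex^2 \<Rightarrow> complex^2 \<Rightarrow> complex) \<Rightarrow>
     (2+2 \<Rightarrow> (complex^2) set) \<Rightarrow> (2+2 \<Rightarrow> complex^2) \<Rightarrow> bool" where
  "is_lift N L H U b \<longleftrightarrow>
     symplectic_basis L H b \<and> (\<forall>i. U i = torus_pt L ((1 / real N) *\<^sub>R b i))"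

definition level_structure ::
    "nat \<Rightarrow> (complex^2) set \<Rightarrow> (complex^2 \<Rightarrow> complex^2 \<Rightarrow> complex) \<Rightarrow>
     (2+2 \<Rightarrow> (complex^2) set) \<Rightarrow> bool" where
  "level_structure N L H U \<longleftrightarrow> torsion_basis N L U \<and> (\<exists>b. is_lift N L H U b)"

definition compatible_level ::
    "int \<Rightarrow> nat \<Rightarrow> (complex^2) set \<Rightarrow> (complex^2 \<Rightarrow> complex^2 \<Rightarrow> complex) \<Rightarrow>
     (complex^2 \<Rightarrow> complex^2) \<Rightarrow> (2+2 \<Rightarrow> (complex^2) set) \<Rightarrow> bool" where
  "compatible_level d N L H k U \<longleftrightarrow>
     (\<exists>b. is_lift N L H U b \<and>
        (\<forall>x. real N *\<^sub>R x \<in> int_vecs \<longrightarrow>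
           k (frame b x) - frame b (transpose (N_beta d) *v x) \<in> L))"

record surface_data =
  lat :: "(complex^2) set"
  herm :: "complex^2 \<Rightarrow> complex^2 \<Rightarrow> complex"
  kap :: "complex^2 \<Rightarrow> complex^2"
  lev :: "2+2 \<Rightarrow> (complex^2) set"

definition moduli_objects :: "int \<Rightarrow> nat \<Rightarrow> surface_data set" where
  "moduli_objects d N = {S.
     pp_abelian_surface (lat S) (herm S) \<and>
     antiholomorphic_mult d (lat S) (herm S) (kap S) \<and>
     level_structure N (lat S) (herm S) (lev S) \<and>
     compatible_level d N (lat S) (herm S) (kap S) (lev S)}"

definition moduli_iso :: "nat \<Rightarrow> surface_data \<Rightarrow> surface_data \<Rightarrow> bool" where
  "moduli_iso N S S' \<longleftrightarrow>
     (\<exists>f::complex^2 \<Rightarrow> complex^2.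
        Vector_Spaces.linear (*s) (*s) f \<and> bij f \<and>
        f ` lat S = lat S' \<and>
        (\<forall>u v. herm S (inv_into UNIV f u) (inv_into UNIV f v) = herm S' u v) \<and>
        f \<circ> kap S \<circ> inv_into UNIV f = kap S' \<and>
        (\<exists>b b'. is_lift N (lat S) (herm S) (lev S) b \<and>
                is_lift N (lat S') (herm S') (lev S') b' \<and>
                (\<forall>i. f ((1 / real N) *\<^sub>R b i) - (1 / real N) *\<^sub>R b' i \<in> lat S')))"

definition moduli_rel :: "int \<Rightarrow> nat \<Rightarrow> (surface_data \<times> surface_data) set" where
  "moduli_rel d N =
     {(S, S'). S \<in> moduli_objects d N \<and> S' \<in> moduli_objects d N \<and> moduli_iso N S S'}"

definition moduli_space :: "int \<Rightarrow> nat \<Rightarrow> surface_data set set" where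
  "moduli_space d N = moduli_objects d N // moduli_rel d N"


section \<open>The surface attached to a real point of the Siegel space\<close>

definition F_Z :: "complex^2^2 \<Rightarrow> real^(2+2) \<Rightarrow> complex^2" where
  "F_Z Z x = Z *v (\<chi> a. of_real (x $ Inl a)) + (\<chi> a. of_real (x $ Inr a))"

definition L_Z :: "complex^2^2 \<Rightarrow> (complex^2) set" where
  "L_Z Z = F_Z Z ` int_vecs"

definition H_Z :: "complex^2^2 \<Rightarrow> complex^2 \<Rightarrow> complex^2 \<Rightarrow> complex" where
  "H_Z Z u v =
     (\<Sum>a\<in>UNIV. u $ a *
        (map_matrix of_real (matrix_inv (map_matrix Im Z)) *v (\<chi> c. cnj (v $ c))) $ a)"

definition kappa_Z :: "int \<Rightarrow> complex^2^2 \<Rightarrow> mat4 \<Rightarrow> complex^2 \<Rightarrow> complex^2" where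
  "kappa_Z d Z g = F_Z Z \<circ> (\<lambda>x. transpose (N_beta d ** g) *v x) \<circ> inv_into UNIV (F_Z Z)"

text \<open>The element \<open>g\<close> of the arithmetic group that carries \<open>Z\<close> to its image under the
  involution is determined by \<open>Z\<close>; it is kept as an explicit argument.\<close>

definition A_Z :: "int \<Rightarrow> nat \<Rightarrow> complex^2^2 \<Rightarrow> mat4 \<Rightarrow> surface_data" where
  "A_Z d N Z g =
     \<lparr>lat = L_Z Z, herm = H_Z Z, kap = kappa_Z d Z g,
      lev = (\<lambda>i. torus_pt (L_Z Z) (F_Z Z ((1 / real N) *\<^sub>R axis i 1)))\<rparr>"

end

(*
The period map F_Z(x, y) = Z x + y satisfies F_Z o g^t = P F_{gZ} with P = (C Z + D)^t, and gZ is
characterised by this relation; moreover F_{hat Z} o N_beta^t = beta o conj o F_Z.  Every symplectic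
frame of a positive definite Hermitian form is P F_Z for exactly one Z (period_normal_form), which
turns statements about the Siegel space into statements about 4 x 4 matrices.

If g in Gamma_N carries Z to hat Z, then hat(g) g fixes Z and is trivial, since Gamma(N) is
torsion-free for N >= 3: if 1 + N E is an isometry of a positive definite form and E is integral,
then E contracts the form by 4 / N^2 < 1, so E is nilpotent, and a unipotent isometry is trivial.
This gives the axioms of anti-holomorphic multiplication.  Injectivity is a comparison of frames.

For surjectivity, an anti-holomorphic multiplication has in a compatible symplectic basis an
integral matrix K = [P, R; S, P^t], P = [a, b; c, -a], R and S skew with entries r and s,
a^2 + bc - rs = d, and K = N_beta^t mod N.  One needs M in Gamma(N) such that K' = M^-1 K M has
K' N_beta^t = d mod d N, for then (N_beta K'^t) / d is the required element of Gamma_N.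
Elementary symplectic matrices in Gamma(N) first make c prime to d (d is square-free, so no prime
p | d can have p | a, b, c, r, s) and then, with pivot c, normalise the other entries modulo d N.
*)
theory Submission
  imports Defs
begin

section \<open>Integral symplectic matrices\<close>

text \<open>The obstacle in surjectivity is that \<open>N_beta\<close> is invertible only after
  division by d. If K is the matrix of the multiplication, K = g^t \<open>N_beta\<close>^t forces
  g^t = K \<open>N_beta\<close>^t / d. Compatibility with the level structure gives K
  \<open>N_beta\<close>^t = d only modulo N, whereas integrality and g = 1 modulo N ask for it
  modulo d N. What is free is the lift of the level structure, that is, conjugation by Gamma(N). The
  trace-free self-adjoint K form a lattice of rank five on which K^2 is the scalar a^2 + bc - rs, a
  quadratic form of signature (3, 2), and conjugation acts by isometries. The task is to move a
  vector of norm d by elementary isometries trivial modulo N; b need not be steered, as the norm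
  equation determines it. The condition hat Z = g Z is exactly antilinearity of the multiplication:
  \<open>F_Z\<close> is the identity on the second summand for every period matrix, and an
  antilinear map is determined by its values on real vectors.\<close>

declare transpose_matrix_vector [simp del]

lemma sum_UNIV_2_plus_2: "(\<Sum>i\<in>(UNIV::(2+2) set). f i) = f (Inl 1) + f (Inl 2) + (f (Inr 1) + f (Inr 2))"
proof -
  have "(\<Sum>i\<in>(UNIV::(2+2) set). f i) = (\<Sum>i\<in>(UNIV::2 set) <+> (UNIV::2 set). f i)"
    by simp
  also have "\<dots> = (\<Sum>i\<in>UNIV. f (Inl i)) + (\<Sum>i\<in>UNIV. f (Inr i))"
    by (subst sum.Plus) (simp_all del: UNIV_Plus_UNIV add: o_def)
  finally show ?thesis by (simp add: sum_2)
qed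

lemma forall_2_plus_2:
  "(\<forall>i::2+2. P i) \<longleftrightarrow> P (Inl 1) \<and> P (Inl 2) \<and> P (Inr 1) \<and> P (Inr 2)"
proof safe
  fix i :: "2+2"
  assume P: "P (Inl 1)" "P (Inl 2)" "P (Inr 1)" "P (Inr 2)"
  have "\<forall>a::2. P (Inl a)" "\<forall>a::2. P (Inr a)" by (simp_all add: forall_2 P)
  then show "P i" by (cases i) simp_all
qed simp_all

lemma block_nth [simp]:
  "block A B C D $ Inl a $ Inl b = A $ a $ b"
  "block A B C D $ Inl a $ Inr b = B $ a $ b"
  "block A B C D $ Inr a $ Inl b = C $ a $ b"
  "block A B C D $ Inr a $ Inr b = D $ a $ b"
  by (simp_all add: block_def)

text \<open>Expands an identity between matrices of these fixed sizes into ring identities between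
  entries.\<close>

lemmas matrix_entries =
  vec_eq_iff forall_2 forall_2_plus_2 matrix_matrix_mult_def matrix_vector_mult_def
  transpose_def mat_def sum_2 sum_UNIV_2_plus_2

definition symp_form :: mat4 where
  "symp_form = block 0 (mat 1) (- mat 1) 0"

lemma symp_form_sq: "symp_form ** symp_form = - mat 1"
  by (simp add: symp_form_def matrix_entries)

lemma Sp4_real_iff: "g \<in> Sp4_real \<longleftrightarrow> transpose g ** symp_form ** g = symp_form"
  by (simp add: Sp4_real_def blkA_def blkB_def blkC_def blkD_def sym_mat_def symp_form_def
      matrix_entries) (auto simp: algebra_simps)

lemma minus_matrix_mult [simp]:
  fixes A :: "'a::ring_1^'n^'m" and B :: "'a^'p^'n"
  shows "(- A) ** B = - (A ** B)" "A ** (- B) = - (A ** B)"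
  by (simp_all add: matrix_matrix_mult_def vec_eq_iff sum_negf)

lemma minus_matrix_vector_mult [simp]:
  fixes A :: "'a::ring_1^'n^'m"
  shows "(- A) *v x = - (A *v x)" "A *v (- x) = - (A *v x)"
  by (simp_all add: matrix_vector_mult_def vec_eq_iff sum_negf)

lemma matrix_scaleR_mult [simp]:
  fixes A :: "'a::real_algebra_1^'n^'m" and B :: "'a^'p^'n"
  shows "(k *\<^sub>R A) ** B = k *\<^sub>R (A ** B)" "A ** (k *\<^sub>R B) = k *\<^sub>R (A ** B)"
  by (simp_all add: matrix_matrix_mult_def vec_eq_iff scaleR_sum_right)

lemma matrix_add_distrib_right:
  fixes A :: "'a::semiring_1^'n^'m" and C :: "'a^'p^'n"
  shows "(A + B) ** C = A ** C + B ** C"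
  by (simp add: matrix_matrix_mult_def vec_eq_iff sum.distrib distrib_right)

lemma matrix_inv_unique:
  fixes A :: "'a::field^'n^'n"
  assumes "A ** B = mat 1"
  shows "matrix_inv A = B"
proof -
  have BA: "B ** A = mat 1" using assms by (simp add: matrix_left_right_inverse)
  have "A ** matrix_inv A = mat 1 \<and> matrix_inv A ** A = mat 1"
    unfolding matrix_inv_def by (rule someI) (use assms BA in blast)
  then have "B ** (A ** matrix_inv A) = B" by simp
  then show ?thesis by (simp add: matrix_mul_assoc BA)
qed

text \<open>The classical inverse -J g^t J of a symplectic matrix. Built without division, it
  visibly keeps integrality and congruence to 1 modulo N.\<close>

definition symp_inv :: "mat4 \<Rightarrow> mat4" where
  "symp_inv g = - (symp_form ** transpose g ** symp_form)"

lemma symp_inv: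
  assumes "g \<in> Sp4_real"
  shows "symp_inv g ** g = mat 1" "g ** symp_inv g = mat 1"
proof -
  have "symp_inv g ** g = - (symp_form ** (transpose g ** symp_form ** g))"
    by (simp add: symp_inv_def matrix_mul_assoc)
  then show "symp_inv g ** g = mat 1"
    using assms by (simp add: Sp4_real_iff symp_form_sq)
  then show "g ** symp_inv g = mat 1"
    by (simp add: matrix_left_right_inverse)
qed

text \<open>As the inverse is explicit, g times its inverse reads g J g^t J = -1, which is the
  relation for g^t. Transposes matter because periods transform by g^t.\<close>

lemma Sp4_real_transpose:
  assumes "g \<in> Sp4_real"
  shows "transpose g \<in> Sp4_real"
proof -
  have "g ** symp_form ** transpose g ** symp_form = - mat 1"
    using symp_inv(2)[OF assms] by (simp add: symp_inv_def matrix_mul_assoc neg_equal_iff_equal)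
      (metis add.inverse_inverse)
  then have "g ** symp_form ** transpose g ** symp_form ** symp_form = - symp_form"
    by simp
  then have "- (g ** symp_form ** transpose g) = - symp_form"
    by (simp add: symp_form_sq flip: matrix_mul_assoc)
  then show ?thesis by (simp add: Sp4_real_iff)
qed

lemma Sp4_real_mult:
  assumes "g \<in> Sp4_real" "h \<in> Sp4_real"
  shows "g ** h \<in> Sp4_real"
proof -
  have "transpose (g ** h) ** symp_form ** (g ** h)
      = transpose h ** (transpose g ** symp_form ** g) ** h"
    by (simp add: matrix_transpose_mul matrix_mul_assoc)
  then show ?thesis using assms by (simp add: Sp4_real_iff)
qed

lemma Sp4_real_1: "mat 1 \<in> Sp4_real"
  by (simp add: Sp4_real_iff)

lemma Sp4_real_inv:
  assumes "g \<in> Sp4_real"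
  shows "symp_inv g \<in> Sp4_real"
proof -
  have "transpose (symp_inv g) ** symp_form ** symp_inv g
      = transpose (symp_inv g) ** (transpose g ** symp_form ** g) ** symp_inv g"
    using assms by (simp add: Sp4_real_iff)
  also have "\<dots> = transpose (g ** symp_inv g) ** symp_form ** (g ** symp_inv g)"
    by (simp add: matrix_transpose_mul matrix_mul_assoc)
  finally show ?thesis by (simp add: Sp4_real_iff symp_inv[OF assms])
qed

section \<open>Integral matrices and the congruence subgroup Gamma(N)\<close>

definition int_mat :: "real^'n^'m \<Rightarrow> bool" where
  "int_mat E \<longleftrightarrow> (\<forall>i j. E $ i $ j \<in> \<int>)"

lemma int_mat_mult: "int_mat A \<Longrightarrow> int_mat B \<Longrightarrow> int_mat (A ** B)"
  by (auto simp: int_mat_def matrix_matrix_mult_def intro!: Ints_sum Ints_mult)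

lemma int_mat_add: "int_mat A \<Longrightarrow> int_mat B \<Longrightarrow> int_mat (A + B)"
  by (auto simp: int_mat_def)

lemma int_mat_minus: "int_mat A \<Longrightarrow> int_mat (- A)"
  by (auto simp: int_mat_def)

lemma int_mat_transpose: "int_mat A \<Longrightarrow> int_mat (transpose A)"
  by (auto simp: int_mat_def transpose_def)

lemma int_mat_of_int: "int_mat A \<Longrightarrow> k \<in> \<int> \<Longrightarrow> int_mat (k *\<^sub>R A)"
  by (auto simp: int_mat_def)

lemma int_mat_mat_1: "int_mat (mat 1)"
  by (auto simp: int_mat_def mat_def)

lemma int_mat_symp_form: "int_mat symp_form"
  by (simp add: int_mat_def symp_form_def forall_2_plus_2 mat_def)

lemma int_vecs_matrix_mult: "int_mat A \<Longrightarrow> x \<in> int_vecs \<Longrightarrow> A *v x \<in> int_vecs"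
  by (auto simp: int_mat_def int_vecs_def matrix_vector_mult_def intro!: Ints_sum Ints_mult)

lemma int_vecs_closed:
  "x \<in> int_vecs \<Longrightarrow> y \<in> int_vecs \<Longrightarrow> x + y \<in> int_vecs"
  "x \<in> int_vecs \<Longrightarrow> y \<in> int_vecs \<Longrightarrow> x - y \<in> int_vecs"
  "x \<in> int_vecs \<Longrightarrow> - x \<in> int_vecs"
  "0 \<in> int_vecs" "axis i 1 \<in> int_vecs"
  by (auto simp: int_vecs_def axis_def)

lemma matrix_mult_axis_nth:
  fixes A :: "'a::semiring_1^'n^'m"
  shows "(A *v axis j 1) $ i = A $ i $ j"
  by (simp add: matrix_vector_mult_def axis_def if_distrib cong: if_cong)

text \<open>Collecting the entrywise congruences in one integral matrix \<open>E\<close> turns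
  closure properties into matrix algebra with 1 + N E.\<close>

lemma principal_congruence_iff:
  "g \<in> principal_congruence N \<longleftrightarrow>
     g \<in> Sp4_real \<and> (\<exists>E. int_mat E \<and> g = mat 1 + real N *\<^sub>R E)"
proof
  assume g: "g \<in> principal_congruence N"
  then have "\<forall>i j. \<exists>k::int. g $ i $ j - mat 1 $ i $ j = of_int (int N * k)"
    by (simp add: principal_congruence_def)
  then obtain k :: "_ \<Rightarrow> _ \<Rightarrow> int" where k: "g $ i $ j - mat 1 $ i $ j = of_int (int N * k i j)" for i j
    by metis
  have "g = mat 1 + real N *\<^sub>R (\<chi> i j. of_int (k i j))"
    using k by (simp add: vec_eq_iff algebra_simps)
  moreover have "int_mat (\<chi> i j. of_int (k i j))" by (simp add: int_mat_def)
  ultimately show "g \<in> Sp4_real \<and> (\<exists>E. int_mat E \<and> g = mat 1 + real N *\<^sub>R E)"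
    using g by (auto simp: principal_congruence_def Sp4_int_def)
next
  assume "g \<in> Sp4_real \<and> (\<exists>E. int_mat E \<and> g = mat 1 + real N *\<^sub>R E)"
  then obtain E where g: "g \<in> Sp4_real" and E: "int_mat E" "g = mat 1 + real N *\<^sub>R E" by blast
  have "int_mat g"
    unfolding E(2) by (intro int_mat_add int_mat_of_int E(1) int_mat_mat_1) simp
  moreover have "\<exists>k::int. g $ i $ j - mat 1 $ i $ j = of_int (int N * k)" for i j
  proof -
    have "E $ i $ j \<in> \<int>" using E(1) by (simp add: int_mat_def)
    then obtain k where "E $ i $ j = of_int k" by (auto elim: Ints_cases)
    then show ?thesis by (intro exI[of _ k]) (simp add: E(2))
  qed
  ultimately show "g \<in> principal_congruence N"
    using g by (simp add: principal_congruence_def Sp4_int_def int_mat_def)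
qed

lemma principal_congruence_Sp4: "g \<in> principal_congruence N \<Longrightarrow> g \<in> Sp4_real"
  by (simp add: principal_congruence_iff)

lemma principal_congruence_int_mat: "g \<in> principal_congruence N \<Longrightarrow> int_mat g"
  by (simp add: principal_congruence_def Sp4_int_def int_mat_def)

lemma principal_congruence_1: "mat 1 \<in> principal_congruence N"
  unfolding principal_congruence_iff
  by (intro conjI Sp4_real_1 exI[of _ 0]) (simp_all add: int_mat_def)

lemma principal_congruence_mult:
  assumes "g \<in> principal_congruence N" "h \<in> principal_congruence N"
  shows "g ** h \<in> principal_congruence N"
proof -
  obtain E F where E: "int_mat E" "g = mat 1 + real N *\<^sub>R E"
    and F: "int_mat F" "h = mat 1 + real N *\<^sub>R F"
    using assms by (auto simp: principal_congruence_iff)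
  have "g ** h = h + (real N *\<^sub>R E) ** h"
    by (simp add: E(2) matrix_add_distrib_right)
  also have "\<dots> = mat 1 + real N *\<^sub>R (F + E ** h)"
    by (subst (1) F(2)) (simp add: algebra_simps)
  moreover have "int_mat (F + E ** h)"
    by (intro int_mat_add int_mat_mult E F principal_congruence_int_mat[OF assms(2)])
  moreover have "g ** h \<in> Sp4_real"
    using assms Sp4_real_mult principal_congruence_Sp4 by blast
  ultimately show ?thesis
    unfolding principal_congruence_iff by metis
qed

lemma principal_congruence_transpose:
  assumes "g \<in> principal_congruence N"
  shows "transpose g \<in> principal_congruence N"
proof -
  obtain E where E: "int_mat E" "g = mat 1 + real N *\<^sub>R E"
    using assms by (auto simp: principal_congruence_iff)
  have "transpose g = mat 1 + real N *\<^sub>R transpose E"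
    by (simp add: E(2) vec_eq_iff transpose_def mat_def)
  then show ?thesis
    using assms int_mat_transpose[OF E(1)] Sp4_real_transpose[of g] unfolding principal_congruence_iff by blast
qed

lemma principal_congruence_inv:
  assumes "g \<in> principal_congruence N"
  shows "symp_inv g \<in> principal_congruence N"
proof -
  obtain E where E: "int_mat E" "transpose g = mat 1 + real N *\<^sub>R E"
    using principal_congruence_transpose[OF assms] by (auto simp: principal_congruence_iff)
  have "symp_inv g = mat 1 + real N *\<^sub>R - (symp_form ** E ** symp_form)"
    by (simp add: symp_inv_def E(2) matrix_add_ldistrib matrix_add_distrib_right symp_form_sq)
  moreover have "int_mat (- (symp_form ** E ** symp_form))"
    by (intro int_mat_minus int_mat_mult int_mat_symp_form E)
  moreover have "symp_inv g \<in> Sp4_real"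
    using assms Sp4_real_inv principal_congruence_Sp4 by blast
  ultimately show ?thesis
    unfolding principal_congruence_iff by blast
qed

section \<open>The involution on the symplectic group\<close>

lemma beta_sq: "beta d ** beta d = of_int d *\<^sub>R mat 1"
proof -
  have "d mod 4 = 1 \<Longrightarrow> (of_int d::real) = 1 + 4 * of_int (d div 4)"
    using mult_div_mod_eq[of 4 d] by (metis add.commute of_int_1 of_int_add of_int_mult of_int_numeral)
  then show ?thesis
    by (simp add: beta_def matrix_entries)
qed

lemma int_mat_beta: "int_mat (beta d)"
  by (simp add: int_mat_def beta_def forall_2)

lemma transpose_block: "transpose (block A B C D) =
    block (transpose A) (transpose C) (transpose B) (transpose D)"
  by (simp add: matrix_entries)

lemma block_mult: "block A B C D ** block A' B' C' D' =
    block (A ** A' + B ** C') (A ** B' + B ** D') (C ** A' + D ** C') (C ** B' + D ** D')"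
  by (simp add: matrix_entries)

lemma block_scaleR: "k *\<^sub>R block A B C D = block (k *\<^sub>R A) (k *\<^sub>R B) (k *\<^sub>R C) (k *\<^sub>R D)"
  by (simp add: matrix_entries)

lemma block_1: "block (mat 1) 0 0 (mat 1) = mat 1"
  by (simp add: matrix_entries)

lemma N_beta_sq: "N_beta d ** N_beta d = of_int d *\<^sub>R mat 1"
  by (simp add: N_beta_def block_mult beta_sq matrix_transpose_mul[symmetric] transpose_scalar
      block_scaleR block_1[symmetric])

lemma int_mat_N_beta: "int_mat (N_beta d)"
  using int_mat_beta[of d]
  by (simp add: int_mat_def N_beta_def forall_2_plus_2 forall_2 transpose_def)

text \<open>\<open>N_beta\<close> is a similitude of multiplier d; this is why conjugation by it
  preserves the symplectic group, to which it does not belong in general.\<close>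

lemma N_beta_symp_form:
  "transpose (N_beta d) ** symp_form ** N_beta d = of_int d *\<^sub>R symp_form"
proof -
  have "transpose (0::real^2^2) = 0" by (simp add: transpose_def vec_eq_iff)
  then show ?thesis
    by (simp add: N_beta_def symp_form_def transpose_block block_mult block_scaleR beta_sq
        matrix_transpose_mul[symmetric] transpose_scalar)
qed

lemma hat_Sp_eq:
  assumes "d \<noteq> 0"
  shows "hat_Sp d g = (1 / of_int d) *\<^sub>R (N_beta d ** g ** N_beta d)"
proof -
  have "matrix_inv (N_beta d) = (1 / of_int d) *\<^sub>R N_beta d"
    by (rule matrix_inv_unique) (use assms in \<open>simp add:  N_beta_sq\<close>)
  then show ?thesis by (simp add: hat_Sp_def )
qed

lemma hat_Sp_N_beta:
  assumes "d \<noteq> 0"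
  shows "hat_Sp d g ** N_beta d = N_beta d ** g" "N_beta d ** hat_Sp d g = g ** N_beta d"
  using assms
  by (simp_all add: hat_Sp_eq  N_beta_sq
      matrix_mul_assoc[of _ "N_beta d" "N_beta d", symmetric])
     (simp add: matrix_mul_assoc N_beta_sq)

text \<open>Right multiplication by \<open>N_beta\<close> can be cancelled because its square is d.
  Multiplicativity and involutivity of the hat are then checked on the intertwining relation, with
  no inverse matrix.\<close>

lemma hat_Sp_unique:
  assumes "d \<noteq> 0" "h ** N_beta d = N_beta d ** g"
  shows "h = hat_Sp d g"
proof -
  have "h ** N_beta d ** N_beta d = hat_Sp d g ** N_beta d ** N_beta d"
    by (simp add: assms hat_Sp_N_beta)
  then show ?thesis
    using assms(1) by (simp add: N_beta_sq  flip: matrix_mul_assoc)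
qed

lemma hat_Sp_hat_Sp: "d \<noteq> 0 \<Longrightarrow> hat_Sp d (hat_Sp d g) = g"
  by (rule hat_Sp_unique[symmetric]) (simp_all add: hat_Sp_N_beta)

lemma hat_Sp_mult: "d \<noteq> 0 \<Longrightarrow> hat_Sp d (g ** h) = hat_Sp d g ** hat_Sp d h"
  by (rule hat_Sp_unique[symmetric])
     (simp_all add: hat_Sp_N_beta(1) matrix_mul_assoc flip: matrix_mul_assoc[of "hat_Sp d g"])

lemma hat_Sp_1: "d \<noteq> 0 \<Longrightarrow> hat_Sp d (mat 1) = mat 1"
  by (rule hat_Sp_unique[symmetric]) simp_all

lemma hat_Sp_Sp4_real:
  assumes "d \<noteq> 0" "g \<in> Sp4_real"
  shows "hat_Sp d g \<in> Sp4_real"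
proof -
  let ?B = "N_beta d"
  let ?h = "hat_Sp d g"
  have "transpose ?B ** (transpose ?h ** symp_form ** ?h) ** ?B
      = transpose (?h ** ?B) ** symp_form ** (?h ** ?B)"
    by (simp add: matrix_transpose_mul matrix_mul_assoc)
  also have "\<dots> = transpose g ** (transpose ?B ** symp_form ** ?B) ** g"
    using assms(1) by (simp add: hat_Sp_N_beta matrix_transpose_mul matrix_mul_assoc)
  also have "\<dots> = transpose ?B ** symp_form ** ?B"
    using assms(2) by (simp add: N_beta_symp_form Sp4_real_iff)
  finally have *: "transpose ?B ** (transpose ?h ** symp_form ** ?h) ** ?B
      = transpose ?B ** symp_form ** ?B" .
  \<comment> \<open>One more factor \<open>N_beta\<close> on either side completes squares, so that
    only the scalar d has to be cancelled.\<close>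
  have "transpose (?B ** ?B) ** (transpose ?h ** symp_form ** ?h) ** (?B ** ?B)
      = transpose ?B ** (transpose ?B ** (transpose ?h ** symp_form ** ?h) ** ?B) ** ?B"
    by (simp only: matrix_transpose_mul matrix_mul_assoc)
  also have "\<dots> = transpose ?B ** (transpose ?B ** symp_form ** ?B) ** ?B"
    by (simp only: *)
  also have "\<dots> = transpose (?B ** ?B) ** symp_form ** (?B ** ?B)"
    by (simp only: matrix_transpose_mul matrix_mul_assoc)
  finally show ?thesis
    using assms(1) by (simp add: N_beta_sq transpose_scalar Sp4_real_iff)
qed

lemma Gamma_N_iff:
  assumes "d \<noteq> 0"
  shows "g \<in> Gamma_N d N \<longleftrightarrow> g \<in> principal_congruence N \<and> hat_Sp d g \<in> principal_congruence N"
proof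
  assume "g \<in> Gamma_N d N"
  then show "g \<in> principal_congruence N \<and> hat_Sp d g \<in> principal_congruence N"
    by (auto simp: Gamma_N_def hat_Sp_hat_Sp[OF assms])
next
  assume "g \<in> principal_congruence N \<and> hat_Sp d g \<in> principal_congruence N"
  then show "g \<in> Gamma_N d N"
    unfolding Gamma_N_def by (metis IntI hat_Sp_hat_Sp[OF assms] imageI)
qed

lemma Gamma_N_Sp4: "g \<in> Gamma_N d N \<Longrightarrow> g \<in> Sp4_real"
  by (auto simp: Gamma_N_def principal_congruence_Sp4)

lemma Gamma_N_hat: "d \<noteq> 0 \<Longrightarrow> g \<in> Gamma_N d N \<Longrightarrow> hat_Sp d g \<in> Gamma_N d N"
  by (simp add: Gamma_N_iff hat_Sp_hat_Sp)

lemma Gamma_N_1: "d \<noteq> 0 \<Longrightarrow> mat 1 \<in> Gamma_N d N"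
  by (simp add: Gamma_N_iff hat_Sp_1 principal_congruence_1)

lemma Gamma_N_mult: "d \<noteq> 0 \<Longrightarrow> g \<in> Gamma_N d N \<Longrightarrow> h \<in> Gamma_N d N \<Longrightarrow> g ** h \<in> Gamma_N d N"
  by (simp add: Gamma_N_iff hat_Sp_mult principal_congruence_mult)

lemma symp_inv_unique:
  assumes "g \<in> Sp4_real" "h ** g = mat 1"
  shows "h = symp_inv g"
proof -
  have "h ** (g ** symp_inv g) = symp_inv g"
    using assms(2) by (simp add: matrix_mul_assoc)
  then show ?thesis by (simp add: symp_inv[OF assms(1)])
qed

lemma hat_Sp_symp_inv:
  assumes "d \<noteq> 0" "g \<in> Sp4_real"
  shows "hat_Sp d (symp_inv g) = symp_inv (hat_Sp d g)"
  by (rule symp_inv_unique)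
     (use assms in \<open>simp_all add: hat_Sp_Sp4_real hat_Sp_mult[symmetric] symp_inv hat_Sp_1\<close>)

lemma Gamma_N_inv: "d \<noteq> 0 \<Longrightarrow> g \<in> Gamma_N d N \<Longrightarrow> symp_inv g \<in> Gamma_N d N"
  using hat_Sp_symp_inv principal_congruence_inv principal_congruence_Sp4
  by (metis Gamma_N_iff)

section \<open>Period matrices of principally polarized lattices\<close>

definition top_part :: "real^(2+2) \<Rightarrow> real^2" where "top_part x = (\<chi> a. x $ Inl a)"
definition bot_part :: "real^(2+2) \<Rightarrow> real^2" where "bot_part x = (\<chi> a. x $ Inr a)"
definition join :: "real^2 \<Rightarrow> real^2 \<Rightarrow> real^(2+2)" where
  "join x y = (\<chi> i. case i of Inl a \<Rightarrow> x $ a | Inr a \<Rightarrow> y $ a)"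

definition cvec :: "real^'n \<Rightarrow> complex^'n" where "cvec x = (\<chi> a. of_real (x $ a))"
definition re_vec :: "complex^'n \<Rightarrow> real^'n" where "re_vec u = (\<chi> a. Re (u $ a))"
definition im_vec :: "complex^'n \<Rightarrow> real^'n" where "im_vec u = (\<chi> a. Im (u $ a))"
definition cnj_vec :: "complex^'n \<Rightarrow> complex^'n" where "cnj_vec u = (\<chi> a. cnj (u $ a))"

lemma join_parts [simp]:
  "top_part (join x y) = x" "bot_part (join x y) = y" "join (top_part z) (bot_part z) = z"
  by (simp_all add: top_part_def bot_part_def join_def vec_eq_iff forall_2_plus_2)

lemma vec_parts_eqI: "re_vec u = re_vec v \<Longrightarrow> im_vec u = im_vec v \<Longrightarrow> u = v"
  by (simp add: re_vec_def im_vec_def vec_eq_iff complex_eq_iff)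

lemma re_im_vec_simps [simp]:
  "re_vec (u + v) = re_vec u + re_vec v" "im_vec (u + v) = im_vec u + im_vec v"
  "re_vec (cvec x) = x" "im_vec (cvec x) = 0"
  by (simp_all add: re_vec_def im_vec_def cvec_def vec_eq_iff)

lemma re_im_vec_matrix_mult_cvec [simp]:
  "re_vec (M *v cvec x) = map_matrix Re M *v x" "im_vec (M *v cvec x) = map_matrix Im M *v x"
  by (simp_all add: re_vec_def im_vec_def cvec_def vec_eq_iff matrix_vector_mult_def)

lemma cvec_linear [simp]:
  "cvec (x + y) = cvec x + cvec y" "cvec (c *\<^sub>R x) = c *\<^sub>R cvec x" "cvec 0 = 0"
  by (simp_all add: cvec_def vec_eq_iff scaleR_conv_of_real[where 'a=complex])

lemma F_Z_eq: "F_Z Z x = Z *v cvec (top_part x) + cvec (bot_part x)"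
  by (simp add: F_Z_def cvec_def top_part_def bot_part_def)

lemma parts_linear [simp]:
  "top_part (x + y) = top_part x + top_part y" "bot_part (x + y) = bot_part x + bot_part y"
  "top_part (c *\<^sub>R x) = c *\<^sub>R top_part x" "bot_part (c *\<^sub>R x) = c *\<^sub>R bot_part x"
  by (simp_all add: top_part_def bot_part_def vec_eq_iff)

lemma complex_matrix_vector_scaleR [simp]:
  fixes M :: "complex^'n^'m"
  shows "M *v (r *\<^sub>R u) = r *\<^sub>R (M *v u)" "(r *\<^sub>R M) *v u = r *\<^sub>R (M *v u)"
  by (simp_all add: vec_eq_iff matrix_vector_mult_def scaleR_sum_right)

lemma linear_F_Z: "linear (F_Z Z)"
  by (rule linearI) (simp_all add: F_Z_eq matrix_vector_right_distrib scaleR_right_distrib)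

lemma symp_form_inner:
  "x \<bullet> (symp_form *v y) = top_part x \<bullet> bot_part y - bot_part x \<bullet> top_part y"
  by (simp add: symp_form_def inner_vec_def matrix_vector_mult_def sum_UNIV_2_plus_2 sum_2
      mat_def top_part_def bot_part_def)

lemma symp_form_nondegenerate:
  assumes "\<And>y. x \<bullet> (symp_form *v y) = 0"
  shows "x = 0"
proof -
  have "symp_form *v (- (symp_form *v x)) = x"
    by (simp add: matrix_vector_mul_assoc symp_form_sq)
  then have "x \<bullet> x = 0" using assms[of "- (symp_form *v x)"] by simp
  then show ?thesis by simp
qed

lemma Sp4_real_inner:
  assumes "g \<in> Sp4_real"
  shows "(g *v x) \<bullet> (symp_form *v (g *v y)) = x \<bullet> (symp_form *v y)"
proof -
  have "(g *v x) \<bullet> (symp_form *v (g *v y)) = x \<bullet> ((transpose g ** symp_form ** g) *v y)"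
    by (simp add: dot_lmul_matrix[symmetric] matrix_vector_mul_assoc[symmetric])
  then show ?thesis using assms by (simp add: Sp4_real_iff)
qed

lemma linear_frame: "linear (frame b)"
  by (rule linearI) (simp_all add: frame_def scaleR_left_distrib sum.distrib scaleR_sum_right)

lemma frame_axis [simp]: "frame b (axis i 1) = b i"
proof -
  have "frame b (axis i 1) = (\<Sum>j\<in>UNIV. if j = i then b j else 0)"
    unfolding frame_def by (rule sum.cong) (auto simp: axis_def)
  then show ?thesis by simp
qed

lemma linear_eq_frame:
  assumes "linear F"
  shows "F = frame (\<lambda>i. F (axis i 1))"
proof
  fix x
  have "F x = F (\<Sum>i\<in>UNIV. x $ i *\<^sub>R axis i 1)"
    using basis_expansion[of x] by (simp add: scalar_mult_eq_scaleR)
  also have "\<dots> = frame (\<lambda>i. F (axis i 1)) x"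
    by (simp add: frame_def linear_sum[OF assms] linear_scale[OF assms])
  finally show "F x = frame (\<lambda>i. F (axis i 1)) x" .
qed

section \<open>Positive definite Hermitian forms and symplectic frames\<close>

lemma pos_def_hermitian_bilinear:
  assumes "pos_def_hermitian H"
  shows "H (u + u') v = H u v + H u' v" "H (c *s u) v = c * H u v"
    "H v (u + u') = H v u + H v u'" "H v (c *s u) = cnj c * H v u"
    "H v u = cnj (H u v)"
proof -
  have lin: "Vector_Spaces.linear (*s) (*) (\<lambda>u. H u v)" for v
    using assms unfolding pos_def_hermitian_def by blast
  have herm: "H v u = cnj (H u v)" for u v
    using assms unfolding pos_def_hermitian_def by blast
  show add: "H (u + u') v = H u v + H u' v" for u u' v
    using Vector_Spaces.linear.axioms(3)[OF lin[of v]] by (simp add: module_hom_def module_hom_axioms_def)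
  show scale: "H (c *s u) v = c * H u v" for c u v
    using Vector_Spaces.linear.axioms(3)[OF lin[of v]] by (simp add: module_hom_def module_hom_axioms_def)
  show "H v (u + u') = H v u + H v u'"
    by (subst (1 2 3) herm) (simp add: add)
  show "H v (c *s u) = cnj c * H v u"
    by (subst (1 2) herm) (simp add: scale)
  show "H v u = cnj (H u v)" by (rule herm)
qed

lemma pos_def_hermitian_pos: "pos_def_hermitian H \<Longrightarrow> u \<noteq> 0 \<Longrightarrow> 0 < Re (H u u)"
  unfolding pos_def_hermitian_def by blast

lemma scaleR_eq_scale_of_real: "r *\<^sub>R (u::complex^'n) = of_real r *s u"
  by (simp add: vec_eq_iff scaleR_conv_of_real[where 'a=complex])

lemma pos_def_hermitian_scaleR:
  assumes "pos_def_hermitian H"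
  shows "H (r *\<^sub>R u) v = of_real r * H u v" "H v (r *\<^sub>R u) = of_real r * H v u"
  by (simp_all only: scaleR_eq_scale_of_real pos_def_hermitian_bilinear(2,4)[OF assms]
      complex_cnj_complex_of_real)

lemma pos_def_hermitian_zero:
  assumes "pos_def_hermitian H"
  shows "H 0 v = 0" "H v 0 = 0"
  using pos_def_hermitian_scaleR(1)[OF assms, of 0 0 v] pos_def_hermitian_scaleR(2)[OF assms, of v 0 0]
  by simp_all

lemma pos_def_hermitian_sum:
  assumes "pos_def_hermitian H"
  shows "H (sum f A) v = (\<Sum>i\<in>A. H (f i) v)" "H v (sum f A) = (\<Sum>i\<in>A. H v (f i))"
  by (induction A rule: infinite_finite_induct;
      simp add: pos_def_hermitian_bilinear(1-4)[OF assms] pos_def_hermitian_zero[OF assms])+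

text \<open>Replaces the Gram matrix of a basis by the pullback of Q along the frame map; later
  arguments treat a symplectic basis as a real linear map of symplectic spaces.\<close>

lemma imag_form_frame:
  assumes "pos_def_hermitian H"
  shows "(\<forall>i j. imag_form H (b i) (b j) = symp_form $ i $ j) \<longleftrightarrow>
    (\<forall>x y. Im (H (frame b x) (frame b y)) = x \<bullet> (symp_form *v y))"
proof
  assume *: "\<forall>i j. imag_form H (b i) (b j) = symp_form $ i $ j"
  show "\<forall>x y. Im (H (frame b x) (frame b y)) = x \<bullet> (symp_form *v y)"
    using * by (simp add: frame_def pos_def_hermitian_sum[OF assms] pos_def_hermitian_scaleR[OF assms]
        imag_form_def inner_vec_def matrix_vector_mult_def sum_distrib_left mult_ac)
      (intro allI sum.swap)
next
  assume *: "\<forall>x y. Im (H (frame b x) (frame b y)) = x \<bullet> (symp_form *v y)"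
  show "\<forall>i j. imag_form H (b i) (b j) = symp_form $ i $ j"
  proof (intro allI)
    fix i j
    show "imag_form H (b i) (b j) = symp_form $ i $ j"
      using *[rule_format, of "axis i 1" "axis j 1"]
      by (simp add: imag_form_def inner_axis' matrix_mult_axis_nth)
  qed
qed

lemma pos_def_hermitian_comp:
  assumes "pos_def_hermitian H" "invertible P"
  shows "pos_def_hermitian (\<lambda>u v. H (P *v u) (P *v v))"
proof -
  note H = pos_def_hermitian_bilinear(1-4)[OF assms(1)]
  have P: "P *v u = 0 \<Longrightarrow> u = 0" for u
    using inj_matrix_vector_mult[OF assms(2)] by (metis injD matrix_vector_mult_0_right)
  have "Vector_Spaces.linear (*s) (*) (\<lambda>u. H (P *v u) (P *v v))" for v
    by unfold_locales
      (simp_all add: H algebra_simps vector_scalar_commute matrix_vector_right_distrib)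
  moreover have "H (P *v v) (P *v u) = cnj (H (P *v u) (P *v v))" for u v
    by (rule pos_def_hermitian_bilinear(5)[OF assms(1)])
  moreover have "u \<noteq> 0 \<Longrightarrow> 0 < Re (H (P *v u) (P *v u))" for u
    using P by (blast intro: pos_def_hermitian_pos[OF assms(1)])
  ultimately show ?thesis unfolding pos_def_hermitian_def by blast
qed

text \<open>The form u^t S conj(v) of a real matrix S, split into real and imaginary parts so that
  its properties become statements about real inner products.\<close>

definition real_hermitian :: "real^2^2 \<Rightarrow> complex^2 \<Rightarrow> complex^2 \<Rightarrow> complex" where
  "real_hermitian S u v = Complex
     (re_vec u \<bullet> (S *v re_vec v) + im_vec u \<bullet> (S *v im_vec v))
     (im_vec u \<bullet> (S *v re_vec v) - re_vec u \<bullet> (S *v im_vec v))"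

lemma H_Z_eq: "H_Z Z = real_hermitian (matrix_inv (map_matrix Im Z))"
  by (intro ext) (simp add: H_Z_def real_hermitian_def complex_eq_iff inner_vec_def
      matrix_vector_mult_def sum_2 re_vec_def im_vec_def algebra_simps)

lemma siegelD:
  assumes "Z \<in> siegel"
  shows "transpose Z = Z" "transpose (map_matrix Im Z) = map_matrix Im Z"
    "transpose (map_matrix Re Z) = map_matrix Re Z"
    "x \<noteq> 0 \<Longrightarrow> 0 < x \<bullet> (map_matrix Im Z *v x)"
  using assms by (auto simp: siegel_def sym_mat_def transpose_def vec_eq_iff)

lemma siegel_imag_inverse:
  assumes "Z \<in> siegel"
  shows "map_matrix Im Z ** matrix_inv (map_matrix Im Z) = mat 1"
    "matrix_inv (map_matrix Im Z) ** map_matrix Im Z = mat 1"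
    "transpose (matrix_inv (map_matrix Im Z)) = matrix_inv (map_matrix Im Z)"
proof -
  let ?Y = "map_matrix Im Z"
  have "\<forall>x. ?Y *v x = 0 \<longrightarrow> x = 0"
    using siegelD(4)[OF assms] by (metis inner_zero_right less_irrefl)
  then obtain B where "B ** ?Y = mat 1"
    by (meson matrix_left_invertible_ker)
  then have B: "?Y ** B = mat 1" by (simp add: matrix_left_right_inverse)
  then have inv: "matrix_inv ?Y = B" by (rule matrix_inv_unique)
  show "?Y ** matrix_inv ?Y = mat 1" by (simp add: inv B)
  then show "matrix_inv ?Y ** ?Y = mat 1" by (simp add: matrix_left_right_inverse)
  then have "transpose (matrix_inv ?Y ** ?Y) = mat 1" by simp
  then have "?Y ** transpose B = mat 1"
    by (simp add: matrix_transpose_mul siegelD[OF assms] inv)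
  then show "transpose (matrix_inv ?Y) = matrix_inv ?Y"
    using matrix_inv_unique inv by metis
qed

lemma inner_transpose_mult:
  fixes A :: "real^'n^'m"
  shows "x \<bullet> (transpose A *v y) = (A *v x) \<bullet> y"
  by (metis dot_lmul_matrix inner_commute transpose_matrix_vector)

lemma inner_matrix_symmetric:
  fixes S :: "real^'n^'n"
  assumes "transpose S = S"
  shows "x \<bullet> (S *v y) = (S *v x) \<bullet> y"
  by (metis assms dot_lmul_matrix transpose_matrix_vector)

text \<open>The inverse of Im Z inside \<open>H_Z\<close> cancels the factor Im Z in the imaginary
  part of Z x; the terms containing Re Z cancel because Re Z is symmetric.\<close>

lemma Im_H_Z_F_Z:
  assumes "Z \<in> siegel"
  shows "Im (H_Z Z (F_Z Z x) (F_Z Z y)) = x \<bullet> (symp_form *v y)"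
proof -
  let ?Y = "map_matrix Im Z" and ?X = "map_matrix Re Z"
  let ?S = "matrix_inv ?Y"
  note S = siegel_imag_inverse[OF assms]
  have 1: "(?Y *v a) \<bullet> (?S *v b) = a \<bullet> b" for a b
    using inner_matrix_symmetric[OF siegelD(2)[OF assms], of a]
    by (simp add: matrix_vector_mul_assoc S flip: inner_matrix_symmetric[OF siegelD(2)[OF assms]])
  have 2: "a \<bullet> (?S *v (?Y *v b)) = a \<bullet> b" for a b
    by (simp add: matrix_vector_mul_assoc S)
  show ?thesis
    by (simp add: H_Z_eq real_hermitian_def F_Z_eq symp_form_inner 1 2 inner_add_left inner_add_right
        inner_matrix_symmetric[OF siegelD(3)[OF assms]])
qed

lemma H_Z_pos_def:
  assumes "Z \<in> siegel"
  shows "pos_def_hermitian (H_Z Z)"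
proof -
  let ?Y = "map_matrix Im Z"
  let ?S = "matrix_inv ?Y"
  note S = siegel_imag_inverse[OF assms]
  have pos: "0 < x \<bullet> (?S *v x)" if "x \<noteq> 0" for x
  proof -
    have x: "x = ?Y *v (?S *v x)" by (simp add: matrix_vector_mul_assoc S)
    then have "?S *v x \<noteq> 0" using that by force
    then have "0 < (?S *v x) \<bullet> (?Y *v (?S *v x))" by (rule siegelD(4)[OF assms])
    then show ?thesis using x by (simp add: inner_commute)
  qed
  then have nonneg: "0 \<le> x \<bullet> (?S *v x)" for x
    by (cases "x = 0") (auto intro: less_imp_le)
  have sym: "a \<bullet> (?S *v b) = b \<bullet> (?S *v a)" for a b
    by (metis inner_matrix_symmetric[OF S(3)] inner_commute)
  have "Vector_Spaces.linear (*s) (*) (\<lambda>u. H_Z Z u v)" for v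
    by unfold_locales (simp_all add: H_Z_def algebra_simps sum.distrib sum_distrib_left)
  moreover have "H_Z Z v u = cnj (H_Z Z u v)" for u v
    using sym[of "re_vec v" "re_vec u"] sym[of "im_vec v" "re_vec u"]
      sym[of "re_vec v" "im_vec u"] sym[of "im_vec v" "im_vec u"]
    by (simp add: H_Z_eq real_hermitian_def complex_eq_iff)
  moreover have "0 < Re (H_Z Z u u)" if "u \<noteq> 0" for u
  proof -
    have "re_vec u \<noteq> 0 \<or> im_vec u \<noteq> 0"
      using that vec_parts_eqI[of u 0] by (auto simp: re_vec_def im_vec_def zero_vec_def)
    then show ?thesis
      using pos nonneg by (auto simp: H_Z_eq real_hermitian_def intro: add_pos_nonneg add_nonneg_pos)
  qed
  ultimately show ?thesis unfolding pos_def_hermitian_def by blast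
qed

text \<open>Injectivity is nondegeneracy of the pulled back form. For surjectivity the imaginary
  part determines x, and y then corrects the real part.\<close>

lemma bij_F_Z:
  assumes "Z \<in> siegel"
  shows "bij (F_Z Z)"
proof (rule bijI)
  let ?Y = "map_matrix Im Z"
  note S = siegel_imag_inverse[OF assms]
  show "inj (F_Z Z)"
    unfolding linear_injective_0[OF linear_F_Z]
    using Im_H_Z_F_Z[OF assms] symp_form_nondegenerate pos_def_hermitian_zero[OF H_Z_pos_def[OF assms]]
    by (metis zero_complex.simps(2))
  show "surj (F_Z Z)"
  proof (rule surjI)
    fix u
    let ?x = "matrix_inv ?Y *v im_vec u"
    show "F_Z Z (join ?x (re_vec u - map_matrix Re Z *v ?x)) = u"
      by (rule vec_parts_eqI) (simp_all add: F_Z_eq matrix_vector_mul_assoc S)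
  qed
qed

lemma hermitian_matrix_rep:
  assumes H: "pos_def_hermitian H" and real: "\<And>a b. Im (H (axis a 1) (axis b 1)) = 0"
  obtains S where "transpose S = S" "H = real_hermitian S"
proof
  let ?S = "\<chi> a b. Re (H (axis a 1) (axis b 1))"
  note * = pos_def_hermitian_bilinear(1-4)[OF H]
  have "Re (H (axis b 1) (axis a 1)) = Re (H (axis a 1) (axis b 1))" for a b
    by (subst pos_def_hermitian_bilinear(5)[OF H]) simp
  then show "transpose ?S = ?S" by (simp add: transpose_def)
  show "H = real_hermitian ?S"
  proof (intro ext)
    fix u v
    have e: "w = (\<Sum>i\<in>UNIV. w $ i *s axis i 1)" for w :: "complex^2"
      by (simp add: basis_expansion)
    have "H u v = (\<Sum>a\<in>UNIV. \<Sum>b\<in>UNIV. u $ a * cnj (v $ b) * H (axis a 1) (axis b 1))"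
      by (subst (1) e[of u], subst (1) e[of v])
        (simp add: pos_def_hermitian_sum[OF H] * sum_distrib_left mult_ac, rule sum.swap)
    then show "H u v = real_hermitian ?S u v"
      by (simp add: real_hermitian_def complex_eq_iff inner_vec_def matrix_vector_mult_def
          sum_2 re_vec_def im_vec_def real algebra_simps)
  qed
qed

lemma F_Z_join: "F_Z Z (join x y) = Z *v cvec x + cvec y"
  by (simp add: F_Z_eq)

text \<open>Each symplectic relation yields one Siegel condition. The real vectors are isotropic, so
  H has a real symmetric Gram matrix S. Pairing the two halves gives Y^t S = 1 for Y = Im W, so Y is
  symmetric with inverse S. Isotropy of the first half makes Re W symmetric, and positivity of H at
  Y x is positivity of Y at x.\<close>

lemma siegel_of_symplectic:
  assumes H: "pos_def_hermitian H"
    and symp: "\<And>x y. Im (H (F_Z W x) (F_Z W y)) = x \<bullet> (symp_form *v y)"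
  shows "W \<in> siegel" "H = H_Z W"
proof -
  let ?Y = "map_matrix Im W" and ?X = "map_matrix Re W"
  have symp': "Im (H (W *v cvec x + cvec y) (W *v cvec x' + cvec y')) = x \<bullet> y' - y \<bullet> x'"
    for x y x' y'
    using symp[of "join x y" "join x' y'"] by (simp add: F_Z_join symp_form_inner)
  have axis: "cvec (axis a 1) = (axis a 1 :: complex^2)" for a
    by (simp add: cvec_def axis_def vec_eq_iff)
  have "Im (H (axis a 1) (axis b 1)) = 0" for a b
    using symp'[of 0 "axis a 1" 0 "axis b 1"] by (simp add: axis)
  then obtain S where S: "transpose S = S" "H = real_hermitian S"
    using hermitian_matrix_rep[OF H] by blast
  have YS: "(?Y *v x) \<bullet> (S *v y) = x \<bullet> y" for x y
    using symp'[of x 0 0 y] by (simp add: S(2) real_hermitian_def)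
  have "x \<bullet> ((transpose ?Y ** S) *v y) = x \<bullet> y" for x y
    using YS[of x y] by (simp add: inner_transpose_mult flip: matrix_vector_mul_assoc)
  then have "(transpose ?Y ** S) *v y = y" for y
    using vector_eq_ldot by blast
  then have 1: "transpose ?Y ** S = mat 1" by (simp add: matrix_eq)
  then have 2: "S ** transpose ?Y = mat 1" by (simp add: matrix_left_right_inverse)
  have 3: "S ** ?Y = mat 1"
    using arg_cong[OF 1, of transpose] by (simp add: matrix_transpose_mul S)
  have Ysym: "transpose ?Y = ?Y"
    using matrix_inv_unique[OF 2] matrix_inv_unique[OF 3] by simp
  have "(?Y *v x) \<bullet> (S *v (?X *v y)) - (?X *v x) \<bullet> (S *v (?Y *v y)) = 0" for x y
    using symp'[of x 0 y 0] by (simp add: S(2) real_hermitian_def)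
  moreover have "(?X *v x) \<bullet> (S *v (?Y *v y)) = (?Y *v y) \<bullet> (S *v (?X *v x))" for x y
    by (subst inner_matrix_symmetric[OF S(1)]) (rule inner_commute)
  ultimately have "x \<bullet> (?X *v y) = y \<bullet> (?X *v x)" for x y
    by (simp add: YS)
  then have "x \<bullet> (?X *v y) = x \<bullet> (transpose ?X *v y)" for x y
    by (simp add: inner_transpose_mult inner_commute[of "?X *v x"])
  then have "?X *v y = transpose ?X *v y" for y
    using vector_eq_ldot by blast
  then have Xsym: "transpose ?X = ?X" by (simp add: matrix_eq)
  have "transpose W = W"
    using Xsym Ysym by (simp add: transpose_def vec_eq_iff complex_eq_iff)
  moreover have "0 < x \<bullet> (?Y *v x)" if "x \<noteq> 0" for x
  proof -
    have x: "S *v (?Y *v x) = x" by (simp add: matrix_vector_mul_assoc 3)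
    then have "?Y *v x \<noteq> 0" using that by force
    then have "cvec (?Y *v x) \<noteq> 0"
      by (metis re_im_vec_simps(3) cvec_linear(3))
    then have "0 < Re (H (cvec (?Y *v x)) (cvec (?Y *v x)))"
      by (rule pos_def_hermitian_pos[OF H])
    then show ?thesis by (simp add: S(2) real_hermitian_def x inner_commute)
  qed
  ultimately show "W \<in> siegel" by (simp add: siegel_def sym_mat_def)
  have "matrix_inv ?Y = S"
    using 3 matrix_left_right_inverse matrix_inv_unique by metis
  then show "H = H_Z W" by (simp add: H_Z_eq S(2))
qed

text \<open>P collects the images of f_1, f_2 and U those of e_1, e_2; then W = P^-1 U. The point to
  settle is that the images of f_1, f_2 are independent over the complex numbers, not merely over
  the reals.\<close>

lemma period_normal_form:
  assumes F: "linear F" and H: "pos_def_hermitian H"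
    and symp: "\<And>x y. Im (H (F x) (F y)) = x \<bullet> (symp_form *v y)"
  obtains P W where "invertible P" "W \<in> siegel" "\<And>x. F x = P *v F_Z W x"
    "\<And>u v. H (P *v u) (P *v v) = H_Z W u v"
proof -
  define U where "U = (\<chi> i a. F (axis (Inl a) 1) $ i)"
  define P where "P = (\<chi> i a. F (axis (Inr a) 1) $ i)"
  have FUP: "F x = U *v cvec (top_part x) + P *v cvec (bot_part x)" for x
    using fun_cong[OF linear_eq_frame[OF F], of x]
    by (simp add: frame_def sum_UNIV_2_plus_2 vec_eq_iff matrix_vector_mult_def sum_2 U_def P_def
        cvec_def top_part_def bot_part_def scaleR_conv_of_real[where 'a=complex] mult_ac)
  have FP: "F (join 0 y) = P *v cvec y" for y
    by (simp add: FUP)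
  have injF: "x = 0" if "F x = 0" for x
    by (rule symp_form_nondegenerate) (simp add: symp[symmetric] that pos_def_hermitian_zero[OF H])
  have "y = 0" if "P *v y = 0" for y
  proof -
    let ?w = "P *v cvec (im_vec y)"
    have "y = cvec (re_vec y) + \<i> *s cvec (im_vec y)"
      by (simp add: vec_eq_iff cvec_def re_vec_def im_vec_def complex_eq_iff)
    then have "P *v cvec (re_vec y) + \<i> *s ?w = 0"
      using that by (metis matrix_vector_right_distrib vector_scalar_commute)
    \<comment> \<open>Both sides lie in the isotropic image of the second summand, while Q(-i w, w)
      = -H(w, w). Hence w = 0 by positivity, and y = 0 by real injectivity of F.\<close>
    then have w: "P *v cvec (re_vec y) = (- \<i>) *s ?w"
      by (simp add: add_eq_0_iff)
    have "Im (H (F (join 0 (re_vec y))) (F (join 0 (im_vec y)))) = 0"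
      by (subst symp) (simp add: symp_form_inner)
    then have "Im (H ((- \<i>) *s ?w) ?w) = 0" by (simp only: FP w)
    then have "Re (H ?w ?w) = 0"
      by (simp only: pos_def_hermitian_bilinear(1-4)[OF H]) simp
    then have w0: "?w = 0" using pos_def_hermitian_pos[OF H] by force
    then have "join 0 (im_vec y) = 0" by (intro injF) (simp add: FP)
    moreover have "join 0 (re_vec y) = 0" by (intro injF) (simp only: FP w w0, simp)
    ultimately have "im_vec y = 0" "re_vec y = 0"
      using join_parts(2) by (metis parts_linear(4) scaleR_zero_left)+
    then show "y = 0" by (intro vec_parts_eqI) (simp_all add: re_vec_def im_vec_def zero_vec_def)
  qed
  then obtain P' where P': "P' ** P = mat 1"
    using matrix_left_invertible_ker[of P] by blast
  then have P'': "P ** P' = mat 1" by (simp add: matrix_left_right_inverse)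
  have inv: "invertible P" using P' P'' by (auto simp: invertible_def)
  have F': "F x = P *v F_Z (P' ** U) x" for x
    by (simp add: FUP F_Z_eq matrix_vector_right_distrib matrix_vector_mul_assoc matrix_mul_assoc P'')
  note H' = pos_def_hermitian_comp[OF H inv]
  have "P' ** U \<in> siegel" "(\<lambda>u v. H (P *v u) (P *v v)) = H_Z (P' ** U)"
    by (rule siegel_of_symplectic[OF H']; simp add: F'[symmetric] symp)+
  then show ?thesis
    by (intro that[of P "P' ** U"] inv F') metis+
qed

section \<open>The action on the Siegel space in terms of period maps\<close>

lemma cvec_axis: "cvec (axis a 1) = (axis a 1 :: complex^'n)"
  by (simp add: cvec_def axis_def vec_eq_iff)

text \<open>Real vectors contain the standard basis, so they detect equality of complex
  matrices.\<close>

lemma matrix_eq_cvec: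
  fixes A B :: "complex^'n^'m"
  assumes "\<And>x. A *v cvec x = B *v cvec x"
  shows "A = B"
proof -
  have "A *v axis j 1 = B *v axis j 1" for j
    using assms[of "axis j 1"] by (simp add: cvec_axis)
  then have "(A *v axis j 1) $ i = (B *v axis j 1) $ i" for i j by simp
  then show ?thesis
    unfolding matrix_mult_axis_nth by (simp add: vec_eq_iff)
qed

lemma F_Z_inject:
  assumes "\<And>x. F_Z Z x = F_Z W x"
  shows "Z = W"
proof (rule matrix_eq_cvec)
  fix x
  show "Z *v cvec x = W *v cvec x"
    using assms[of "join x 0"] by (simp add: F_Z_join)
qed

text \<open>Symmetry of Z turns g^t acting on coordinates into the transposes of A Z + B and C Z +
  D.\<close>

lemma F_Z_transpose:
  assumes "transpose Z = Z"
  shows "F_Z Z (transpose g *v x) =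
    transpose (map_matrix of_real (blkA g) ** Z + map_matrix of_real (blkB g)) *v cvec (top_part x) +
    transpose (map_matrix of_real (blkC g) ** Z + map_matrix of_real (blkD g)) *v cvec (bot_part x)"
proof -
  have "Z $ 2 $ 1 = Z $ 1 $ 2"
    using assms by (auto simp: transpose_def vec_eq_iff)
  then show ?thesis
    by (simp add: F_Z_eq blkA_def blkB_def blkC_def blkD_def matrix_entries cvec_def
        top_part_def bot_part_def algebra_simps)
qed

text \<open>Comparing the two summands gives P = (C Z + D)^t and P W = (A Z + B)^t. Invertibility of
  C Z + D is thus inherited from P.\<close>

lemma siegel_act_unique:
  assumes Z: "transpose Z = Z" and W: "transpose W = W" and "invertible P"
    and F: "\<And>x. F_Z Z (transpose g *v x) = P *v F_Z W x"
  shows "siegel_act g Z = W"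
proof -
  let ?AB = "map_matrix of_real (blkA g) ** Z + map_matrix of_real (blkB g)"
  let ?CD = "map_matrix of_real (blkC g) ** Z + map_matrix of_real (blkD g)"
  note F' = F[unfolded F_Z_transpose[OF Z], unfolded F_Z_eq matrix_vector_right_distrib]
  have "transpose ?CD = P"
    by (rule matrix_eq_cvec) (use F'[of "join 0 _"] in simp)
  then have CD: "?CD = transpose P" by (metis transpose_transpose)
  have "transpose ?AB = P ** W"
    by (rule matrix_eq_cvec) (use F'[of "join _ 0"] in \<open>simp add: matrix_vector_mul_assoc\<close>)
  then have AB: "?AB = W ** transpose P"
    by (metis transpose_transpose matrix_transpose_mul W)
  obtain P' where "P' ** P = mat 1" "P ** P' = mat 1"
    using assms(3) by (auto simp: invertible_def)
  then have P': "transpose P ** transpose P' = mat 1"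
    by (metis matrix_transpose_mul transpose_mat)
  then show ?thesis
    by (simp add: siegel_act_def AB CD matrix_inv_unique[OF P'] flip: matrix_mul_assoc)
qed

text \<open>The frame \<open>F_Z Z\<close> after g^t is again symplectic for \<open>H_Z Z\<close>,
  so its normal form supplies a point of the Siegel space, which must be g Z. Symmetry and
  positivity of g Z come with it, without the usual computation of Im(g Z).\<close>

lemma siegel_act_period:
  assumes Z: "Z \<in> siegel" and g: "g \<in> Sp4_real"
  obtains P where "invertible P" "siegel_act g Z \<in> siegel"
    "\<And>x. F_Z Z (transpose g *v x) = P *v F_Z (siegel_act g Z) x"
    "\<And>u v. H_Z Z (P *v u) (P *v v) = H_Z (siegel_act g Z) u v"
proof -
  let ?F = "\<lambda>x. F_Z Z (transpose g *v x)"
  have lin: "linear ?F"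
    using linear_compose[OF matrix_vector_mul_linear linear_F_Z] by (simp add: o_def)
  have "Im (H_Z Z (?F x) (?F y)) = x \<bullet> (symp_form *v y)" for x y
    by (simp add: Im_H_Z_F_Z[OF Z] Sp4_real_inner[OF Sp4_real_transpose[OF g]])
  then obtain P W where P: "invertible P" "W \<in> siegel" "\<And>x. ?F x = P *v F_Z W x"
    "\<And>u v. H_Z Z (P *v u) (P *v v) = H_Z W u v"
    using period_normal_form[OF lin H_Z_pos_def[OF Z]] by blast
  have "siegel_act g Z = W"
    using siegel_act_unique[OF siegelD(1)[OF Z] siegelD(1)[OF P(2)] P(1) P(3)] .
  then show ?thesis using that P by blast
qed

lemma siegel_act_siegel: "Z \<in> siegel \<Longrightarrow> g \<in> Sp4_real \<Longrightarrow> siegel_act g Z \<in> siegel"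
  using siegel_act_period by blast

lemma siegel_act_1: "Z \<in> siegel \<Longrightarrow> siegel_act (mat 1) Z = Z"
  by (rule siegel_act_unique[of _ _ "mat 1"]) (simp_all add: siegelD invertible_def)

lemma siegel_act_mult:
  assumes Z: "Z \<in> siegel" and g: "g \<in> Sp4_real" and h: "h \<in> Sp4_real"
  shows "siegel_act (g ** h) Z = siegel_act g (siegel_act h Z)"
proof -
  obtain P where P: "invertible P" "siegel_act h Z \<in> siegel"
    "\<And>x. F_Z Z (transpose h *v x) = P *v F_Z (siegel_act h Z) x"
    using siegel_act_period[OF Z h] by metis
  obtain P' where P': "invertible P'" "siegel_act g (siegel_act h Z) \<in> siegel"
    "\<And>x. F_Z (siegel_act h Z) (transpose g *v x) = P' *v F_Z (siegel_act g (siegel_act h Z)) x"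
    using siegel_act_period[OF P(2) g] by metis
  show ?thesis
  proof (rule siegel_act_unique)
    show "invertible (P ** P')" using P P' by (simp add: invertible_mult)
    show "F_Z Z (transpose (g ** h) *v x)
        = (P ** P') *v F_Z (siegel_act g (siegel_act h Z)) x" for x
      by (simp add: matrix_transpose_mul P P' flip: matrix_vector_mul_assoc)
  qed (use Z P' siegelD in auto)
qed

lemma siegel_act_symp_inv:
  assumes "Z \<in> siegel" "g \<in> Sp4_real"
  shows "siegel_act (symp_inv g) (siegel_act g Z) = Z"
  using assms by (simp add: siegel_act_mult[symmetric] Sp4_real_inv symp_inv siegel_act_1)

section \<open>The involution on the Siegel space\<close>

lemma cnj_vec_simps [simp]:
  "cnj_vec (u + v) = cnj_vec u + cnj_vec v" "cnj_vec (cvec x) = cvec x" "cnj_vec (cnj_vec u) = u"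
  by (simp_all add: cnj_vec_def cvec_def vec_eq_iff)

lemma cnj_vec_matrix_mult: "cnj_vec (M *v u) = map_matrix cnj M *v cnj_vec u"
  by (simp add: cnj_vec_def matrix_vector_mult_def vec_eq_iff)

lemma map_of_real_mult_cvec: "map_matrix of_real A *v cvec x = cvec (A *v x)"
  by (simp add: cvec_def matrix_vector_mult_def vec_eq_iff)

lemma map_of_real_matrix_mult:
  "map_matrix (of_real::real \<Rightarrow> complex) (A ** B) = map_matrix of_real A ** map_matrix of_real B"
  by (simp add: matrix_matrix_mult_def vec_eq_iff)

lemma map_of_real_beta_sq:
  "map_matrix (of_real::real \<Rightarrow> complex) (beta d) ** map_matrix of_real (beta d) = of_int d *\<^sub>R mat 1"
  by (simp add: map_of_real_matrix_mult[symmetric] beta_sq)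
    (simp add: vec_eq_iff mat_def scaleR_conv_of_real[where 'a=complex])

lemma hat_siegel_eq:
  assumes "d \<noteq> 0"
  shows "hat_siegel d Z = (1 / of_int d) *\<^sub>R
    (map_matrix of_real (beta d) ** map_matrix cnj Z ** transpose (map_matrix of_real (beta d)))"
proof -
  let ?b = "map_matrix of_real (beta d) :: complex^2^2"
  have *: "transpose ?b ** ((1 / of_int d) *\<^sub>R transpose ?b) = mat 1"
    using assms by (simp add: matrix_transpose_mul[symmetric] map_of_real_beta_sq transpose_scalar)
  show ?thesis
    unfolding hat_siegel_def matrix_inv_unique[OF *] by simp
qed

lemma parts_transpose_N_beta:
  "top_part (transpose (N_beta d) *v x) = transpose (beta d) *v top_part x"
  "bot_part (transpose (N_beta d) *v x) = beta d *v bot_part x"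
  by (simp_all add: N_beta_def matrix_entries top_part_def bot_part_def)

text \<open>On the first summand \<open>N_beta\<close>^t acts by beta^t, which cancels the inverse
  in hat Z; on the second it acts by beta.\<close>

lemma F_Z_hat_siegel:
  assumes "d \<noteq> 0"
  shows "F_Z (hat_siegel d Z) (transpose (N_beta d) *v x) =
    map_matrix of_real (beta d) *v cnj_vec (F_Z Z x)"
proof -
  let ?b = "map_matrix of_real (beta d) :: complex^2^2"
  have "hat_siegel d Z *v (transpose ?b *v u) = ?b *v (map_matrix cnj Z *v u)" for u
  proof -
    have "hat_siegel d Z ** transpose ?b = ?b ** map_matrix cnj Z"
      using assms by (simp add: hat_siegel_eq matrix_transpose_mul[symmetric] map_of_real_beta_sq
          transpose_scalar flip: matrix_mul_assoc)
    then show ?thesis by (simp add: matrix_vector_mul_assoc)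
  qed
  moreover have "cvec (transpose (beta d) *v y) = transpose ?b *v cvec y" for y
    by (simp add: cvec_def matrix_vector_mult_def transpose_def vec_eq_iff)
  ultimately show ?thesis
    by (simp add: F_Z_eq parts_transpose_N_beta cnj_vec_matrix_mult matrix_vector_right_distrib
        map_of_real_mult_cvec)
qed

lemma hat_siegel_siegel:
  assumes d: "d < 0" and Z: "Z \<in> siegel"
  shows "hat_siegel d Z \<in> siegel"
proof -
  let ?b = "map_matrix of_real (beta d) :: complex^2^2"
  have d0: "d \<noteq> 0" using d by simp
  have "transpose (map_matrix cnj Z) = map_matrix cnj Z"
    using siegelD(1)[OF Z] by (simp add: transpose_def vec_eq_iff)
  then have "transpose (hat_siegel d Z) = hat_siegel d Z"
    by (simp add: hat_siegel_eq[OF d0] transpose_scalar matrix_transpose_mul matrix_mul_assoc)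
  moreover have "0 < x \<bullet> (map_matrix Im (hat_siegel d Z) *v x)" if x: "x \<noteq> 0" for x
  proof -
    let ?y = "transpose (beta d) *v x"
    \<comment> \<open>Conjugation reverses the sign of Im Z and the factor 1 / d, with d negative,
      restores it.\<close>
    have "map_matrix Im (hat_siegel d Z) =
        (- 1 / of_int d) *\<^sub>R (beta d ** map_matrix Im Z ** transpose (beta d))"
      by (simp add: hat_siegel_eq[OF d0] matrix_entries) (simp add: divide_simps d0 algebra_simps)
    then have "x \<bullet> (map_matrix Im (hat_siegel d Z) *v x) =
        (- 1 / of_int d) * (x \<bullet> (beta d *v (map_matrix Im Z *v ?y)))"
      by (simp add: scaleR_matrix_vector_assoc[symmetric] flip: matrix_vector_mul_assoc)
    also have "x \<bullet> (beta d *v (map_matrix Im Z *v ?y)) = ?y \<bullet> (map_matrix Im Z *v ?y)"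
      using inner_transpose_mult[of x "transpose (beta d)" "map_matrix Im Z *v ?y"] by simp
    finally have *: "x \<bullet> (map_matrix Im (hat_siegel d Z) *v x) =
        (- 1 / of_int d) * (?y \<bullet> (map_matrix Im Z *v ?y))" .
    have "transpose (beta d) *v ?y = of_int d *\<^sub>R x"
      by (simp add: matrix_vector_mul_assoc matrix_transpose_mul[symmetric] beta_sq transpose_scalar
          scaleR_matrix_vector_assoc[symmetric])
    then have "?y \<noteq> 0" using x d0 by force
    then have "0 < ?y \<bullet> (map_matrix Im Z *v ?y)" by (rule siegelD(4)[OF Z])
    then show ?thesis using d by (simp add: * divide_neg_neg mult_neg_neg zero_less_mult_iff divide_less_0_iff)
  qed
  ultimately show ?thesis by (simp add: siegel_def sym_mat_def)
qed

lemma invertible_map_of_real_beta: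
  assumes "d \<noteq> 0"
  shows "invertible (map_matrix of_real (beta d) :: complex^2^2)"
  using assms map_of_real_beta_sq[of d] unfolding invertible_def
  by (intro exI[of _ "(1 / of_int d) *\<^sub>R map_matrix of_real (beta d)"]) simp

lemma transpose_N_beta_sq: "transpose (N_beta d) ** transpose (N_beta d) = of_int d *\<^sub>R mat 1"
  by (simp add: matrix_transpose_mul[symmetric] N_beta_sq transpose_scalar)

lemma transpose_N_beta_surj:
  assumes "d \<noteq> 0"
  obtains y where "x = transpose (N_beta d) *v y"
proof
  show "x = transpose (N_beta d) *v ((1 / of_int d) *\<^sub>R (transpose (N_beta d) *v x))"
    using assms by (simp add: matrix_vector_mult_scaleR matrix_vector_mul_assoc transpose_N_beta_sq
        scaleR_matrix_vector_assoc[symmetric])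
qed

lemma invertible_map_cnj:
  assumes "invertible (P::complex^'n^'n)"
  shows "invertible (map_matrix cnj P)"
proof -
  have *: "map_matrix cnj (A ** B) = map_matrix cnj A ** map_matrix cnj B" for A B :: "complex^'n^'n"
    by (simp add: matrix_matrix_mult_def vec_eq_iff)
  have "map_matrix cnj (mat 1) = (mat 1 :: complex^'n^'n)"
    by (simp add: mat_def vec_eq_iff)
  then show ?thesis using assms unfolding invertible_def by (metis *)
qed

text \<open>Frames are compared on the vectors \<open>N_beta\<close>^t y, which exhaust R^4. The
  resulting period factor is beta conj(P) beta^-1, and \<open>siegel_act_unique\<close> identifies
  the points.\<close>

lemma hat_siegel_act:
  assumes d: "d < 0" and Z: "Z \<in> siegel" and g: "g \<in> Sp4_real"
  shows "hat_siegel d (siegel_act g Z) = siegel_act (hat_Sp d g) (hat_siegel d Z)"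
proof -
  let ?b = "map_matrix of_real (beta d) :: complex^2^2"
  let ?N = "transpose (N_beta d)"
  have d0: "d \<noteq> 0" using d by simp
  obtain P where P: "invertible P" "siegel_act g Z \<in> siegel"
    "\<And>x. F_Z Z (transpose g *v x) = P *v F_Z (siegel_act g Z) x"
    using siegel_act_period[OF Z g] by metis
  obtain b' where b': "?b ** b' = mat 1" "b' ** ?b = mat 1"
    using invertible_map_of_real_beta[OF d0] by (auto simp: invertible_def)
  have inv: "invertible (?b ** map_matrix cnj P ** b')"
    using b' by (intro invertible_mult invertible_map_of_real_beta d0 invertible_map_cnj P)
      (auto simp: invertible_def)
  have "F_Z (hat_siegel d Z) (transpose (hat_Sp d g) *v x)
      = (?b ** map_matrix cnj P ** b') *v F_Z (hat_siegel d (siegel_act g Z)) x" for x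
  proof -
    obtain y where x: "x = ?N *v y" using transpose_N_beta_surj[OF d0] by blast
    have "transpose (hat_Sp d g) ** ?N = ?N ** transpose g"
      by (simp add: matrix_transpose_mul[symmetric] hat_Sp_N_beta[OF d0])
    then have "transpose (hat_Sp d g) *v x = ?N *v (transpose g *v y)"
      by (simp add: x matrix_vector_mul_assoc)
    then have "F_Z (hat_siegel d Z) (transpose (hat_Sp d g) *v x)
        = ?b *v (map_matrix cnj P *v cnj_vec (F_Z (siegel_act g Z) y))"
      by (simp add: F_Z_hat_siegel[OF d0] P cnj_vec_matrix_mult)
    also have "\<dots> = (?b ** map_matrix cnj P ** b') *v (?b *v cnj_vec (F_Z (siegel_act g Z) y))"
      by (simp add: matrix_vector_mul_assoc b' flip: matrix_mul_assoc)
    finally show ?thesis by (simp add: x F_Z_hat_siegel[OF d0])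
  qed
  then show ?thesis
    using siegel_act_unique[OF _ _ inv] siegelD(1) hat_siegel_siegel[OF d] Z P(2) by metis
qed

lemma hat_siegel_hat_siegel:
  assumes d: "d < 0"
  shows "hat_siegel d (hat_siegel d Z) = Z"
proof (rule F_Z_inject)
  fix x
  let ?b = "map_matrix of_real (beta d) :: complex^2^2"
  let ?N = "transpose (N_beta d)"
  let ?Z = "hat_siegel d (hat_siegel d Z)"
  have d0: "d \<noteq> 0" using d by simp
  have cb: "map_matrix cnj ?b = ?b" by (simp add: vec_eq_iff)
  have "F_Z ?Z (?N *v (?N *v x)) = of_int d *\<^sub>R F_Z Z x"
    by (simp add: F_Z_hat_siegel[OF d0] cnj_vec_matrix_mult cb)
      (simp add: matrix_vector_mul_assoc map_of_real_beta_sq)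
  then have "F_Z ?Z (of_int d *\<^sub>R x) = of_int d *\<^sub>R F_Z Z x"
    by (simp add: matrix_vector_mul_assoc transpose_N_beta_sq scaleR_matrix_vector_assoc[symmetric])
  then show "F_Z ?Z x = F_Z Z x"
    using d0 by (simp add: linear_scale[OF linear_F_Z])
qed

section \<open>Torsion-freeness of the principal congruence subgroup\<close>

locale period_norm =
  fixes Z :: "complex^2^2"
  assumes Z: "Z \<in> siegel"
begin

text \<open>Squared length for \<open>H_Z\<close>, read in lattice coordinates.\<close>

definition q :: "real^(2+2) \<Rightarrow> real" where
  "q x = Re (H_Z Z (F_Z Z x) (F_Z Z x))"

lemma q_scale: "q (c *\<^sub>R x) = c\<^sup>2 * q x"
  by (simp add: q_def linear_scale[OF linear_F_Z] pos_def_hermitian_scaleR[OF H_Z_pos_def[OF Z]]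
      power2_eq_square mult.assoc)

lemma q_pos: "x \<noteq> 0 \<Longrightarrow> 0 < q x"
  unfolding q_def
  by (rule pos_def_hermitian_pos[OF H_Z_pos_def[OF Z]])
    (metis bij_F_Z[OF Z] bij_def injD linear_0 linear_F_Z)

lemma q_zero: "q 0 = 0"
  using q_scale[of 0 0] by simp

lemma q_nonneg: "0 \<le> q x"
  using q_pos[of x] q_zero by (cases "x = 0") auto

lemma q_parallelogram: "q (x + y) + q (x - y) = 2 * q x + 2 * q y"
proof -
  have "x - y = x + (-1) *\<^sub>R y" by simp
  then show ?thesis
    unfolding q_def
    by (simp only: linear_add[OF linear_F_Z] linear_scale[OF linear_F_Z]
      pos_def_hermitian_bilinear(1,3)[OF H_Z_pos_def[OF Z]]
      pos_def_hermitian_scaleR[OF H_Z_pos_def[OF Z]]) simp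
qed

text \<open>Taken from the minimum on the compact unit sphere. It lets smallness of \<open>q\<close>
  be tested against the Euclidean norm, in which nonzero integral vectors have length at least
  1.\<close>

lemma q_lower_bound: obtains c where "c > 0" "\<And>x. c * (norm x)\<^sup>2 \<le> q x"
proof -
  let ?S = "matrix_inv (map_matrix Im Z)"
  have "linear (\<lambda>x. re_vec (F_Z Z x))" "linear (\<lambda>x. im_vec (F_Z Z x))"
    by (auto intro!: linearI simp: linear_add[OF linear_F_Z] linear_scale[OF linear_F_Z])
      (simp_all add: re_vec_def im_vec_def vec_eq_iff)
  then have cont: "continuous_on A (\<lambda>x. re_vec (F_Z Z x))" "continuous_on A (\<lambda>x. im_vec (F_Z Z x))" for A
    by (simp_all add: linear_continuous_on linear_linear)
  have "continuous_on (sphere 0 1) q"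
    unfolding q_def H_Z_eq real_hermitian_def
    by (simp, intro continuous_intros cont continuous_on_compose2[OF linear_continuous_on[of "(*v) ?S"] cont(1)]
        continuous_on_compose2[OF linear_continuous_on[of "(*v) ?S"] cont(2)]) (auto simp: linear_linear)
  moreover have "sphere 0 1 \<noteq> ({} :: (real^(2+2)) set)"
    by simp
  ultimately obtain x0 where x0: "x0 \<in> sphere 0 1" "\<And>x. x \<in> sphere 0 1 \<Longrightarrow> q x0 \<le> q x"
    using continuous_attains_inf[of "sphere 0 1" q] compact_sphere by blast
  show ?thesis
  proof (rule that[of "q x0"])
    show "0 < q x0" using x0(1) by (intro q_pos) auto
    show "q x0 * (norm x)\<^sup>2 \<le> q x" for x
    proof (cases "x = 0")
      case False
      then have "q x0 \<le> q ((1 / norm x) *\<^sub>R x)" by (intro x0) simp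
      then show ?thesis using False by (simp add: q_scale field_simps)
    qed (simp add: q_zero)
  qed
qed

lemma int_vecs_norm_ge_1:
  assumes "x \<in> int_vecs" "x \<noteq> 0"
  shows "1 \<le> norm x"
proof -
  obtain i where i: "x $ i \<noteq> 0" using assms(2) by (auto simp: vec_eq_iff)
  have "x $ i \<in> \<int>" using assms(1) by (simp add: int_vecs_def)
  then have "1 \<le> \<bar>x $ i\<bar>" using i by (rule Ints_nonzero_abs_ge1)
  then show ?thesis using component_le_norm_cart[of x i] by linarith
qed

lemma isometry_congruent_1:
  assumes E: "int_mat E" and iso: "\<And>x. q ((mat 1 + real N *\<^sub>R E) *v x) = q x" and N: "N \<ge> 3"
  shows "E = 0"
proof -
  let ?T = "mat 1 + real N *\<^sub>R E"
  have T: "?T *v x = x + real N *\<^sub>R (E *v x)" for x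
    by (simp add: matrix_vector_mult_add_rdistrib scaleR_matrix_vector_assoc)
  \<comment> \<open>The parallelogram law with the nonnegative term q(y + x) dropped.\<close>
  have diff_bound: "q (y - x) \<le> 4 * q x" if "q y = q x" for x y
    using q_parallelogram[of y x] q_nonneg[of "y + x"] that by simp
  \<comment> \<open>The constant is 4 / N^2 in the worst case N = 3.\<close>
  have contr: "q (E *v x) \<le> (4/9) * q x" for x
  proof -
    have "(real N)\<^sup>2 * q (E *v x) \<le> 4 * q x"
      using diff_bound[OF iso, of x] unfolding T by (simp add: q_scale)
    moreover have "(3::real)\<^sup>2 \<le> (real N)\<^sup>2" using N by (intro power_mono) auto
    then have "9 * q (E *v x) \<le> (real N)\<^sup>2 * q (E *v x)"
      by (intro mult_right_mono q_nonneg) simp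
    ultimately show ?thesis by linarith
  qed
  let ?p = "\<lambda>k. ((*v) E) ^^ k"
  have pow: "q (?p k x) \<le> (4/9)^k * q x" for k x
  proof (induction k)
    case (Suc k)
    have "q (?p (Suc k) x) \<le> (4/9) * q (?p k x)" using contr by simp
    then show ?case using Suc by simp
  qed simp
  \<comment> \<open>If E^2 x = 0, the n-th iterate of the isometry displaces x by n N E x, whose
    squared length grows like n^2, while \<open>diff_bound\<close> caps it at 4 q(x).\<close>
  have step: "E *v x = 0" if "E *v (E *v x) = 0" for x
  proof (rule ccontr)
    assume "E *v x \<noteq> 0"
    then have pos: "0 < q (real N *\<^sub>R (E *v x))" using N by (intro q_pos) auto
    have "(((*v) ?T) ^^ n) x = x + real n *\<^sub>R (real N *\<^sub>R (E *v x))" for n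
      by (induction n) (simp_all add: T that algebra_simps scaleR_matrix_vector_assoc[symmetric])
    moreover have "q ((((*v) ?T) ^^ n) x) = q x" for n
      by (induction n) (simp_all add: iso)
    ultimately have bound: "(real n)\<^sup>2 * q (real N *\<^sub>R (E *v x)) \<le> 4 * q x" for n
      using diff_bound[of "x + real n *\<^sub>R (real N *\<^sub>R (E *v x))" x]
      by (metis add_diff_cancel_left' q_scale)
    obtain n :: nat where n: "4 * q x / q (real N *\<^sub>R (E *v x)) < real n"
      using reals_Archimedean2 by blast
    then have "n \<noteq> 0" using pos q_nonneg[of x]
      by (metis divide_nonneg_pos mult_nonneg_nonneg not_less of_nat_0 zero_le_numeral)
    then have "real n \<le> (real n)\<^sup>2" by (simp add: power2_eq_square)
    then have "4 * q x / q (real N *\<^sub>R (E *v x)) < (real n)\<^sup>2" using n by linarith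
    then show False using bound[of n] pos by (simp add: pos_divide_less_eq)
  qed
  have descend: "?p k x = 0 \<Longrightarrow> E *v x = 0" for k x
  proof (induction k arbitrary: x)
    case (Suc k)
    then have "E *v (E *v x) = 0" by (simp add: funpow_swap1)
    then show ?case by (rule step)
  qed simp
  obtain c where c: "c > 0" "\<And>x. c * (norm x)\<^sup>2 \<le> q x" using q_lower_bound by blast
  \<comment> \<open>The exponent depends on x: iterates of an integral x stay integral while their
    lengths tend to zero, so one of them vanishes, and \<open>descend\<close> then removes all
    powers but the first.\<close>
  have "E *v x = 0" if x: "x \<in> int_vecs" for x
  proof -
    have "(\<lambda>k. (4/9::real)^k * q x) \<longlonglongrightarrow> 0"
      using tendsto_mult_right[OF LIMSEQ_realpow_zero[of "4/9::real"], of "q x"] by simp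
    then have "\<forall>\<^sub>F k in sequentially. (4/9::real)^k * q x < c"
      by (rule order_tendstoD) (rule c)
    then obtain k where k: "(4/9::real)^k * q x < c"
      by (auto simp: eventually_sequentially)
    have int: "?p k x \<in> int_vecs"
      by (induction k) (simp_all add: x int_vecs_matrix_mult[OF E])
    have "?p k x = 0"
    proof (rule ccontr)
      assume "?p k x \<noteq> 0"
      then have "1 \<le> norm (?p k x)" using int by (intro int_vecs_norm_ge_1)
      then have "c * 1 \<le> c * (norm (?p k x))\<^sup>2"
        using c(1) by (intro mult_left_mono) auto
      then show False using c(2)[of "?p k x"] pow[of k x] k by linarith
    qed
    then show ?thesis by (rule descend)
  qed
  then have "E *v axis j 1 = 0" for j by (simp add: int_vecs_closed)
  then have "(E *v axis j 1) $ i = 0" for i j by simp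
  then show ?thesis unfolding matrix_mult_axis_nth by (simp add: vec_eq_iff)
qed

end

text \<open>At a fixed point the period factor P is an isometry of \<open>H_Z Z\<close>, and in
  lattice coordinates it is g^t.\<close>

lemma principal_congruence_fixed_point:
  assumes g: "g \<in> principal_congruence N" and N: "N \<ge> 3" and Z: "Z \<in> siegel"
    and fixp: "siegel_act g Z = Z"
  shows "g = mat 1"
proof -
  interpret period_norm Z by unfold_locales (rule Z)
  obtain P where P': "\<And>x. F_Z Z (transpose g *v x) = P *v F_Z (siegel_act g Z) x"
    "\<And>u v. H_Z Z (P *v u) (P *v v) = H_Z (siegel_act g Z) u v"
    using siegel_act_period[OF Z principal_congruence_Sp4[OF g]] by metis
  note P = P'[unfolded fixp]
  obtain E where E: "int_mat E" "transpose g = mat 1 + real N *\<^sub>R E"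
    using principal_congruence_transpose[OF g] by (auto simp: principal_congruence_iff)
  have "E = 0"
    by (rule isometry_congruent_1[OF E(1) _ N]) (simp add: q_def E(2)[symmetric] P)
  then have "transpose g = transpose (mat 1)" by (simp add: E(2))
  then show ?thesis by (metis transpose_transpose)
qed

text \<open>Makes the group element of a real point well defined, and lets equalities between points
  be upgraded to equalities between matrices.\<close>

lemma real_point_element_unique:
  assumes "g \<in> principal_congruence N" "h \<in> principal_congruence N" and N: "N \<ge> 3"
    and Z: "Z \<in> siegel" and eq: "siegel_act g Z = siegel_act h Z"
  shows "g = h"
proof -
  have Sp: "g \<in> Sp4_real" "h \<in> Sp4_real" using assms principal_congruence_Sp4 by auto
  have "siegel_act (symp_inv h ** g) Z = Z"
    using Sp Z by (simp add: siegel_act_mult Sp4_real_inv eq siegel_act_symp_inv)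
  then have "symp_inv h ** g = mat 1"
    using assms by (intro principal_congruence_fixed_point[OF _ N Z]
        principal_congruence_mult principal_congruence_inv)
  then have "h ** symp_inv h ** g = h" by (simp flip: matrix_mul_assoc)
  then show ?thesis by (simp add: symp_inv[OF Sp(2)])
qed

lemma real_point_cocycle:
  assumes d: "d < 0" and N: "N \<ge> 3" and Z: "Z \<in> siegel" and g: "g \<in> Gamma_N d N"
    and real: "hat_siegel d Z = siegel_act g Z"
  shows "hat_Sp d g ** g = mat 1"
proof -
  have d0: "d \<noteq> 0" using d by simp
  note Sp = Gamma_N_Sp4[OF g]
  have "siegel_act (hat_Sp d g ** g) Z = siegel_act (hat_Sp d g) (hat_siegel d Z)"
    using Sp Z d0 by (simp add: siegel_act_mult hat_Sp_Sp4_real real)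
  also have "\<dots> = Z"
    using d Sp Z by (simp add: hat_siegel_act[symmetric] real[symmetric] hat_siegel_hat_siegel)
  finally have "siegel_act (hat_Sp d g ** g) Z = Z" .
  then show ?thesis
    using g by (intro principal_congruence_fixed_point[OF _ N Z] principal_congruence_mult)
      (simp_all add: Gamma_N_iff[OF d0])
qed

section \<open>Self-adjoint integral matrices up to the principal congruence subgroup\<close>

text \<open>The integral solutions of K^t J = J K whose upper left block has trace zero:
  self-adjointness makes the off-diagonal blocks skew and the lower right block the transpose of the
  upper left one.\<close>

definition kmat :: "int \<Rightarrow> int \<Rightarrow> int \<Rightarrow> int \<Rightarrow> int \<Rightarrow> mat4" where
  "kmat a b c r s = block
     (vector [vector [of_int a, of_int b], vector [of_int c, - of_int a]])
     (vector [vector [0, of_int r], vector [- of_int r, 0]])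
     (vector [vector [0, of_int s], vector [- of_int s, 0]])
     (vector [vector [of_int a, of_int c], vector [of_int b, - of_int a]])"

lemma kmat_sq:
  assumes "a * a + b * c - r * s = d"
  shows "kmat a b c r s ** kmat a b c r s = of_int d *\<^sub>R mat 1"
  by (simp add: kmat_def matrix_entries assms[symmetric])

lemma kmat_sq_iff:
  "kmat a b c r s ** kmat a b c r s = of_int d *\<^sub>R mat 1 \<longleftrightarrow> a * a + b * c - r * s = d"
proof
  assume "kmat a b c r s ** kmat a b c r s = of_int d *\<^sub>R mat 1"
  then have "(kmat a b c r s ** kmat a b c r s) $ Inl 1 $ Inl 1 = of_int d"
    by (simp add: mat_def)
  then have "real_of_int (a * a + b * c - r * s) = of_int d"
    by (simp add: kmat_def matrix_matrix_mult_def sum_UNIV_2_plus_2)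
  then show "a * a + b * c - r * s = d" by (simp only: of_int_eq_iff)
qed (rule kmat_sq)

text \<open>Multiplying the similitude relation by K on the right and using K^2 = d gives K^t J = J
  K, which fixes the block shape up to the trace.\<close>

lemma self_adjoint_eq_kmat:
  assumes d: "d < 0" and int: "int_mat K" and sq: "K ** K = of_int d *\<^sub>R mat 1"
    and symp: "transpose K ** symp_form ** K = of_int d *\<^sub>R symp_form"
  obtains a b c r s where "K = kmat a b c r s" "a * a + b * c - r * s = d"
proof -
  have "transpose K ** symp_form ** (K ** K) = of_int d *\<^sub>R (symp_form ** K)"
    using symp by (simp add: matrix_mul_assoc)
  then have adj: "transpose K ** symp_form = symp_form ** K"
    using d by (simp add: sq)
  have "\<forall>i j. \<exists>k. K $ i $ j = of_int k"
    using int by (auto simp: int_mat_def elim!: Ints_cases)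
  then obtain k where k: "K $ i $ j = of_int (k i j)" for i j by metis
  let ?a = "k (Inl 1) (Inl 1)" and ?b = "k (Inl 1) (Inl 2)" and ?c = "k (Inl 2) (Inl 1)"
    and ?e = "k (Inl 2) (Inl 2)" and ?r = "k (Inl 1) (Inr 2)" and ?s = "k (Inr 1) (Inl 2)"
  have ent: "(transpose K ** symp_form) $ i $ j = (symp_form ** K) $ i $ j" for i j
    by (simp add: adj)
  note ent = ent[unfolded matrix_matrix_mult_def transpose_def symp_form_def, simplified,
      simplified sum_UNIV_2_plus_2 k, simplified mat_def, simplified]
  have e: "k (Inr 1) (Inl 1) = 0" "k (Inr 2) (Inl 2) = 0" "k (Inr 2) (Inl 1) = - ?s"
    "k (Inl 1) (Inr 1) = 0" "k (Inl 2) (Inr 2) = 0" "k (Inl 2) (Inr 1) = - ?r"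
    "k (Inr 1) (Inr 1) = ?a" "k (Inr 1) (Inr 2) = ?c" "k (Inr 2) (Inr 1) = ?b" "k (Inr 2) (Inr 2) = ?e"
    using ent[of "Inl 1" "Inl 1"] ent[of "Inl 2" "Inl 2"] ent[of "Inl 2" "Inl 1"]
      ent[of "Inr 1" "Inr 1"] ent[of "Inr 2" "Inr 2"] ent[of "Inr 2" "Inr 1"]
      ent[of "Inl 1" "Inr 1"] ent[of "Inl 1" "Inr 2"] ent[of "Inl 2" "Inr 1"] ent[of "Inl 2" "Inr 2"]
    by (simp_all del: of_int_minus add: of_int_minus[symmetric]) linarith?
  have sq': "(\<Sum>j\<in>UNIV. k i j * k j l) = (if i = l then d else 0)" for i l
  proof -
    have "real_of_int (\<Sum>j\<in>UNIV. k i j * k j l) = (K ** K) $ i $ l"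
      by (simp add: matrix_matrix_mult_def k)
    also have "\<dots> = real_of_int (if i = l then d else 0)"
      by (simp add: sq mat_def)
    finally show ?thesis by (simp only: of_int_eq_iff)
  qed
  have 1: "?a * ?a + ?b * ?c - ?r * ?s = d"
    using sq'[of "Inl 1" "Inl 1"] by (simp add: sum_UNIV_2_plus_2 e)
  have 2: "?b * (?a + ?e) = 0" "?c * (?a + ?e) = 0" "?r * (?a + ?e) = 0"
    using sq'[of "Inl 1" "Inl 2"] sq'[of "Inl 2" "Inl 1"] sq'[of "Inl 1" "Inr 2"]
    by (simp_all add: sum_UNIV_2_plus_2 e algebra_simps)
  \<comment> \<open>With a nonzero trace the off-diagonal entries of K^2 would kill b and r, leaving
    a^2 = d < 0.\<close>
  have "?e = - ?a"
  proof (rule ccontr)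
    assume "?e \<noteq> - ?a"
    then have "?b = 0" "?r = 0" using 2 by auto
    then have "?a * ?a = d" using 1 by simp
    then show False using d zero_le_square[of ?a] by simp
  qed
  then have "K = kmat ?a ?b ?c ?r ?s"
    by (simp add: kmat_def matrix_entries k e)
  then show ?thesis using 1 that by blast
qed

text \<open>K and K' describe one multiplication in two lifts of the same level structure. M ranges
  over Gamma(N) rather than \<open>Gamma_N\<close>, since a change of lift need not respect the
  involution.\<close>

definition kconj :: "nat \<Rightarrow> mat4 \<Rightarrow> mat4 \<Rightarrow> bool" where
  "kconj N K K' \<longleftrightarrow> (\<exists>M\<in>principal_congruence N. K ** M = M ** K')"

lemma kconj_trans:
  assumes "kconj N K K'" "kconj N K' K''"
  shows "kconj N K K''"
proof -
  obtain M M' where M: "M \<in> principal_congruence N" "K ** M = M ** K'"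
    and M': "M' \<in> principal_congruence N" "K' ** M' = M' ** K''"
    using assms by (auto simp: kconj_def)
  have "K ** (M ** M') = M ** (K' ** M')" by (simp add: matrix_mul_assoc M)
  also have "\<dots> = (M ** M') ** K''" by (simp add: matrix_mul_assoc M')
  finally show ?thesis
    using principal_congruence_mult[OF M(1) M'(1)] by (auto simp: kconj_def)
qed

lemma kconj_sq:
  assumes "kconj N K K'" "K ** K = k *\<^sub>R mat 1"
  shows "K' ** K' = k *\<^sub>R mat 1"
proof -
  obtain M where M: "M \<in> principal_congruence N" "K ** M = M ** K'"
    using assms by (auto simp: kconj_def)
  note inv = symp_inv[OF principal_congruence_Sp4[OF M(1)]]
  have "M ** (K' ** K') = (K ** K) ** M"
    by (metis M(2) matrix_mul_assoc)
  then have "symp_inv M ** (M ** (K' ** K')) = symp_inv M ** (k *\<^sub>R M)"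
    by (simp add: assms(2))
  then show ?thesis by (simp add: matrix_mul_assoc inv)
qed

lemma kconj_cong:
  assumes "kconj N K K'" "int_mat K" "int_mat K'"
  obtains E where "int_mat E" "K' = K + real N *\<^sub>R E"
proof -
  obtain M where M: "M \<in> principal_congruence N" "K ** M = M ** K'"
    using assms by (auto simp: kconj_def)
  obtain E where E: "int_mat E" "M = mat 1 + real N *\<^sub>R E"
    using M(1) by (auto simp: principal_congruence_iff)
  have "K + real N *\<^sub>R (K ** E) = K' + real N *\<^sub>R (E ** K')"
    using M(2) by (simp add: E(2) matrix_add_distrib_right matrix_add_ldistrib)
  then have "K' = K + real N *\<^sub>R (K ** E + - (E ** K'))"
    by (simp add: algebra_simps)
  moreover have "int_mat (K ** E + - (E ** K'))"
    using assms E by (intro int_mat_add int_mat_minus int_mat_mult)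
  ultimately show ?thesis using that by blast
qed

lemma int_mat_kmat: "int_mat (kmat a b c r s)"
  by (simp add: int_mat_def kmat_def forall_2_plus_2)

lemma kmat_cong:
  assumes "int_mat E" "kmat a' b' c' r' s' = kmat a b c r s + real N *\<^sub>R E"
  shows "int N dvd a' - a" "int N dvd b' - b" "int N dvd c' - c" "int N dvd r' - r" "int N dvd s' - s"
proof -
  have *: "int N dvd x' - x" if "real_of_int x' = of_int x + real N * E $ i $ j" for x x' i j
  proof -
    obtain k where "E $ i $ j = of_int k"
      using assms(1) by (auto simp: int_mat_def elim!: Ints_cases)
    then have "real_of_int (x' - x) = of_int (int N * k)" using that by simp
    then have "x' - x = int N * k" by (simp only: of_int_eq_iff)
    then show ?thesis by simp
  qed
  note entry = arg_cong[OF assms(2), of "\<lambda>M. M $ i $ j" for i j]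
  show "int N dvd a' - a"
    using entry[of "Inl 1" "Inl 1"] by (intro *[of _ _ "Inl 1" "Inl 1"]) (simp add: kmat_def)
  show "int N dvd b' - b"
    using entry[of "Inl 1" "Inl 2"] by (intro *[of _ _ "Inl 1" "Inl 2"]) (simp add: kmat_def)
  show "int N dvd c' - c"
    using entry[of "Inl 2" "Inl 1"] by (intro *[of _ _ "Inl 2" "Inl 1"]) (simp add: kmat_def)
  show "int N dvd r' - r"
    using entry[of "Inl 1" "Inr 2"] by (intro *[of _ _ "Inl 1" "Inr 2"]) (simp add: kmat_def)
  show "int N dvd s' - s"
    using entry[of "Inr 1" "Inl 2"] by (intro *[of _ _ "Inr 1" "Inl 2"]) (simp add: kmat_def)
qed

text \<open>Conjugation preserves the scalar K^2, hence the quadratic form; a conjugating matrix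
  that is 1 modulo N preserves every coordinate modulo N.\<close>

lemma kconj_kmat_invariants:
  assumes "kconj N (kmat a b c r s) (kmat a' b' c' r' s')"
  shows "a' * a' + b' * c' - r' * s' = a * a + b * c - r * s"
    "int N dvd a' - a" "int N dvd b' - b" "int N dvd c' - c" "int N dvd r' - r" "int N dvd s' - s"
proof -
  show "a' * a' + b' * c' - r' * s' = a * a + b * c - r * s"
    by (rule iffD1[OF kmat_sq_iff, OF kconj_sq[OF assms kmat_sq[OF refl]]])
  obtain E where "int_mat E" "kmat a' b' c' r' s' = kmat a b c r s + real N *\<^sub>R E"
    using kconj_cong[OF assms int_mat_kmat int_mat_kmat] .
  from kmat_cong[OF \<open>int_mat E\<close> \<open>kmat a' b' c' r' s' = kmat a b c r s + real N *\<^sub>R E\<close>]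
  show "int N dvd a' - a" "int N dvd b' - b" "int N dvd c' - c" "int N dvd r' - r" "int N dvd s' - s" .
qed

lemma kconjI:
  assumes "int_mat E" "transpose (mat 1 + real N *\<^sub>R E) ** symp_form ** (mat 1 + real N *\<^sub>R E) = symp_form"
    and "K ** (mat 1 + real N *\<^sub>R E) = (mat 1 + real N *\<^sub>R E) ** K'"
  shows "kconj N K K'"
  unfolding kconj_def
  by (rule bexI[of _ "mat 1 + real N *\<^sub>R E"]) (use assms in \<open>auto simp: principal_congruence_iff Sp4_real_iff\<close>)

text \<open>The first two moves come from shears diag(A, A^-t), the others from unipotent matrices
  with a single entry in the upper right or lower left block. Each of the latter changes only one of
  b, c and one of r, s.\<close>

lemma kconj_moves:
  fixes a b c r s t :: int and N :: nat
  defines "n \<equiv> int N * t"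
  shows kconj_m1: "kconj N (kmat a b c r s) (kmat (a - n * c) (b + 2 * a * n - n * n * c) c r s)"
    and kconj_m2: "kconj N (kmat a b c r s) (kmat (a + n * b) b (c - 2 * a * n - n * n * b) r s)"
    and kconj_m3: "kconj N (kmat a b c r s) (kmat a (b - s * n) c (r - n * c) s)"
    and kconj_m4: "kconj N (kmat a b c r s) (kmat a b (c + s * n) (r + n * b) s)"
    and kconj_m5: "kconj N (kmat a b c r s) (kmat a b (c - r * n) r (s - n * b))"
    and kconj_m6: "kconj N (kmat a b c r s) (kmat a (b + r * n) c r (s + n * c))"
proof -
  let ?t = "real_of_int t"
  show "kconj N (kmat a b c r s) (kmat (a - n * c) (b + 2 * a * n - n * n * c) c r s)"
    by (rule kconjI[where E = "block (vector [vector [0, ?t], vector [0, 0]]) 0 0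
          (vector [vector [0, 0], vector [- ?t, 0]])"])
      (simp_all add: int_mat_def forall_2_plus_2 matrix_entries kmat_def symp_form_def n_def algebra_simps)
  show "kconj N (kmat a b c r s) (kmat (a + n * b) b (c - 2 * a * n - n * n * b) r s)"
    by (rule kconjI[where E = "block (vector [vector [0, 0], vector [?t, 0]]) 0 0
          (vector [vector [0, - ?t], vector [0, 0]])"])
      (simp_all add: int_mat_def forall_2_plus_2 matrix_entries kmat_def symp_form_def n_def algebra_simps)
  show "kconj N (kmat a b c r s) (kmat a (b - s * n) c (r - n * c) s)"
    by (rule kconjI[where E = "block 0 (vector [vector [?t, 0], vector [0, 0]]) 0 0"])
      (simp_all add: int_mat_def forall_2_plus_2 matrix_entries kmat_def symp_form_def n_def algebra_simps)
  show "kconj N (kmat a b c r s) (kmat a b (c + s * n) (r + n * b) s)"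
    by (rule kconjI[where E = "block 0 (vector [vector [0, 0], vector [0, ?t]]) 0 0"])
      (simp_all add: int_mat_def forall_2_plus_2 matrix_entries kmat_def symp_form_def n_def algebra_simps)
  show "kconj N (kmat a b c r s) (kmat a b (c - r * n) r (s - n * b))"
    by (rule kconjI[where E = "block 0 0 (vector [vector [?t, 0], vector [0, 0]]) 0"])
      (simp_all add: int_mat_def forall_2_plus_2 matrix_entries kmat_def symp_form_def n_def algebra_simps)
  show "kconj N (kmat a b c r s) (kmat a (b + r * n) c r (s + n * c))"
    by (rule kconjI[where E = "block 0 0 (vector [vector [0, 0], vector [0, ?t]]) 0"])
      (simp_all add: int_mat_def forall_2_plus_2 matrix_entries kmat_def symp_form_def n_def algebra_simps)
qed

text \<open>Gives the step size used to repair c: for squarefree d, the number d / gcd(c, d) is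
  divisible by exactly those primes of d that do not divide c.\<close>

lemma prime_dvd_div_gcd_iff:
  fixes d :: int
  assumes "squarefree d" "Factorial_Ring.prime p" "p dvd d"
  shows "p dvd d div gcd c d \<longleftrightarrow> \<not> p dvd c"
proof
  assume p: "p dvd d div gcd c d"
  show "\<not> p dvd c"
  proof
    assume "p dvd c"
    then have "p * p dvd gcd c d * (d div gcd c d)"
      using assms(3) p by (intro mult_dvd_mono) auto
    then have "p\<^sup>2 dvd d" by (simp add: power2_eq_square)
    then have "p dvd 1" using assms(1) by (simp add: squarefree_def)
    then show False using assms(2) by (simp add: prime_int_iff)
  qed
next
  assume c: "\<not> p dvd c"
  have "p dvd gcd c d * (d div gcd c d)" using assms(3) by simp
  then have "p dvd gcd c d \<or> p dvd d div gcd c d"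
    by (rule prime_dvd_multD[OF assms(2)])
  then show "p dvd d div gcd c d" using c by auto
qed

text \<open>With such a t, adding x n t to c leaves primes not dividing c alone, and a prime
  dividing c survives only if it also divides x.\<close>

lemma prime_dvd_shift:
  fixes p :: int
  assumes "Factorial_Ring.prime p" and "p dvd c + x * (n * t)" and "\<not> p dvd c \<Longrightarrow> p dvd t"
    and "p dvd c \<Longrightarrow> \<not> p dvd t" and "p dvd c \<Longrightarrow> \<not> p dvd n"
  shows "p dvd c" "p dvd x"
proof -
  show c: "p dvd c"
  proof (rule ccontr)
    assume "\<not> p dvd c"
    then have "p dvd x * (n * t)" using assms(3) by simp
    then show False using assms(2) \<open>\<not> p dvd c\<close> dvd_add_left_iff by blast
  qed
  then have "p dvd x * (n * t)" using assms(2) dvd_add_right_iff by blast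
  then show "p dvd x"
    using c assms by (simp add: prime_dvd_mult_iff)
qed

text \<open>Three moves add to c suitable multiples of s, of r and of 2a + n b. A prime of d
  surviving all of them divides every coordinate, so its square divides the norm d, contrary to
  squarefreeness. The hypothesis on c excludes primes of N, modulo which no move can change
  c.\<close>

lemma kconj_coprime:
  assumes sf: "squarefree d" and q: "a * a + b * c - r * s = d"
    and c: "\<And>p. Factorial_Ring.prime p \<Longrightarrow> p dvd d \<Longrightarrow> p dvd c \<Longrightarrow> \<not> p dvd int N"
  obtains a' b' c' r' s' where "kconj N (kmat a b c r s) (kmat a' b' c' r' s')" "coprime c' d"
proof -
  define t where "t c = d div gcd c d" for c
  have t: "p dvd t c \<longleftrightarrow> \<not> p dvd c" if "Factorial_Ring.prime p" "p dvd d" for p c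
    using prime_dvd_div_gcd_iff[OF sf that] by (simp add: t_def)
  define n where "n = int N * t c"
  define c1 r1 where "c1 = c + s * n" and "r1 = r + n * b"
  define n1 where "n1 = int N * t c1"
  define c2 s2 where "c2 = c1 - r1 * n1" and "s2 = s - n1 * b"
  define n2 where "n2 = int N * t c2"
  define a3 c3 where "a3 = a + n2 * b" and "c3 = c2 - 2 * a * n2 - n2 * n2 * b"
  have k1: "kconj N (kmat a b c r s) (kmat a b c1 r1 s)"
    unfolding c1_def r1_def n_def by (rule kconj_m4)
  have k2: "kconj N (kmat a b c1 r1 s) (kmat a b c2 r1 s2)"
    unfolding c2_def s2_def n1_def by (rule kconj_m5)
  have k3: "kconj N (kmat a b c2 r1 s2) (kmat a3 b c3 r1 s2)"
    unfolding a3_def c3_def n2_def by (rule kconj_m2)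
  have q1: "a * a + b * c1 - r1 * s = d"
    using kconj_kmat_invariants(1)[OF k1] q by simp
  have "coprime c3 d"
  proof (rule ccontr)
    assume "\<not> coprime c3 d"
    then obtain p where p: "Factorial_Ring.prime p" "p dvd c3" "p dvd d"
      by (metis coprime_iff_gcd_eq_1 dvd_gcdD1 dvd_gcdD2 gcd_pos_int is_unit_gcd
          prime_divisor_exists gcd_eq_0_iff sf not_squarefree_0)
    note cN = c[OF p(1,3)] and t = t[OF p(1,3)]
    have A: "p dvd c \<and> p dvd s" if "p dvd c1"
      using prime_dvd_shift[OF p(1), of c s "int N" "t c"] that cN t
      by (simp add: c1_def n_def)
    have B: "p dvd c1 \<and> p dvd r1" if "p dvd c2"
    proof -
      have "p dvd c1 + (- r1) * (int N * t c1)" using that by (simp add: c2_def n1_def)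
      then have "p dvd c1" "p dvd - r1"
        using prime_dvd_shift[OF p(1), of c1 "- r1" "int N" "t c1"] A cN t by blast+
      then show ?thesis by simp
    qed
    have "p dvd c2 + (- 2 * a - n2 * b) * (int N * t c2)"
      using p(2) by (simp add: c3_def n2_def algebra_simps)
    then have C: "p dvd c2" "p dvd - 2 * a - n2 * b"
      using prime_dvd_shift[OF p(1), of c2 "- 2 * a - n2 * b" "int N" "t c2"] A B cN t by blast+
    then have dvd: "p dvd c1" "p dvd r1" "p dvd s" "p dvd c" using A B by auto
    \<comment> \<open>Divisibility of a is taken from the norm equation, because \<open>C(2)\<close>
      involves 2a and is silent about a when p = 2.\<close>
    have "a * a = d - b * c1 + r1 * s" using q1 by simp
    then have "p dvd a * a" using dvd p(3) by simp
    then have a: "p dvd a" using p(1) by (simp add: prime_dvd_mult_iff)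
    have "p dvd - 2 * a - (- 2 * a - n2 * b)"
      by (rule dvd_diff) (use a C(2) in auto)
    then have "p dvd n2 * b" by simp
    moreover have "\<not> p dvd n2"
      using C(1) cN dvd t p(1) by (simp add: n2_def prime_dvd_mult_iff)
    ultimately have b: "p dvd b" using p(1) by (simp add: prime_dvd_mult_iff)
    have "p * p dvd a * a + b * c1 - r1 * s"
      using a b dvd by (intro dvd_diff dvd_add mult_dvd_mono)
    then have "p\<^sup>2 dvd d" by (simp add: q1 power2_eq_square)
    then have "p dvd 1" using sf by (simp add: squarefree_def)
    then show False using p(1) by (simp add: prime_int_iff)
  qed
  then show ?thesis
    using that kconj_trans[OF kconj_trans[OF k1 k2] k3] by blast
qed

section \<open>Normal forms modulo d N with pivot c\<close>

lemma solve_coprime: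
  fixes c d w :: int
  assumes "coprime c d"
  obtains x where "d dvd w - x * c"
proof -
  obtain u v where uv: "u * c + v * d = 1"
    using assms by (metis bezout_int coprime_iff_gcd_eq_1)
  have "w * (u * c + v * d) = w" by (simp add: uv)
  then have "w - (w * u) * c = d * (w * v)" by (simp add: algebra_simps)
  then show ?thesis using that dvd_triv_left by metis
qed

text \<open>As c is invertible modulo d, \<open>kconj_m3\<close> adjusts r and
  \<open>kconj_m6\<close> adjusts s. Neither disturbs the other's work, and both leave a and c
  fixed; b absorbs the change.\<close>

lemma kconj_eliminate_rs:
  assumes c: "coprime c d" and dvd: "int N dvd r" "int N dvd s"
  obtains b' r' s' where "kconj N (kmat a b c r s) (kmat a b' c r' s')"
    "d * int N dvd r'" "d * int N dvd s'"
proof -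
  obtain r0 s0 where rs: "r = int N * r0" "s = int N * s0" using dvd by (auto elim!: dvdE)
  obtain x y where xy: "d dvd r0 - x * c" "d dvd s0 - y * c"
    using solve_coprime[OF c] by metis
  have k1: "kconj N (kmat a b c r s) (kmat a (b - s * (int N * x)) c (r - int N * x * c) s)"
    by (rule kconj_m3)
  have k2: "kconj N \<dots> (kmat a (b - s * (int N * x) + (r - int N * x * c) * (int N * (- y))) c
      (r - int N * x * c) (s + int N * (- y) * c))"
    by (rule kconj_m6)
  have "r - int N * x * c = (r0 - x * c) * int N" "s + int N * (- y) * c = (s0 - y * c) * int N"
    by (simp_all add: rs algebra_simps)
  then have "d * int N dvd r - int N * x * c" "d * int N dvd s + int N * (- y) * c"
    using xy by (simp_all add: mult_dvd_mono)
  then show ?thesis using that kconj_trans[OF k1 k2] by blast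
qed

text \<open>The target congruences say that K' \<open>N_beta\<close>^t = d modulo d N. The diagonal
  entries of this product are b and c d, which is why c is prescribed only modulo N. The pivot
  clears a, r and s.\<close>

lemma kconj_normal_form_mod4_ne_1:
  assumes sf: "squarefree d" and q: "a * a + b * c - r * s = d"
    and dvd: "int N dvd a" "int N dvd b - d" "int N dvd c - 1" "int N dvd r" "int N dvd s"
  obtains a' b' c' r' s' where "kconj N (kmat a b c r s) (kmat a' b' c' r' s')"
    "d * int N dvd a'" "d * int N dvd b' - d" "int N dvd c' - 1" "d * int N dvd r'" "d * int N dvd s'"
proof -
  have "\<not> p dvd int N" if "Factorial_Ring.prime p" "p dvd c" for p
  proof
    assume "p dvd int N"
    then have "p dvd c - (c - 1)" using dvd(3) that(2) by (meson dvd_diff dvd_trans)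
    then show False using that(1) by (simp add: prime_int_iff)
  qed
  then obtain a1 b1 c1 r1 s1 where
    k1: "kconj N (kmat a b c r s) (kmat a1 b1 c1 r1 s1)" and cop: "coprime c1 d"
    using kconj_coprime[OF sf q] by metis
  note i1 = kconj_kmat_invariants[OF k1]
  have dvd1: "int N dvd a1" "int N dvd c1 - 1" "int N dvd r1" "int N dvd s1"
    using dvd_add[OF i1(2) dvd(1)] dvd_add[OF i1(4) dvd(3)] dvd_add[OF i1(5) dvd(4)]
      dvd_add[OF i1(6) dvd(5)] by simp_all
  obtain a0 where a0: "a1 = int N * a0" using dvd1(1) by (auto elim!: dvdE)
  obtain x where x: "d dvd a0 - x * c1" using solve_coprime[OF cop] .
  let ?n = "int N * x"
  let ?a = "a1 - ?n * c1"
  have k2: "kconj N (kmat a1 b1 c1 r1 s1)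
      (kmat ?a (b1 + 2 * a1 * ?n - ?n * ?n * c1) c1 r1 s1)"
    by (rule kconj_m1)
  obtain b' r' s' where k3: "kconj N (kmat ?a (b1 + 2 * a1 * ?n - ?n * ?n * c1) c1 r1 s1)
      (kmat ?a b' c1 r' s')" and rs: "d * int N dvd r'" "d * int N dvd s'"
    using kconj_eliminate_rs[OF cop dvd1(3,4)] by blast
  have k: "kconj N (kmat a b c r s) (kmat ?a b' c1 r' s')"
    using kconj_trans[OF kconj_trans[OF k1 k2] k3] .
  have "?a = (a0 - x * c1) * int N" by (simp add: a0 algebra_simps)
  then have a': "d * int N dvd ?a" using x by (simp add: mult_dvd_mono)
  have q': "?a * ?a + b' * c1 - r' * s' = d"
    using kconj_kmat_invariants(1)[OF k] q by simp
  have "d * int N dvd r' * s' - ?a * ?a"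
    by (rule dvd_diff[OF dvd_mult[OF rs(2)] dvd_mult[OF a']])
  then obtain y where y: "r' * s' - ?a * ?a = d * int N * y" by (auto elim!: dvdE)
  \<comment> \<open>This is the norm equation modulo d N. Since c1 is prime to d and 1 modulo N, it
    forces b' = d e with e = 1 modulo N.\<close>
  have "b' * c1 = d * (1 + int N * y)" using q' y by (simp add: algebra_simps)
  then have "d dvd b' * c1" by simp
  then have "d dvd b'" using cop by (simp add: coprime_dvd_mult_left_iff coprime_commute)
  then obtain e where e: "b' = d * e" by (auto elim!: dvdE)
  have "d \<noteq> 0" using sf by auto
  then have "e * c1 = 1 + int N * y" using \<open>b' * c1 = d * (1 + int N * y)\<close> by (simp add: e)
  then have "e - 1 = int N * y - e * (c1 - 1)" by (simp add: algebra_simps)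
  then have "int N dvd e - 1" using dvd1(2) by simp
  then have "d * int N dvd d * (e - 1)" by (intro mult_dvd_mono) auto
  then have "d * int N dvd b' - d" by (simp add: e algebra_simps)
  then show ?thesis using that[OF k a' _ dvd1(2) rs] by blast
qed

text \<open>The upper left block of K' \<open>N_beta\<close>^t has entries a + 2b, 2ma - b, c - 2a
  and a + 2mc. Once b = 2ma and c = 2a modulo d N, both diagonal entries become d a, so a itself is
  prescribed only modulo N.\<close>

lemma kconj_normal_form_mod4_eq_1:
  assumes sf: "squarefree d" and q: "a * a + b * c - r * s = d" and N: "N > 0"
    and d: "d = 4 * m + 1"
    and dvd: "int N dvd a - 1" "int N dvd b - 2 * m" "int N dvd c - 2" "int N dvd r" "int N dvd s"
  obtains a' b' c' r' s' where "kconj N (kmat a b c r s) (kmat a' b' c' r' s')"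
    "int N dvd a' - 1" "d * int N dvd b' - 2 * m * a'" "d * int N dvd c' - 2 * a'"
    "d * int N dvd r'" "d * int N dvd s'"
proof -
  have "\<not> p dvd int N" if "Factorial_Ring.prime p" "p dvd d" "p dvd c" for p
  proof
    assume "p dvd int N"
    then have "p dvd c - (c - 2)" using dvd(3) that(3) by (meson dvd_diff dvd_trans)
    then have "p dvd 2" by simp
    then have "p dvd d - 2 * (2 * m)" using that(2) by (meson dvd_diff dvd_mult2)
    then have "p dvd 1" by (simp add: d)
    then show False using that(1) by (simp add: prime_int_iff)
  qed
  then obtain a1 b1 c1 r1 s1 where
    k1: "kconj N (kmat a b c r s) (kmat a1 b1 c1 r1 s1)" and cop: "coprime c1 d"
    using kconj_coprime[OF sf q] by metis
  note i1 = kconj_kmat_invariants[OF k1]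
  have dvd1: "int N dvd a1 - 1" "int N dvd c1 - 2" "int N dvd r1" "int N dvd s1"
    using dvd_add[OF i1(2) dvd(1)] dvd_add[OF i1(4) dvd(3)] dvd_add[OF i1(5) dvd(4)]
      dvd_add[OF i1(6) dvd(5)] by simp_all
  have "int N dvd (c1 - 2) - 2 * (a1 - 1)" 
    by (rule dvd_diff[OF dvd1(2) dvd_mult[OF dvd1(1)]])
  then have "int N dvd c1 - 2 * a1" by simp
  then obtain w where w: "c1 - 2 * a1 = int N * w" by (auto elim!: dvdE)
  \<comment> \<open>The move below subtracts N x c1 from a, which adds 2 N x c1 to c1 - 2a; as d is
    odd, the coefficient 2 c1 is still invertible modulo d.\<close>
  have "coprime 2 d" by (simp add: d)
  then have cop2: "coprime (2 * c1) d" using cop by simp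
  obtain x where x: "d dvd - w - x * (2 * c1)" using solve_coprime[OF cop2] .
  let ?n = "int N * x"
  let ?a = "a1 - ?n * c1"
  have k2: "kconj N (kmat a1 b1 c1 r1 s1)
      (kmat ?a (b1 + 2 * a1 * ?n - ?n * ?n * c1) c1 r1 s1)"
    by (rule kconj_m1)
  obtain b' r' s' where k3: "kconj N (kmat ?a (b1 + 2 * a1 * ?n - ?n * ?n * c1) c1 r1 s1)
      (kmat ?a b' c1 r' s')" and rs: "d * int N dvd r'" "d * int N dvd s'"
    using kconj_eliminate_rs[OF cop dvd1(3,4)] by blast
  have k: "kconj N (kmat a b c r s) (kmat ?a b' c1 r' s')"
    using kconj_trans[OF kconj_trans[OF k1 k2] k3] .
  note i = kconj_kmat_invariants[OF k]
  have q': "?a * ?a + b' * c1 - r' * s' = d" using i(1) q by simp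
  have aN: "int N dvd ?a - 1" using dvd_add[OF i(2) dvd(1)] by (simp add: algebra_simps)
  have bN: "int N dvd b' - 2 * m" using dvd_add[OF i(3) dvd(2)] by simp
  have "c1 - 2 * ?a = - ((- w - x * (2 * c1)) * int N)" using w by (simp add: algebra_simps)
  moreover have "d * int N dvd (- w - x * (2 * c1)) * int N" by (rule mult_dvd_mono[OF x]) simp
  ultimately have c': "d * int N dvd c1 - 2 * ?a" by (simp only: dvd_minus_iff)
  have "int N dvd (b' - 2 * m) - 2 * m * (?a - 1)" 
    by (rule dvd_diff[OF bN dvd_mult[OF aN]])
  then have "int N dvd b' - 2 * m * ?a" by (simp add: algebra_simps)
  then obtain e where e: "b' - 2 * m * ?a = int N * e" by (auto elim!: dvdE)
  \<comment> \<open>Obtained by eliminating d = 4m + 1 and r' s' through the norm equation. Every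
    term on the right is divisible by d N, and 2a may be cancelled modulo d because it is congruent
    to c1.\<close>
  have "2 * ?a * (b' - 2 * m * ?a) = - (d * (?a - 1)) * (?a + 1) + r' * s' - b' * (c1 - 2 * ?a)"
  proof -
    have rs': "r' * s' = ?a * ?a + b' * c1 - d" using q' by simp
    show ?thesis unfolding rs' unfolding d by (simp add: algebra_simps)
  qed
  also have "d * int N dvd \<dots>"
  proof -
    have "d * int N dvd - (d * (?a - 1)) * (?a + 1)"
      using aN by (intro dvd_mult2) (simp add: mult_dvd_mono)
    then show ?thesis
      by (rule dvd_diff[OF dvd_add[OF _ dvd_mult[OF rs(2)]] dvd_mult[OF c']])
  qed
  finally have "d * int N dvd 2 * ?a * (int N * e)" by (simp only: e)
  also have "2 * ?a * (int N * e) = (2 * ?a * e) * int N" by (simp add: mult_ac)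
  finally have "d * int N dvd (2 * ?a * e) * int N" .
  then have "d dvd 2 * ?a * e" using N by (subst (asm) dvd_mult_cancel_right) simp
  moreover have "coprime (2 * ?a) d"
  proof -
    obtain z where "c1 - 2 * ?a = d * int N * z" using c' by (auto elim!: dvdE)
    then have "c1 = 2 * ?a + (int N * z) * d" by (simp add: algebra_simps)
    then show ?thesis using cop gcd_add_mult by (metis coprime_iff_gcd_eq_1 gcd.commute add.commute)
  qed
  ultimately have "d dvd e"
    by (simp add: coprime_dvd_mult_right_iff coprime_commute)
  then have "d * int N dvd b' - 2 * m * ?a"
    unfolding e by (simp add: mult.commute)
  then show ?thesis using that[OF k aN _ c' rs] by blast
qed

section \<open>Recovering the group element from a normal form\<close>

lemma transpose_N_beta_eq_kmat:
  "transpose (N_beta d) = (if d mod 4 = 1 then kmat 1 (2 * (d div 4)) 2 0 0 else kmat 0 d 1 0 0)"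
  by (simp add: N_beta_def beta_def kmat_def matrix_entries)

lemma kmat_mult_N_beta_mod4_ne_1:
  assumes "d mod 4 \<noteq> 1"
    and "d * int N dvd a" "d * int N dvd b - d" "int N dvd c - 1" "d * int N dvd r" "d * int N dvd s"
  obtains E where "int_mat E" "kmat a b c r s ** transpose (N_beta d) = of_int d *\<^sub>R (mat 1 + real N *\<^sub>R E)"
proof -
  obtain a' b' c' r' s' where "a = d * int N * a'" "b - d = d * int N * b'" "c - 1 = int N * c'"
    "r = d * int N * r'" "s = d * int N * s'"
    using assms unfolding dvd_def by blast
  then have *: "a = d * int N * a'" "b = d + d * int N * b'" "c = 1 + int N * c'"
    "r = d * int N * r'" "s = d * int N * s'" by linarith+
  let ?R = "\<lambda>x::int. real_of_int x"
  \<comment> \<open>The entries of (K \<open>N_beta\<close>^t - d) / (d N), computed from the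
    product.\<close>
  define E where "E = block
    (vector [vector [?R b', ?R (d * a')], vector [- ?R a', ?R c']])
    (vector [vector [?R (d * r'), 0], vector [0, - ?R r']])
    (vector [vector [?R s', 0], vector [0, - ?R (d * s')]])
    (vector [vector [?R c', ?R a'], vector [- ?R (d * a'), ?R b']])"
  have "int_mat E" by (simp add: int_mat_def forall_2_plus_2 E_def)
  moreover have "kmat a b c r s ** transpose (N_beta d) = of_int d *\<^sub>R (mat 1 + real N *\<^sub>R E)"
  proof -
    have tN: "transpose (N_beta d) = kmat 0 d 1 0 0"
      using assms(1) by (simp add: transpose_N_beta_eq_kmat)
    show ?thesis
      unfolding tN E_def by (simp add: kmat_def matrix_entries *) (simp add: algebra_simps)
  qed
  ultimately show ?thesis using that by blast
qed

lemma kmat_mult_N_beta_mod4_eq_1: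
  assumes d: "d mod 4 = 1" and m: "m = d div 4"
    and "int N dvd a - 1" "d * int N dvd b - 2 * m * a" "d * int N dvd c - 2 * a"
      "d * int N dvd r" "d * int N dvd s"
  obtains E where "int_mat E" "kmat a b c r s ** transpose (N_beta d) = of_int d *\<^sub>R (mat 1 + real N *\<^sub>R E)"
proof -
  obtain a' b' c' r' s' where "a - 1 = int N * a'" "b - 2 * m * a = d * int N * b'"
    "c - 2 * a = d * int N * c'" "r = d * int N * r'" "s = d * int N * s'"
    using assms unfolding dvd_def by blast
  then have *: "a = 1 + int N * a'" "b = 2 * m * a + d * int N * b'" "c = 2 * a + d * int N * c'"
    "r = d * int N * r'" "s = d * int N * s'" by linarith+
  have dm: "d = 4 * m + 1" using d m by presburger
  let ?R = "\<lambda>x::int. real_of_int x"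
  define E where "E = block
    (vector [vector [?R (a' + 2 * b'), - ?R b'], vector [?R c', ?R (a' + 2 * m * c')]])
    (vector [vector [?R (2 * m * r'), - ?R r'], vector [- ?R r', - ?R (2 * r')]])
    (vector [vector [?R (2 * s'), - ?R s'], vector [- ?R s', - ?R (2 * m * s')]])
    (vector [vector [?R (a' + 2 * m * c'), - ?R c'], vector [?R b', ?R (a' + 2 * b')]])"
  have "int_mat E" by (simp add: int_mat_def forall_2_plus_2 E_def)
  moreover have "kmat a b c r s ** transpose (N_beta d) = of_int d *\<^sub>R (mat 1 + real N *\<^sub>R E)"
  proof -
    have tN: "transpose (N_beta d) = kmat 1 (2 * m) 2 0 0"
      using d m by (simp add: transpose_N_beta_eq_kmat)
    show ?thesis
      unfolding tN E_def by (simp add: kmat_def matrix_entries *) (simp add: dm algebra_simps)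
  qed
  ultimately show ?thesis using that by blast
qed

lemma N_beta_symp_form_transpose:
  "N_beta d ** symp_form ** transpose (N_beta d) = of_int d *\<^sub>R symp_form"
proof -
  have "transpose (0::real^2^2) = 0" by (simp add: transpose_def vec_eq_iff)
  then show ?thesis
    by (simp add: N_beta_def symp_form_def transpose_block block_mult block_scaleR beta_sq
        matrix_transpose_mul[symmetric] transpose_scalar)
qed

text \<open>K and \<open>N_beta\<close>^t both scale the symplectic form by d, so K
  \<open>N_beta\<close>^t / d is symplectic. The relation K^2 = d becomes hat(g) g = 1, so hat(g) is
  the inverse of g and lies in Gamma(N) without further conditions.\<close>

lemma Gamma_N_of_multiplication:
  assumes d: "d \<noteq> 0" and sq: "K ** K = of_int d *\<^sub>R mat 1"
    and symp: "transpose K ** symp_form ** K = of_int d *\<^sub>R symp_form"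
    and E: "int_mat E" "K ** transpose (N_beta d) = of_int d *\<^sub>R (mat 1 + real N *\<^sub>R E)"
  obtains g where "g \<in> Gamma_N d N" "K = transpose (N_beta d ** g)"
proof -
  let ?B = "transpose (N_beta d)"
  define g where "g = mat 1 + real N *\<^sub>R transpose E"
  have tg: "transpose g = mat 1 + real N *\<^sub>R E"
    by (simp add: g_def vec_eq_iff transpose_def mat_def)
  have KB: "K ** ?B = of_int d *\<^sub>R transpose g" by (simp add: E(2) tg)
  have "(K ** ?B) ** ?B = of_int d *\<^sub>R K"
    by (simp add: transpose_N_beta_sq flip: matrix_mul_assoc)
  then have "of_int d *\<^sub>R (transpose g ** ?B) = of_int d *\<^sub>R K" by (simp add: KB)
  then have K: "K = transpose (N_beta d ** g)"
    using d by (simp add: matrix_transpose_mul)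
  have "transpose (K ** ?B) ** symp_form ** (K ** ?B)
      = N_beta d ** (transpose K ** symp_form ** K) ** ?B"
    by (simp add: matrix_transpose_mul matrix_mul_assoc)
  also have "\<dots> = (of_int d * of_int d) *\<^sub>R symp_form"
    by (simp add: symp N_beta_symp_form_transpose)
  finally have "(of_int d * of_int d) *\<^sub>R (g ** symp_form ** transpose g)
      = (of_int d * of_int d) *\<^sub>R symp_form"
    by (simp add: KB transpose_scalar)
  then have "transpose g \<in> Sp4_real" using d by (simp add: Sp4_real_iff)
  then have tg_cong: "transpose g \<in> principal_congruence N"
    using E(1) tg by (auto simp: principal_congruence_iff)
  then have g: "g \<in> principal_congruence N"
    using principal_congruence_transpose by force
  have "transpose (K ** K) = N_beta d ** g ** (N_beta d ** g)"
    by (simp add: K matrix_transpose_mul)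
  then have "N_beta d ** g ** N_beta d ** g = of_int d *\<^sub>R mat 1"
    by (simp add: sq transpose_scalar matrix_mul_assoc)
  then have "hat_Sp d g ** N_beta d ** N_beta d ** g = of_int d *\<^sub>R mat 1"
    using d by (simp add: hat_Sp_N_beta)
  then have "hat_Sp d g ** (N_beta d ** N_beta d) ** g = of_int d *\<^sub>R mat 1"
    by (simp add: matrix_mul_assoc)
  then have "of_int d *\<^sub>R (hat_Sp d g ** g) = of_int d *\<^sub>R mat 1"
    by (simp add: N_beta_sq)
  then have "hat_Sp d g ** g = mat 1" using d by simp
  then have "hat_Sp d g = symp_inv g"
    using symp_inv_unique principal_congruence_Sp4[OF g] by blast
  then have "g \<in> Gamma_N d N"
    using g principal_congruence_inv by (simp add: Gamma_N_iff[OF d])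
  then show ?thesis using K that by blast
qed

text \<open>Surjectivity comes down to this: after M changes the lift, the multiplication has the
  shape that occurs in \<open>kappa_Z\<close>.\<close>

proposition multiplication_conj_Gamma_N:
  assumes d: "d < 0" and sf: "squarefree d" and N: "N > 0"
    and E: "int_mat E" "K = transpose (N_beta d) + real N *\<^sub>R E"
    and sq: "K ** K = of_int d *\<^sub>R mat 1"
    and symp: "transpose K ** symp_form ** K = of_int d *\<^sub>R symp_form"
  obtains M g where "M \<in> principal_congruence N" "g \<in> Gamma_N d N"
    "K ** M = M ** transpose (N_beta d ** g)"
proof -
  have d0: "d \<noteq> 0" using d by simp
  have "int_mat K"
    unfolding E(2) by (intro int_mat_add int_mat_transpose int_mat_N_beta int_mat_of_int E(1)) simp
  then obtain a b c r s where K: "K = kmat a b c r s" and q: "a * a + b * c - r * s = d"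
    using self_adjoint_eq_kmat[OF d _ sq symp] by metis
  have "\<exists>K' E'. kconj N K K' \<and> int_mat E' \<and>
      K' ** transpose (N_beta d) = of_int d *\<^sub>R (mat 1 + real N *\<^sub>R E')"
  proof (cases "d mod 4 = 1")
    case False
    then have "kmat a b c r s = kmat 0 d 1 0 0 + real N *\<^sub>R E"
      using E(2) by (simp add: K transpose_N_beta_eq_kmat)
    from kmat_cong[OF E(1) this] obtain a' b' c' r' s' where
      k: "kconj N (kmat a b c r s) (kmat a' b' c' r' s')"
      and "d * int N dvd a'" "d * int N dvd b' - d" "int N dvd c' - 1" "d * int N dvd r'" "d * int N dvd s'"
      using kconj_normal_form_mod4_ne_1[OF sf q] by (metis diff_zero)
    then show ?thesis
      using kmat_mult_N_beta_mod4_ne_1[OF False] unfolding K by metis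
  next
    case True
    let ?m = "d div 4"
    have dm: "d = 4 * ?m + 1" using True by presburger
    from True have "kmat a b c r s = kmat 1 (2 * ?m) 2 0 0 + real N *\<^sub>R E"
      using E(2) by (simp add: K transpose_N_beta_eq_kmat)
    from kmat_cong[OF E(1) this] obtain a' b' c' r' s' where
      k: "kconj N (kmat a b c r s) (kmat a' b' c' r' s')"
      and "int N dvd a' - 1" "d * int N dvd b' - 2 * ?m * a'" "d * int N dvd c' - 2 * a'"
        "d * int N dvd r'" "d * int N dvd s'"
      using kconj_normal_form_mod4_eq_1[OF sf q N dm] by (metis diff_zero)
    then show ?thesis
      using kmat_mult_N_beta_mod4_eq_1[OF True refl] unfolding K by metis
  qed
  then obtain K' E' where k: "kconj N K K'" and E': "int_mat E'"
    "K' ** transpose (N_beta d) = of_int d *\<^sub>R (mat 1 + real N *\<^sub>R E')" by blast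
  obtain M where M: "M \<in> principal_congruence N" "K ** M = M ** K'"
    using k by (auto simp: kconj_def)
  have "transpose M ** symp_form ** M = symp_form"
    using principal_congruence_Sp4[OF M(1)] by (simp add: Sp4_real_iff)
  have tinv: "transpose (symp_inv M) ** symp_form ** symp_inv M = symp_form"
    using Sp4_real_inv[OF principal_congruence_Sp4[OF M(1)]] by (simp add: Sp4_real_iff)
  have "symp_inv M ** (M ** K') = symp_inv M ** K ** M"
    by (simp add: M(2)[symmetric] matrix_mul_assoc)
  then have K': "K' = symp_inv M ** K ** M"
    by (simp add: matrix_mul_assoc symp_inv[OF principal_congruence_Sp4[OF M(1)]])
  have "transpose K' ** symp_form ** K' =
      transpose M ** (transpose K ** (transpose (symp_inv M) ** symp_form ** symp_inv M) ** K) ** M"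
    by (simp add: K' matrix_transpose_mul matrix_mul_assoc)
  also have "\<dots> = of_int d *\<^sub>R symp_form"
    by (simp add: tinv symp \<open>transpose M ** symp_form ** M = symp_form\<close>)
  finally have "transpose K' ** symp_form ** K' = of_int d *\<^sub>R symp_form" .
  then obtain g where "g \<in> Gamma_N d N" "K' = transpose (N_beta d ** g)"
    using Gamma_N_of_multiplication[OF d0 kconj_sq[OF k sq] _ E'] by blast
  then show ?thesis using that M by blast
qed

section \<open>Lattices, lifts and isomorphisms\<close>

lemma symplectic_frame_inj:
  assumes F: "linear F" and H: "pos_def_hermitian H"
    and symp: "\<And>x y. Im (H (F x) (F y)) = x \<bullet> (symp_form *v y)"
  shows "inj F"
  unfolding linear_injective_0[OF F]
  using symp symp_form_nondegenerate pos_def_hermitian_zero[OF H] by (metis zero_complex.simps(2))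

lemma symplectic_frame_bij:
  assumes F: "linear F" and H: "pos_def_hermitian H"
    and symp: "\<And>x y. Im (H (F x) (F y)) = x \<bullet> (symp_form *v y)"
  shows "bij F"
proof -
  obtain P W where P: "invertible P" "W \<in> siegel" "\<And>x. F x = P *v F_Z W x"
    using period_normal_form[OF assms] by metis
  have "F = (*v) P \<circ> F_Z W" using P(3) by auto
  then show ?thesis
    using P invertible_eq_bij bij_comp bij_F_Z by metis
qed

text \<open>Injectivity and independence of the basis are automatic, since a frame pulling Q back to
  a nondegenerate form is injective.\<close>

lemma symplectic_basis_iff:
  assumes H: "pos_def_hermitian H"
  shows "symplectic_basis L H b \<longleftrightarrow> L = frame b ` int_vecs \<and>
    (\<forall>x y. Im (H (frame b x) (frame b y)) = x \<bullet> (symp_form *v y))"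
proof -
  have "inj b \<and> independent (range b)"
    if symp: "\<forall>x y. Im (H (frame b x) (frame b y)) = x \<bullet> (symp_form *v y)"
  proof -
    have inj: "inj (frame b)"
      using symplectic_frame_inj[OF linear_frame H] symp by blast
    have "range (\<lambda>i. axis i 1 :: real^(2+2)) = Basis"
      by (auto simp: Basis_vec_def)
    then have "frame b ` Basis = range b"
      by (metis (no_types, lifting) frame_axis image_cong image_image)
    moreover have "independent (frame b ` Basis)"
      by (rule linear_independent_injective_image[OF linear_frame independent_Basis])
        (use inj in \<open>auto intro: inj_on_subset\<close>)
    moreover have "inj b"
      using inj by (metis (mono_tags, lifting) axis_eq_axis frame_axis injD injI zero_neq_one)
    ultimately show ?thesis by simp
  qed
  then show ?thesis
    using imag_form_frame[OF H, of b]
    unfolding symplectic_basis_def lattice_basis_def symp_form_def by blast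
qed

lemma is_lift_iff:
  assumes "pos_def_hermitian H"
  shows "is_lift N L H U b \<longleftrightarrow> L = frame b ` int_vecs \<and>
    (\<forall>x y. Im (H (frame b x) (frame b y)) = x \<bullet> (symp_form *v y)) \<and>
    (\<forall>i. U i = torus_pt L ((1 / real N) *\<^sub>R b i))"
  by (auto simp: is_lift_def symplectic_basis_iff[OF assms])

section \<open>Points of the torus and its N-torsion\<close>

definition additive_group :: "'a::ab_group_add set \<Rightarrow> bool" where
  "additive_group L \<longleftrightarrow> 0 \<in> L \<and> (\<forall>u\<in>L. \<forall>v\<in>L. u - v \<in> L)"

lemma additive_group_simps:
  assumes "additive_group L"
  shows "0 \<in> L" "u \<in> L \<Longrightarrow> v \<in> L \<Longrightarrow> u - v \<in> L" "u \<in> L \<Longrightarrow> v \<in> L \<Longrightarrow> u + v \<in> L"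
    "u \<in> L \<Longrightarrow> - u \<in> L"
proof -
  show 0: "0 \<in> L" and diff: "u \<in> L \<Longrightarrow> v \<in> L \<Longrightarrow> u - v \<in> L" for u v
    using assms by (auto simp: additive_group_def)
  show neg: "u \<in> L \<Longrightarrow> - u \<in> L" for u
    using diff[OF 0, of u] by simp
  show "u \<in> L \<Longrightarrow> v \<in> L \<Longrightarrow> u + v \<in> L"
    using diff[OF _ neg, of u v] by simp
qed

lemma additive_group_lattice:
  assumes "linear F"
  shows "additive_group (F ` int_vecs)"
proof -
  have "0 \<in> F ` int_vecs"
    by (rule image_eqI[of _ _ 0]) (simp_all add: linear_0[OF assms] int_vecs_closed)
  moreover have "F x - F y \<in> F ` int_vecs" if "x \<in> int_vecs" "y \<in> int_vecs" for x y
    by (rule image_eqI[of _ _ "x - y"]) (simp_all add: linear_diff[OF assms] int_vecs_closed that)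
  ultimately show ?thesis by (auto simp: additive_group_def)
qed

lemma torus_pt_eq_iff:
  assumes "additive_group L"
  shows "torus_pt L v = torus_pt L w \<longleftrightarrow> v - w \<in> L"
proof
  assume "torus_pt L v = torus_pt L w"
  moreover have "v \<in> torus_pt L v" by (simp add: torus_pt_def additive_group_simps[OF assms])
  ultimately show "v - w \<in> L" by (simp add: torus_pt_def)
next
  assume vw: "v - w \<in> L"
  have "u - v \<in> L \<longleftrightarrow> u - w \<in> L" for u
    using additive_group_simps(3)[OF assms vw, of "u - v"] additive_group_simps(2)[OF assms _ vw, of "u - w"]
    by (auto simp: algebra_simps)
  then show "torus_pt L v = torus_pt L w" by (auto simp: torus_pt_def)
qed

lemma image_torus_pt:
  assumes "linear f" "bij f" "f ` L = L'"
  shows "f ` torus_pt L v = torus_pt L' (f v)"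
proof -
  have "f w - f v \<in> L' \<longleftrightarrow> w - v \<in> L" for w
    using assms inj_image_mem_iff[of f "w - v" L]
    by (simp add: linear_diff[OF assms(1), symmetric] bij_is_inj)
  then have "f w \<in> torus_pt L' (f v) \<longleftrightarrow> w \<in> torus_pt L v" for w by (simp add: torus_pt_def)
  then show ?thesis using assms(2) by (auto simp: image_iff) (metis bij_pointE)
qed

lemma additive_group_sum:
  assumes "additive_group L" "\<And>i. i \<in> A \<Longrightarrow> f i \<in> L"
  shows "sum f A \<in> L"
  using assms(2) by (induction A rule: infinite_finite_induct)
    (simp_all add: additive_group_simps[OF assms(1)])

lemma additive_group_of_nat_scale:
  fixes u :: "'a::real_vector"
  assumes "additive_group L" "u \<in> L"
  shows "real k *\<^sub>R u \<in> L"
  by (induction k) (simp_all add: assms additive_group_simps[OF assms(1)] scaleR_left_distrib)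

lemma lattice_frame_mem_iff:
  "inj F \<Longrightarrow> F x \<in> F ` int_vecs \<longleftrightarrow> x \<in> int_vecs"
  by (rule inj_image_mem_iff)

text \<open>A torsion point is the image of z / N with z integral. Other representatives u_i change
  a combination only by lattice vectors, so the coefficients are determined modulo N, hence uniquely
  in the range below N.\<close>

lemma torsion_basis_of_frame:
  assumes N: "N > 0" and inj: "inj (frame b)" and L: "L = frame b ` int_vecs"
    and U: "\<And>i. U i = torus_pt L ((1 / real N) *\<^sub>R b i)"
  shows "torsion_basis N L U"
proof -
  note F = linear_frame[of b]
  have grp: "additive_group L" unfolding L by (rule additive_group_lattice[OF F])
  have "U i \<in> torsion_pts N L" for i
    using N by (auto simp: torsion_pts_def U L intro!: exI[of _ "(1 / real N) *\<^sub>R b i"] image_eqI[of _ _ "axis i 1"]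
        simp: int_vecs_closed)
  moreover have "\<exists>!k::2+2 \<Rightarrow> nat. (\<forall>i. k i < N) \<and>
        (\<exists>u. (\<forall>i. u i \<in> U i) \<and> P = torus_pt L (\<Sum>i\<in>UNIV. real (k i) *\<^sub>R u i))"
    if "P \<in> torsion_pts N L" for P
  proof -
    obtain v where v: "P = torus_pt L v" "real N *\<^sub>R v \<in> L" using \<open>P \<in> _\<close> by (auto simp: torsion_pts_def)
    then obtain x where x: "x \<in> int_vecs" "real N *\<^sub>R v = frame b x" by (auto simp: L)
    have "\<forall>i. \<exists>k. x $ i = of_int k"
      using x(1) by (auto simp: int_vecs_def elim!: Ints_cases)
    then obtain z :: "2+2 \<Rightarrow> int" where z: "x $ i = of_int (z i)" for i by metis
    have "v = (1 / real N) *\<^sub>R (real N *\<^sub>R v)" using N by simp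
    then have v': "v = frame b ((1 / real N) *\<^sub>R x)" by (simp add: x(2) linear_scale[OF F])
    have eq_iff: "P = torus_pt L (\<Sum>i\<in>UNIV. real (k i) *\<^sub>R u i) \<longleftrightarrow> (\<forall>i. int N dvd z i - int (k i))"
      if u: "\<forall>i. u i \<in> U i" for k u
    proof -
      let ?y = "\<chi> i. real (k i) / real N"
      have "u i - (1 / real N) *\<^sub>R b i \<in> L" for i
        using u by (simp add: U torus_pt_def)
      then have "(\<Sum>i\<in>UNIV. real (k i) *\<^sub>R (u i - (1 / real N) *\<^sub>R b i)) \<in> L"
        by (intro additive_group_sum[OF grp] additive_group_of_nat_scale[OF grp])
      then have "(\<Sum>i\<in>UNIV. real (k i) *\<^sub>R u i) - frame b ?y \<in> L"
        by (simp add: frame_def scaleR_diff_right sum_subtractf)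
      then have "torus_pt L (\<Sum>i\<in>UNIV. real (k i) *\<^sub>R u i) = torus_pt L (frame b ?y)"
        by (rule iffD2[OF torus_pt_eq_iff[OF grp]])
      then have "P = torus_pt L (\<Sum>i\<in>UNIV. real (k i) *\<^sub>R u i) \<longleftrightarrow> P = torus_pt L (frame b ?y)"
        by (simp only:)
      also have "\<dots> \<longleftrightarrow> frame b ((1 / real N) *\<^sub>R x - ?y) \<in> L"
        by (simp add: v(1) v' torus_pt_eq_iff[OF grp] linear_diff[OF F])
      also have "\<dots> \<longleftrightarrow> (\<forall>i. real_of_int (z i - int (k i)) / real N \<in> \<int>)"
        unfolding L lattice_frame_mem_iff[OF inj] by (simp add: int_vecs_def z diff_divide_distrib)
      also have "\<dots> \<longleftrightarrow> (\<forall>i. int N dvd z i - int (k i))"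
      proof -
        have "real_of_int m / real N \<in> \<int> \<longleftrightarrow> int N dvd m" for m
        proof
          assume "real_of_int m / real N \<in> \<int>"
          then obtain l where "real_of_int m / real N = of_int l" by (auto elim: Ints_cases)
          then have "real_of_int m = of_int (int N * l)" using N by (simp add: field_simps)
          then have "m = int N * l" by (simp only: of_int_eq_iff)
          then show "int N dvd m" by simp
        next
          assume "int N dvd m"
          then show "real_of_int m / real N \<in> \<int>"
            using of_int_divide_in_Ints[of "int N" m, where 'a=real] by simp
        qed
        then show ?thesis by blast
      qed
      finally show ?thesis .
    qed
    have mem: "\<forall>i. (1 / real N) *\<^sub>R b i \<in> U i"
      by (simp add: U torus_pt_def additive_group_simps[OF grp])
    show ?thesis
    proof (rule ex1I)
      let ?k = "\<lambda>i. nat (z i mod int N)"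
      have "\<forall>i. int N dvd z i - int (?k i)"
        using N by (simp add: mod_eq_dvd_iff[symmetric])
      then have "P = torus_pt L (\<Sum>i\<in>UNIV. real (?k i) *\<^sub>R ((1 / real N) *\<^sub>R b i))"
        by (rule iffD2[OF eq_iff[OF mem, of ?k]])
      moreover have "\<forall>i. ?k i < N"
        using N by (simp add: nat_less_iff)
      ultimately show "(\<forall>i. ?k i < N) \<and>
          (\<exists>u. (\<forall>i. u i \<in> U i) \<and> P = torus_pt L (\<Sum>i\<in>UNIV. real (?k i) *\<^sub>R u i))"
        using mem by (intro conjI exI[of _ "\<lambda>i. (1 / real N) *\<^sub>R b i"])
    next
      fix k :: "2+2 \<Rightarrow> nat"
      assume "(\<forall>i. k i < N) \<and> (\<exists>u. (\<forall>i. u i \<in> U i) \<and> P = torus_pt L (\<Sum>i\<in>UNIV. real (k i) *\<^sub>R u i))"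
      then have k: "\<And>i. k i < N" "\<And>i. int N dvd z i - int (k i)"
        using eq_iff by blast+
      then have "z i mod int N = int (k i)" for i
        by (metis mod_eq_dvd_iff mod_pos_pos_trivial of_nat_0_le_iff of_nat_less_iff)
      then show "k = (\<lambda>i. nat (z i mod int N))" by simp
    qed
  qed
  ultimately show ?thesis by (simp add: torsion_basis_def)
qed

section \<open>Isomorphisms of surfaces with level structure\<close>

lemma linear_complex_imp_real:
  assumes "Vector_Spaces.linear (*s) (*s) (f :: complex^2 \<Rightarrow> complex^2)"
  shows "linear f"
  using Vector_Spaces.linear.axioms(3)[OF assms]
  by (intro linearI) (simp_all add: module_hom_def module_hom_axioms_def scaleR_eq_scale_of_real)

text \<open>Preservation of the level structure is stated for points of the torus, with no choice of
  lifts, so that composition and inversion are immediate.\<close>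

definition surface_iso :: "surface_data \<Rightarrow> surface_data \<Rightarrow> (complex^2 \<Rightarrow> complex^2) \<Rightarrow> bool" where
  "surface_iso S S' f \<longleftrightarrow> Vector_Spaces.linear (*s) (*s) f \<and> bij f \<and> f ` lat S = lat S' \<and>
     (\<forall>u v. herm S' (f u) (f v) = herm S u v) \<and> (\<forall>u. f (kap S u) = kap S' (f u)) \<and>
     (\<forall>i. f ` lev S i = lev S' i)"

lemma moduli_objectsD:
  assumes "S \<in> moduli_objects d N"
  shows "pos_def_hermitian (herm S)" "\<exists>b. is_lift N (lat S) (herm S) (lev S) b"
    "additive_group (lat S)"
proof -
  show H: "pos_def_hermitian (herm S)" and b: "\<exists>b. is_lift N (lat S) (herm S) (lev S) b"
    using assms by (auto simp: moduli_objects_def pp_abelian_surface_def level_structure_def)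
  show "additive_group (lat S)"
    using b unfolding is_lift_iff[OF H] by (metis additive_group_lattice linear_frame)
qed

text \<open>For each pair of lifts the congruences say that f matches the torsion points. As this no
  longer mentions the lifts, existence of lifts suffices for the equivalence.\<close>

lemma moduli_iso_iff:
  assumes S: "S \<in> moduli_objects d N" and S': "S' \<in> moduli_objects d N"
  shows "moduli_iso N S S' \<longleftrightarrow> (\<exists>f. surface_iso S S' f)"
proof -
  note H = moduli_objectsD(1)[OF S] and H' = moduli_objectsD(1)[OF S']
  have "((\<forall>u v. herm S (inv_into UNIV f u) (inv_into UNIV f v) = herm S' u v) \<and> f \<circ> kap S \<circ> inv_into UNIV f = kap S' \<and>
        (\<exists>b b'. is_lift N (lat S) (herm S) (lev S) b \<and> is_lift N (lat S') (herm S') (lev S') b' \<and>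
          (\<forall>i. f ((1 / real N) *\<^sub>R b i) - (1 / real N) *\<^sub>R b' i \<in> lat S')))
    \<longleftrightarrow> ((\<forall>u v. herm S' (f u) (f v) = herm S u v) \<and> (\<forall>u. f (kap S u) = kap S' (f u)) \<and>
          (\<forall>i. f ` lev S i = lev S' i))"
    if f: "Vector_Spaces.linear (*s) (*s) f" "bij f" "f ` lat S = lat S'" for f
  proof -
    have inv: "inv_into UNIV f (f u) = u" "f (inv_into UNIV f u) = u" for u
      using f(2) by (simp_all add: bij_is_inj bij_is_surj surj_f_inv_f)
    have 1: "(\<forall>u v. herm S (inv_into UNIV f u) (inv_into UNIV f v) = herm S' u v) \<longleftrightarrow> (\<forall>u v. herm S' (f u) (f v) = herm S u v)"
      by (metis inv)
    have 2: "f \<circ> kap S \<circ> inv_into UNIV f = kap S' \<longleftrightarrow> (\<forall>u. f (kap S u) = kap S' (f u))"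
      by (auto simp: fun_eq_iff inv) (metis inv)
    have lev: "(\<forall>i. f ((1 / real N) *\<^sub>R b i) - (1 / real N) *\<^sub>R b' i \<in> lat S') \<longleftrightarrow> (\<forall>i. f ` lev S i = lev S' i)"
      if "is_lift N (lat S) (herm S) (lev S) b" "is_lift N (lat S') (herm S') (lev S') b'" for b b'
    proof -
      have "lev S i = torus_pt (lat S) ((1 / real N) *\<^sub>R b i)"
        "lev S' i = torus_pt (lat S') ((1 / real N) *\<^sub>R b' i)" for i
        using that by (simp_all add: is_lift_def)
      then show ?thesis
        by (simp add: image_torus_pt[OF linear_complex_imp_real[OF f(1)] f(2,3)]
            torus_pt_eq_iff[OF moduli_objectsD(3)[OF S']])
    qed
    then have 3: "(\<exists>b b'. is_lift N (lat S) (herm S) (lev S) b \<and> is_lift N (lat S') (herm S') (lev S') b' \<and>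
          (\<forall>i. f ((1 / real N) *\<^sub>R b i) - (1 / real N) *\<^sub>R b' i \<in> lat S')) \<longleftrightarrow> (\<forall>i. f ` lev S i = lev S' i)"
      using moduli_objectsD(2)[OF S] moduli_objectsD(2)[OF S'] by blast
    show ?thesis unfolding 1 2 3 ..
  qed
  then show ?thesis
    unfolding moduli_iso_def surface_iso_def by meson
qed

lemma moduli_rel_iff:
  "(S, S') \<in> moduli_rel d N \<longleftrightarrow>
     S \<in> moduli_objects d N \<and> S' \<in> moduli_objects d N \<and> (\<exists>f. surface_iso S S' f)"
  using moduli_iso_iff by (auto simp: moduli_rel_def)

lemma surface_iso_refl: "surface_iso S S id"
  by (simp add: surface_iso_def vec.linear_id)

lemma surface_iso_comp:
  assumes "surface_iso S S' f" "surface_iso S' S'' g"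
  shows "surface_iso S S'' (g \<circ> f)"
proof -
  have "Vector_Spaces.linear (*s) (*s) (g \<circ> f)"
    using assms by (intro Vector_Spaces.linear_compose) (auto simp: surface_iso_def)
  moreover have "bij (g \<circ> f)"
    using assms by (intro bij_comp) (auto simp: surface_iso_def)
  ultimately show ?thesis
    using assms unfolding surface_iso_def image_comp[symmetric] by (simp del: image_comp)
qed

lemma surface_iso_inv:
  assumes "surface_iso S S' f"
  shows "surface_iso S' S (inv_into UNIV f)"
proof -
  have f: "Vector_Spaces.linear (*s) (*s) f" "bij f" using assms by (auto simp: surface_iso_def)
  have inv: "inv_into UNIV f (f u) = u" "f (inv_into UNIV f u) = u" for u
    using f(2) by (simp_all add: bij_is_inj bij_is_surj surj_f_inv_f)
  have img: "inv_into UNIV f ` (f ` A) = A" for A by (simp add: image_image inv)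
  note lin = Vector_Spaces.linear.axioms(3)[OF f(1), unfolded module_hom_def module_hom_axioms_def]
  have "Vector_Spaces.linear (*s) (*s) (inv_into UNIV f)"
    by unfold_locales (use lin inv in metis)+
  then show ?thesis
    using assms inv img unfolding surface_iso_def by (metis bij_imp_bij_inv)
qed

lemma equiv_moduli_rel: "equiv (moduli_objects d N) (moduli_rel d N)"
proof (rule equivI)
  show "refl_on (moduli_objects d N) (moduli_rel d N)"
    by (auto simp: refl_on_def moduli_rel_iff intro: surface_iso_refl)
  show "sym (moduli_rel d N)"
    by (auto simp: sym_def moduli_rel_iff intro: surface_iso_inv)
  show "trans (moduli_rel d N)"
    by (auto simp: trans_def moduli_rel_iff intro: surface_iso_comp)
  show "moduli_rel d N \<subseteq> moduli_objects d N \<times> moduli_objects d N"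
    by (auto simp: moduli_rel_iff)
qed

text \<open>Lets a real linear map into C^2 be read in lattice coordinates; used for multiplications
  and for isomorphisms.\<close>

lemma linear_factor_matrix:
  fixes F :: "real^(2+2) \<Rightarrow> complex^2"
  assumes F: "linear F" "bij F" and phi: "linear \<phi>"
  obtains K :: mat4 where "\<And>x. \<phi> x = F (K *v x)"
proof -
  have inv: "F (inv_into UNIV F u) = u" for u using F(2) by (simp add: bij_is_surj surj_f_inv_f)
  have "linear (\<lambda>x. inv_into UNIV F (\<phi> x))"
    by (rule linearI; rule injD[OF bij_is_inj[OF F(2)]])
      (simp_all add: inv linear_add[OF F(1)] linear_scale[OF F(1)] linear_add[OF phi] linear_scale[OF phi])
  then have "matrix (\<lambda>x. inv_into UNIV F (\<phi> x)) *v x = inv_into UNIV F (\<phi> x)" for x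
    using fun_cong[OF matrix_vector_mul(2)] by simp
  then show ?thesis using that[of "matrix (\<lambda>x. inv_into UNIV F (\<phi> x))"] inv by simp
qed

lemma antilinear_linear: "antilinear k \<Longrightarrow> linear k"
  by (rule linearI) (simp_all add: antilinear_def scaleR_eq_scale_of_real)

lemma antilinear_eqI:
  assumes "antilinear k" "antilinear k'" "\<And>y. k (cvec y) = k' (cvec y)"
  shows "k u = k' u"
proof -
  have "u = cvec (re_vec u) + \<i> *s cvec (im_vec u)"
    by (simp add: vec_eq_iff cvec_def re_vec_def im_vec_def complex_eq_iff)
  then show ?thesis using assms unfolding antilinear_def by metis
qed

lemma antilinear_matrix_cnj: "antilinear (\<lambda>u. A *v cnj_vec u)"
proof -
  have "cnj_vec (c *s u) = cnj c *s cnj_vec u" for c and u :: "complex^2"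
    by (simp add: cnj_vec_def vec_eq_iff)
  then show ?thesis
    by (simp add: antilinear_def matrix_vector_right_distrib vector_scalar_commute)
qed

lemma antilinear_matrix_comp:
  assumes "antilinear k"
  shows "antilinear (\<lambda>u. A *v k (B *v u))"
  using assms by (simp add: antilinear_def matrix_vector_right_distrib vector_scalar_commute)

text \<open>On frames, k is P times \<open>F_Z (siegel_act g Z)\<close> after
  \<open>N_beta\<close>^t. Replacing g Z by hat Z turns this into P beta after complex conjugation,
  which is visibly antilinear.\<close>

lemma eq_siegel_act_iff:
  assumes d: "d < 0" and Z: "Z \<in> siegel" and g: "g \<in> Sp4_real"
    and k: "\<And>x. k (F_Z Z x) = F_Z Z (transpose (N_beta d ** g) *v x)"
  shows "hat_siegel d Z = siegel_act g Z \<longleftrightarrow> antilinear k"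
proof -
  let ?b = "map_matrix of_real (beta d) :: complex^2^2"
  let ?N = "transpose (N_beta d)"
  have d0: "d \<noteq> 0" using d by simp
  obtain P where P: "invertible P" "siegel_act g Z \<in> siegel"
    "\<And>x. F_Z Z (transpose g *v x) = P *v F_Z (siegel_act g Z) x"
    using siegel_act_period[OF Z g] by metis
  have k': "k (F_Z Z x) = P *v F_Z (siegel_act g Z) (?N *v x)" for x
    by (simp add: k matrix_transpose_mul P(3) flip: matrix_vector_mul_assoc)
  show ?thesis
  proof
    assume "hat_siegel d Z = siegel_act g Z"
    then have "k (F_Z Z x) = (P ** ?b) *v cnj_vec (F_Z Z x)" for x
      using F_Z_hat_siegel[OF d0, of Z x] by (simp add: k' flip: matrix_vector_mul_assoc)
    then have "k = (\<lambda>u. (P ** ?b) *v cnj_vec u)"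
      using bij_F_Z[OF Z] by (metis bij_pointE ext)
    then show "antilinear k" by (simp only: antilinear_matrix_cnj)
  next
    assume anti: "antilinear k"
    obtain P' where P': "P' ** P = mat 1" using P(1) by (auto simp: invertible_def)
    have anti': "antilinear (\<lambda>u. P' *v k u)"
      using antilinear_matrix_comp[OF anti, of P' "mat 1"] by simp
    have P'k: "P' *v k (F_Z Z x) = F_Z (siegel_act g Z) (?N *v x)" for x
      by (simp add: k' matrix_vector_mul_assoc P')
    \<comment> \<open>On the second summand period maps do not depend on the period matrix, so this
      holds before g Z and hat Z are known to agree; antilinearity extends it to C^2.\<close>
    have eq: "P' *v k (cvec y) = ?b *v cnj_vec (cvec y)" for y
    proof -
      have "F_Z (siegel_act g Z) (?N *v join 0 y) = ?b *v cvec y"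
        by (simp add: F_Z_eq parts_transpose_N_beta map_of_real_mult_cvec)
      moreover have "F_Z Z (join 0 y) = cvec y" by (simp add: F_Z_join)
      ultimately show ?thesis using P'k[of "join 0 y"] by simp
    qed
    have "P' *v k u = ?b *v cnj_vec u" for u
      by (rule antilinear_eqI[OF anti' antilinear_matrix_cnj eq])
    then have *: "F_Z (siegel_act g Z) (?N *v x) = F_Z (hat_siegel d Z) (?N *v x)" for x
      by (simp add: P'k[symmetric] F_Z_hat_siegel[OF d0])
    have "F_Z (hat_siegel d Z) y = F_Z (siegel_act g Z) y" for y
      using transpose_N_beta_surj[OF d0, of y] * by metis
    then show "hat_siegel d Z = siegel_act g Z" by (rule F_Z_inject)
  qed
qed

section \<open>The correspondence\<close>

lemma matrix_inner_scale:
  fixes T :: mat4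
  assumes "transpose T ** symp_form ** T = k *\<^sub>R symp_form"
  shows "(T *v x) \<bullet> (symp_form *v (T *v y)) = k * (x \<bullet> (symp_form *v y))"
proof -
  have "(T *v x) \<bullet> (symp_form *v (T *v y)) = x \<bullet> ((transpose T ** symp_form ** T) *v y)"
    by (simp add: inner_transpose_mult flip: matrix_vector_mul_assoc)
  then show ?thesis by (simp add: assms scaleR_matrix_vector_assoc[symmetric])
qed

lemma matrix_of_inner_scale:
  fixes T :: mat4
  assumes "\<And>x y. (T *v x) \<bullet> (symp_form *v (T *v y)) = k * (x \<bullet> (symp_form *v y))"
  shows "transpose T ** symp_form ** T = k *\<^sub>R symp_form"
proof -
  have "x \<bullet> ((transpose T ** symp_form ** T) *v y) = x \<bullet> ((k *\<^sub>R symp_form) *v y)" for x y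
    using assms[of x y]
    by (simp add: inner_transpose_mult scaleR_matrix_vector_assoc[symmetric] flip: matrix_vector_mul_assoc)
  then have "(transpose T ** symp_form ** T) *v y = (k *\<^sub>R symp_form) *v y" for y
    using vector_eq_ldot by blast
  then show ?thesis by (simp add: matrix_eq)
qed

lemma F_Z_frame: "frame (\<lambda>i. F_Z Z (axis i 1)) = F_Z Z"
  using linear_eq_frame[OF linear_F_Z] by simp

lemma kappa_Z_F_Z:
  assumes "Z \<in> siegel"
  shows "kappa_Z d Z g (F_Z Z x) = F_Z Z (transpose (N_beta d ** g) *v x)"
  by (simp add: kappa_Z_def bij_is_inj[OF bij_F_Z[OF assms]])

lemma is_lift_A_Z:
  assumes Z: "Z \<in> siegel"
  shows "is_lift N (L_Z Z) (H_Z Z) (lev (A_Z d N Z g)) (\<lambda>i. F_Z Z (axis i 1))"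
  unfolding is_lift_iff[OF H_Z_pos_def[OF Z]] F_Z_frame
  by (simp add: L_Z_def Im_H_Z_F_Z[OF Z] A_Z_def linear_scale[OF linear_F_Z])

text \<open>The relation hat(g) g = 1 is (\<open>N_beta\<close> g)^2 = d in disguise: moving g past
  \<open>N_beta\<close> turns it into hat(g).\<close>

lemma real_point_matrix:
  assumes d: "d < 0" and N: "N \<ge> 3" and Z: "Z \<in> siegel" and g: "g \<in> Gamma_N d N"
    and real: "hat_siegel d Z = siegel_act g Z"
  shows "transpose (N_beta d ** g) ** transpose (N_beta d ** g) = of_int d *\<^sub>R mat 1"
    "(transpose (N_beta d ** g) *v x) \<bullet> (symp_form *v (transpose (N_beta d ** g) *v y))
      = of_int d * (x \<bullet> (symp_form *v y))"
proof -
  have d0: "d \<noteq> 0" using d by simp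
  have "N_beta d ** g ** (N_beta d ** g) = N_beta d ** (g ** N_beta d) ** g"
    by (simp add: matrix_mul_assoc)
  also have "\<dots> = (N_beta d ** N_beta d) ** (hat_Sp d g ** g)"
    by (simp add: matrix_mul_assoc flip: hat_Sp_N_beta(2)[OF d0])
  also have "\<dots> = of_int d *\<^sub>R mat 1"
    by (simp add: real_point_cocycle[OF assms] N_beta_sq)
  finally show "transpose (N_beta d ** g) ** transpose (N_beta d ** g) = of_int d *\<^sub>R mat 1"
    by (simp add: matrix_transpose_mul[symmetric] transpose_scalar)
  have B: "(transpose (N_beta d) *v x) \<bullet> (symp_form *v (transpose (N_beta d) *v y))
      = of_int d * (x \<bullet> (symp_form *v y))"
    by (rule matrix_inner_scale) (simp add: N_beta_symp_form_transpose)
  show "(transpose (N_beta d ** g) *v x) \<bullet> (symp_form *v (transpose (N_beta d ** g) *v y))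
      = of_int d * (x \<bullet> (symp_form *v y))"
    using Sp4_real_inner[OF Sp4_real_transpose[OF Gamma_N_Sp4[OF g]]]
    by (simp add: matrix_transpose_mul B flip: matrix_vector_mul_assoc)
qed

lemma A_Z_moduli_objects:
  assumes d: "d < 0" and N: "N \<ge> 3" and even: "d mod 4 = 1 \<Longrightarrow> even N"
    and Z: "Z \<in> siegel" and g: "g \<in> Gamma_N d N" and real: "hat_siegel d Z = siegel_act g Z"
  shows "A_Z d N Z g \<in> moduli_objects d N"
proof -
  let ?T = "transpose (N_beta d ** g)"
  let ?k = "kappa_Z d Z g"
  have d0: "d \<noteq> 0" using d by simp
  note H = H_Z_pos_def[OF Z]
  note T = real_point_matrix[OF d N Z g real]
  note k = kappa_Z_F_Z[OF Z, of d g]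
  have surj: "\<exists>x. u = F_Z Z x" for u
    using bij_F_Z[OF Z] by (metis bij_pointE)
  have lift: "is_lift N (L_Z Z) (H_Z Z) (lev (A_Z d N Z g)) (\<lambda>i. F_Z Z (axis i 1))"
    by (rule is_lift_A_Z[OF Z])
  have g_cong: "g \<in> principal_congruence N" using g by (simp add: Gamma_N_iff[OF d0])
  obtain E where E: "int_mat E" "transpose g = mat 1 + real N *\<^sub>R E"
    using principal_congruence_transpose[OF g_cong] by (auto simp: principal_congruence_iff)
  have T_eq: "?T = transpose (N_beta d) + real N *\<^sub>R (E ** transpose (N_beta d))"
    by (simp add: matrix_transpose_mul E(2) matrix_add_distrib_right)
  have intEB: "int_mat (E ** transpose (N_beta d))"
    by (intro int_mat_mult E int_mat_transpose int_mat_N_beta)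
  have intT: "int_mat ?T"
    unfolding T_eq by (intro int_mat_add int_mat_of_int intEB int_mat_transpose int_mat_N_beta) simp
  have "antilinear ?k"
    using eq_siegel_act_iff[OF d Z Gamma_N_Sp4[OF g] k] real by blast
  moreover have "?k (?k u) = of_int d *\<^sub>R u" for u
  proof -
    obtain x where x: "u = F_Z Z x" using surj by blast
    show ?thesis
      by (simp add: x k matrix_vector_mul_assoc T(1) scaleR_matrix_vector_assoc[symmetric]
          linear_scale[OF linear_F_Z])
  qed
  moreover have "imag_form (H_Z Z) (?k u) (?k v) = of_int d * imag_form (H_Z Z) u v" for u v
  proof -
    obtain x y where "u = F_Z Z x" "v = F_Z Z y" using surj by metis
    then show ?thesis
      by (simp add: imag_form_def k Im_H_Z_F_Z[OF Z] T(2))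
  qed
  moreover have "?k ` L_Z Z \<subseteq> L_Z Z"
    by (auto simp: L_Z_def k int_vecs_matrix_mult[OF intT])
  moreover have "(\<lambda>u. (1/2) *\<^sub>R (?k u + u)) ` L_Z Z \<subseteq> L_Z Z" if d1: "d mod 4 = 1"
  proof -
    \<comment> \<open>\<open>N_beta\<close>^t + 1 is divisible by 2 when d = 1 modulo 4, and
      evenness of N does the same for the correction N E \<open>N_beta\<close>^t.\<close>
    obtain n where n: "N = 2 * n" using even[OF d1] by (auto elim: evenE)
    have "int_mat ((1/2) *\<^sub>R (transpose (N_beta d) + mat 1))"
      using d1 by (simp add: transpose_N_beta_eq_kmat kmat_def int_mat_def forall_2_plus_2 mat_def)
    moreover have "int_mat (real n *\<^sub>R (E ** transpose (N_beta d)))"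
      by (rule int_mat_of_int[OF intEB]) simp
    ultimately have "int_mat ((1/2) *\<^sub>R (transpose (N_beta d) + mat 1) + real n *\<^sub>R (E ** transpose (N_beta d)))"
      by (rule int_mat_add)
    also have "(1/2) *\<^sub>R (transpose (N_beta d) + mat 1) + real n *\<^sub>R (E ** transpose (N_beta d))
        = (1/2) *\<^sub>R (?T + mat 1)"
      by (simp add: T_eq n scaleR_add_right)
    finally have int: "int_mat ((1/2) *\<^sub>R (?T + mat 1))" .
    have "(1/2) *\<^sub>R (?k (F_Z Z x) + F_Z Z x) = F_Z Z (((1/2) *\<^sub>R (?T + mat 1)) *v x)" for x
      by (simp add: k linear_add[OF linear_F_Z] linear_scale[OF linear_F_Z]
          scaleR_matrix_vector_assoc[symmetric] matrix_vector_mult_add_rdistrib)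
    then show ?thesis
      using int_vecs_matrix_mult[OF int] by (auto simp: L_Z_def)
  qed
  ultimately have "antiholomorphic_mult d (L_Z Z) (H_Z Z) ?k"
    by (simp add: antiholomorphic_mult_def)
  moreover have "pp_abelian_surface (L_Z Z) (H_Z Z)"
    using lift H by (auto simp: pp_abelian_surface_def is_lift_def)
  moreover have "level_structure N (L_Z Z) (H_Z Z) (lev (A_Z d N Z g))"
  proof -
    have "torsion_basis N (L_Z Z) (lev (A_Z d N Z g))"
    proof (rule torsion_basis_of_frame[where b = "\<lambda>i. F_Z Z (axis i 1)"])
      show "0 < N" using N by simp
      show "inj (frame (\<lambda>i. F_Z Z (axis i 1)))"
        unfolding F_Z_frame by (rule bij_is_inj[OF bij_F_Z[OF Z]])
    qed (use lift in \<open>simp_all add: is_lift_iff[OF H]\<close>)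
    then show ?thesis using lift by (auto simp: level_structure_def)
  qed
  moreover have "compatible_level d N (L_Z Z) (H_Z Z) ?k (lev (A_Z d N Z g))"
    unfolding compatible_level_def
  proof (intro exI conjI allI impI)
    show "is_lift N (L_Z Z) (H_Z Z) (lev (A_Z d N Z g)) (\<lambda>i. F_Z Z (axis i 1))" by (rule lift)
    fix x :: "real^(2+2)"
    assume x: "real N *\<^sub>R x \<in> int_vecs"
    have "?k (F_Z Z x) - F_Z Z (transpose (N_beta d) *v x)
        = F_Z Z ((E ** transpose (N_beta d)) *v (real N *\<^sub>R x))"
      by (simp add: k T_eq matrix_vector_mult_add_rdistrib linear_add[OF linear_F_Z]
          scaleR_matrix_vector_assoc[symmetric] matrix_vector_mult_scaleR)
    then show "?k (frame (\<lambda>i. F_Z Z (axis i 1)) x) -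
        frame (\<lambda>i. F_Z Z (axis i 1)) (transpose (N_beta d) *v x) \<in> L_Z Z"
      using int_vecs_matrix_mult[OF intEB x] by (simp add: F_Z_frame L_Z_def)
  qed
  ultimately show ?thesis
    by (simp add: moduli_objects_def A_Z_def)
qed

lemma surface_iso_of_matrix:
  assumes P: "invertible P" and "(*v) P ` lat S = lat S'"
    and "\<And>u v. herm S' (P *v u) (P *v v) = herm S u v"
    and "\<And>u. P *v kap S u = kap S' (P *v u)"
    and "\<And>i. (*v) P ` lev S i = lev S' i"
  shows "surface_iso S S' ((*v) P)"
  unfolding surface_iso_def
  using assms invertible_eq_bij[of P] matrix_vector_mul_linear_gen[of P] by auto

text \<open>The period factor of h is the isomorphism. On coordinates it is h^t, which preserves the
  lattice and is 1 modulo N; it intertwines the multiplications because g' must equal hat(h) g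
  h^-1.\<close>

lemma A_Z_surface_iso:
  assumes d: "d < 0" and N: "N \<ge> 3" and Z: "Z \<in> siegel" and g: "g \<in> Gamma_N d N"
    and real: "hat_siegel d Z = siegel_act g Z"
    and h: "h \<in> Gamma_N d N" and g': "g' \<in> Gamma_N d N"
    and real': "hat_siegel d (siegel_act h Z) = siegel_act g' (siegel_act h Z)"
  shows "\<exists>f. surface_iso (A_Z d N (siegel_act h Z) g') (A_Z d N Z g) f"
proof -
  let ?W = "siegel_act h Z"
  have d0: "d \<noteq> 0" using d by simp
  have Sp: "h \<in> Sp4_real" "g \<in> Sp4_real" "g' \<in> Sp4_real" using g g' h Gamma_N_Sp4 by auto
  obtain P where P: "invertible P" and W: "?W \<in> siegel"
    and F: "\<And>x. F_Z Z (transpose h *v x) = P *v F_Z ?W x"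
    and HP: "\<And>u v. H_Z Z (P *v u) (P *v v) = H_Z ?W u v"
    using siegel_act_period[OF Z Sp(1)] by metis
  have h_cong: "h \<in> principal_congruence N" using h by (simp add: Gamma_N_iff[OF d0])
  \<comment> \<open>Both products carry Z to hat(h Z), so torsion-freeness makes them equal.\<close>
  have "siegel_act (g' ** h) Z = siegel_act (hat_Sp d h ** g) Z"
    using Sp Z d d0
    by (simp add: siegel_act_mult hat_Sp_Sp4_real real'[symmetric] real[symmetric] hat_siegel_act)
  then have gh: "g' ** h = hat_Sp d h ** g"
    using Gamma_N_mult[OF d0 g' h] Gamma_N_mult[OF d0 Gamma_N_hat[OF d0 h] g]
    by (intro real_point_element_unique[OF _ _ N Z]) (simp_all add: Gamma_N_iff[OF d0])
  have "N_beta d ** g' ** h = h ** (N_beta d ** g)"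
  proof -
    have "N_beta d ** g' ** h = N_beta d ** (hat_Sp d h ** g)"
      by (simp add: gh flip: matrix_mul_assoc)
    also have "\<dots> = (N_beta d ** hat_Sp d h) ** g" by (rule matrix_mul_assoc)
    finally show ?thesis by (simp only: hat_Sp_N_beta(2)[OF d0] matrix_mul_assoc)
  qed
  then have comm: "transpose h ** transpose (N_beta d ** g') = transpose (N_beta d ** g) ** transpose h"
    by (metis matrix_transpose_mul)
  have th: "transpose h \<in> principal_congruence N"
    by (rule principal_congruence_transpose[OF h_cong])
  have thi: "transpose (symp_inv h) \<in> principal_congruence N"
    by (intro principal_congruence_transpose principal_congruence_inv h_cong)
  have thinv: "transpose h ** transpose (symp_inv h) = mat 1"
    by (simp add: matrix_transpose_mul[symmetric] symp_inv[OF Sp(1)])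
  obtain E where E: "int_mat E" "transpose h = mat 1 + real N *\<^sub>R E"
    using th by (auto simp: principal_congruence_iff)
  have PL: "(*v) P ` L_Z ?W = L_Z Z"
  proof -
    have "(*v) P ` L_Z ?W = F_Z Z ` ((*v) (transpose h) ` int_vecs)"
      by (simp add: L_Z_def image_image F)
    also have "(*v) (transpose h) ` int_vecs = int_vecs"
    proof
      show "(*v) (transpose h) ` int_vecs \<subseteq> int_vecs"
        using int_vecs_matrix_mult[OF principal_congruence_int_mat[OF th]] by blast
      show "int_vecs \<subseteq> (*v) (transpose h) ` int_vecs"
      proof
        fix x :: "real^(2+2)" assume "x \<in> int_vecs"
        then have "transpose (symp_inv h) *v x \<in> int_vecs"
          using int_vecs_matrix_mult[OF principal_congruence_int_mat[OF thi]] by blast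
        moreover have "x = transpose h *v (transpose (symp_inv h) *v x)"
          by (simp add: matrix_vector_mul_assoc thinv)
        ultimately show "x \<in> (*v) (transpose h) ` int_vecs" by blast
      qed
    qed
    finally show ?thesis by (simp add: L_Z_def)
  qed
  have "surface_iso (A_Z d N ?W g') (A_Z d N Z g) ((*v) P)"
  proof (rule surface_iso_of_matrix[OF P])
    show "(*v) P ` lat (A_Z d N ?W g') = lat (A_Z d N Z g)"
      by (simp add: A_Z_def PL)
    show "herm (A_Z d N Z g) (P *v u) (P *v v) = herm (A_Z d N ?W g') u v" for u v
      by (simp add: A_Z_def HP)
    show "P *v kap (A_Z d N ?W g') u = kap (A_Z d N Z g) (P *v u)" for u
    proof -
      obtain x where x: "u = F_Z ?W x" using bij_F_Z[OF W] by (metis bij_pointE)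
      have "P *v kappa_Z d ?W g' u = F_Z Z ((transpose h ** transpose (N_beta d ** g')) *v x)"
        by (simp add: x kappa_Z_F_Z[OF W] F[symmetric] matrix_vector_mul_assoc)
      also have "\<dots> = kappa_Z d Z g (P *v u)"
        by (simp add: x F[symmetric] kappa_Z_F_Z[OF Z] comm matrix_vector_mul_assoc)
      finally show ?thesis by (simp add: A_Z_def)
    qed
    show "(*v) P ` lev (A_Z d N ?W g') i = lev (A_Z d N Z g) i" for i
    proof -
      have grp: "additive_group (L_Z Z)"
        unfolding L_Z_def by (rule additive_group_lattice[OF linear_F_Z])
      have bij: "bij ((*v) P)" using P invertible_eq_bij by blast
      have lin: "linear ((*v) P)"
        by (rule linear_complex_imp_real[OF matrix_vector_mul_linear_gen])
      let ?e = "(1 / real N) *\<^sub>R axis i 1 :: real^(2+2)"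
      have "F_Z Z (transpose h *v ?e) - F_Z Z ?e = F_Z Z (E *v axis i 1)"
        using N by (simp add: E(2) matrix_vector_mult_add_rdistrib linear_add[OF linear_F_Z]
            scaleR_matrix_vector_assoc[symmetric] matrix_vector_mult_scaleR linear_scale[OF linear_F_Z]
            scaleR_add_right)
      also have "\<dots> \<in> L_Z Z"
        unfolding L_Z_def by (intro imageI int_vecs_matrix_mult E int_vecs_closed)
      finally have "torus_pt (L_Z Z) (P *v F_Z ?W ?e) = torus_pt (L_Z Z) (F_Z Z ?e)"
        by (simp add: torus_pt_eq_iff[OF grp] F[symmetric])
      then show ?thesis
        by (simp add: A_Z_def image_torus_pt[OF lin bij PL])
    qed
  qed
  then show ?thesis by blast
qed

text \<open>In the two frames f becomes a matrix M, symplectic because f is an isometry and 1 modulo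
  N because f matches level structures. For h = M^t, commutation with the multiplications reads g h
  = hat(h) g', which puts hat(h) in Gamma(N) too.\<close>

lemma orbit_of_surface_iso:
  assumes d: "d < 0" and N: "N \<ge> 3" and Z: "Z \<in> siegel" and g: "g \<in> Gamma_N d N"
    and W: "W \<in> siegel" and g': "g' \<in> Gamma_N d N"
    and iso: "surface_iso (A_Z d N Z g) (A_Z d N W g') f"
  shows "\<exists>h\<in>Gamma_N d N. Z = siegel_act h W"
proof -
  have d0: "d \<noteq> 0" using d by simp
  have f: "Vector_Spaces.linear (*s) (*s) f" "bij f" "f ` L_Z Z = L_Z W"
    "\<And>u v. H_Z W (f u) (f v) = H_Z Z u v" "\<And>u. f (kappa_Z d Z g u) = kappa_Z d W g' (f u)"
    "\<And>i. f ` lev (A_Z d N Z g) i = lev (A_Z d N W g') i"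
    using iso by (auto simp: surface_iso_def A_Z_def)
  have lin: "linear f" by (rule linear_complex_imp_real[OF f(1)])
  obtain M :: mat4 where M: "\<And>x. f (F_Z Z x) = F_Z W (M *v x)"
    using linear_factor_matrix[OF linear_F_Z bij_F_Z[OF W] linear_compose[OF linear_F_Z lin]]
    by (auto simp: o_def)
  have injW: "F_Z W x = F_Z W y \<longleftrightarrow> x = y" for x y
    using bij_F_Z[OF W] by (simp add: bij_is_inj inj_eq)
  have memW: "F_Z W x \<in> L_Z W \<longleftrightarrow> x \<in> int_vecs" for x
    unfolding L_Z_def by (rule lattice_frame_mem_iff[OF bij_is_inj[OF bij_F_Z[OF W]]])
  have "Im (H_Z W (F_Z W (M *v x)) (F_Z W (M *v y))) = x \<bullet> (symp_form *v y)" for x y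
    by (simp add: M[symmetric] f(4) Im_H_Z_F_Z[OF Z])
  then have "transpose M ** symp_form ** M = 1 *\<^sub>R symp_form"
    by (intro matrix_of_inner_scale) (simp add: Im_H_Z_F_Z[OF W])
  then have Sp: "M \<in> Sp4_real" by (simp add: Sp4_real_iff)
  define E where "E = (1 / real N) *\<^sub>R (M - mat 1)"
  have ME: "M = mat 1 + real N *\<^sub>R E" using N by (simp add: E_def)
  have grp: "additive_group (L_Z W)"
    unfolding L_Z_def by (rule additive_group_lattice[OF linear_F_Z])
  have "E *v axis i 1 \<in> int_vecs" for i
  proof -
    let ?e = "(1 / real N) *\<^sub>R axis i 1 :: real^(2+2)"
    have "torus_pt (L_Z W) (f (F_Z Z ?e)) = torus_pt (L_Z W) (F_Z W ?e)"
      using f(6)[of i] by (simp add: A_Z_def image_torus_pt[OF lin f(2,3)])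
    then have "F_Z W (M *v ?e - ?e) \<in> L_Z W"
      by (simp add: torus_pt_eq_iff[OF grp] M linear_diff[OF linear_F_Z])
    then have "M *v ?e - ?e \<in> int_vecs" by (simp add: memW)
    also have "M *v ?e - ?e = E *v axis i 1"
      by (simp add: E_def scaleR_matrix_vector_assoc[symmetric] matrix_vector_mult_diff_rdistrib
          matrix_vector_mult_scaleR scaleR_diff_right)
    finally show ?thesis .
  qed
  then have "int_mat E" by (auto simp: int_mat_def int_vecs_def matrix_mult_axis_nth)
  then have Mc: "M \<in> principal_congruence N" using Sp ME by (auto simp: principal_congruence_iff)
  define h where "h = transpose M"
  have h: "h \<in> principal_congruence N" using Mc by (simp add: h_def principal_congruence_transpose)
  have "siegel_act h W = Z"
  proof (rule siegel_act_unique)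
    show "invertible (matrix f)"
      using f(1,2) by (simp add: invertible_eq_bij matrix_vector_mul(1)[OF f(1)])
    show "F_Z W (transpose h *v x) = matrix f *v F_Z Z x" for x
      by (simp add: h_def M[symmetric] matrix_works[OF f(1)])
  qed (simp_all add: siegelD Z W)
  moreover have "h \<in> Gamma_N d N"
  proof -
    have "F_Z W (M *v (transpose (N_beta d ** g) *v x)) = F_Z W (transpose (N_beta d ** g') *v (M *v x))" for x
      using f(5)[of "F_Z Z x"] by (simp add: kappa_Z_F_Z Z W M)
    then have "(M ** transpose (N_beta d ** g)) *v x = (transpose (N_beta d ** g') ** M) *v x" for x
      by (simp add: injW flip: matrix_vector_mul_assoc)
    then have "M ** transpose (N_beta d ** g) = transpose (N_beta d ** g') ** M"
      by (simp add: matrix_eq)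
    then have "transpose (M ** transpose (N_beta d ** g)) = transpose (transpose (N_beta d ** g') ** M)"
      by simp
    then have "N_beta d ** g ** h = h ** (N_beta d ** g')"
      by (simp add: matrix_transpose_mul[of M] matrix_transpose_mul[of _ M] h_def)
    then have "N_beta d ** (g ** h) = N_beta d ** (hat_Sp d h ** g')"
      by (simp add: matrix_mul_assoc hat_Sp_N_beta(2)[OF d0])
    then have "N_beta d ** (N_beta d ** (g ** h)) = N_beta d ** (N_beta d ** (hat_Sp d h ** g'))"
      by simp
    then have gh: "g ** h = hat_Sp d h ** g'"
      using d0 by (simp add: matrix_mul_assoc N_beta_sq)
    have g'S: "g' \<in> Sp4_real" using g' by (rule Gamma_N_Sp4)
    have "hat_Sp d h = hat_Sp d h ** (g' ** symp_inv g')" by (simp add: symp_inv[OF g'S])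
    also have "\<dots> = g ** h ** symp_inv g'" by (simp add: gh matrix_mul_assoc)
    also have "\<dots> \<in> principal_congruence N"
      using g g' h by (intro principal_congruence_mult principal_congruence_inv)
        (simp_all add: Gamma_N_iff[OF d0])
    finally show ?thesis using h by (simp add: Gamma_N_iff[OF d0])
  qed
  ultimately show ?thesis by blast
qed

text \<open>Changing the compatible lift by M does not alter the level structure, and the normal
  form of the new frame produces Z and the isomorphism P. Reality of Z is antilinearity of the given
  multiplication, by \<open>eq_siegel_act_iff\<close>.\<close>

lemma moduli_object_iso_A_Z:
  assumes d: "d < 0" and sf: "squarefree d" and N: "N \<ge> 3"
    and S: "S \<in> moduli_objects d N"
  obtains Z g f where "Z \<in> siegel" "g \<in> Gamma_N d N" "hat_siegel d Z = siegel_act g Z"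
    "surface_iso (A_Z d N Z g) S f"
proof -
  have d0: "d \<noteq> 0" and N0: "N > 0" using d N by simp_all
  let ?L = "lat S" and ?H = "herm S" and ?k = "kap S" and ?B = "transpose (N_beta d)"
  note H = moduli_objectsD(1)[OF S] and grp = moduli_objectsD(3)[OF S]
  have anti: "antilinear ?k" and ksq: "\<And>u. ?k (?k u) = of_int d *\<^sub>R u"
    and kQ: "\<And>u v. Im (?H (?k u) (?k v)) = of_int d * Im (?H u v)"
    using S by (auto simp: moduli_objects_def antiholomorphic_mult_def imag_form_def)
  obtain b where lift: "is_lift N ?L ?H (lev S) b"
    and comp: "\<And>x. real N *\<^sub>R x \<in> int_vecs \<Longrightarrow> ?k (frame b x) - frame b (?B *v x) \<in> ?L"
    using S by (auto simp: moduli_objects_def compatible_level_def)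
  let ?F = "frame b"
  note F = linear_frame[of b]
  have L: "?L = ?F ` int_vecs"
    and symp: "\<And>x y. Im (?H (?F x) (?F y)) = x \<bullet> (symp_form *v y)"
    and lev: "\<And>i. lev S i = torus_pt ?L ((1 / real N) *\<^sub>R b i)"
    using lift by (simp_all add: is_lift_iff[OF H])
  have bij: "bij ?F" by (rule symplectic_frame_bij[OF F H symp])
  have inj: "?F x = ?F y \<longleftrightarrow> x = y" for x y using bij by (simp add: bij_is_inj inj_eq)
  have mem: "?F x \<in> ?L \<longleftrightarrow> x \<in> int_vecs" for x
    unfolding L by (rule lattice_frame_mem_iff[OF bij_is_inj[OF bij]])
  obtain K :: mat4 where K: "\<And>x. ?k (?F x) = ?F (K *v x)"
    using linear_factor_matrix[OF F bij linear_compose[OF F antilinear_linear[OF anti]]]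
    by (auto simp: o_def)
  \<comment> \<open>Compatibility tested on the vectors e_i / N and f_j / N says precisely that this
    quotient is integral.\<close>
  define E where "E = (1 / real N) *\<^sub>R (K - ?B)"
  have KE: "K = ?B + real N *\<^sub>R E" using N0 by (simp add: E_def)
  have "E *v axis i 1 \<in> int_vecs" for i
  proof -
    let ?e = "(1 / real N) *\<^sub>R axis i 1 :: real^(2+2)"
    have "real N *\<^sub>R ?e \<in> int_vecs" using N0 by (simp add: int_vecs_closed)
    then have "?F (K *v ?e - ?B *v ?e) \<in> ?L"
      using comp[of ?e] by (simp add: K linear_diff[OF F])
    then have "K *v ?e - ?B *v ?e \<in> int_vecs" by (simp add: mem)
    also have "K *v ?e - ?B *v ?e = E *v axis i 1"
      by (simp add: E_def scaleR_matrix_vector_assoc[symmetric] matrix_vector_mult_diff_rdistrib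
          matrix_vector_mult_scaleR scaleR_diff_right)
    finally show ?thesis .
  qed
  then have intE: "int_mat E" by (auto simp: int_mat_def int_vecs_def matrix_mult_axis_nth)
  have "?F ((K ** K) *v x) = ?F ((of_int d *\<^sub>R mat 1) *v x)" for x
    by (simp add: K[symmetric] ksq linear_scale[OF F] scaleR_matrix_vector_assoc[symmetric]
        flip: matrix_vector_mul_assoc)
  then have Ksq: "K ** K = of_int d *\<^sub>R mat 1" by (simp add: inj matrix_eq)
  have Ksymp: "transpose K ** symp_form ** K = of_int d *\<^sub>R symp_form"
    by (rule matrix_of_inner_scale) (simp add: symp[symmetric] K[symmetric] kQ)
  obtain M g where M: "M \<in> principal_congruence N" and g: "g \<in> Gamma_N d N"
    and KM: "K ** M = M ** transpose (N_beta d ** g)"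
    using multiplication_conj_Gamma_N[OF d sf N0 intE KE Ksq Ksymp] .
  let ?G = "\<lambda>x. ?F (M *v x)"
  have MSp: "M \<in> Sp4_real" by (rule principal_congruence_Sp4[OF M])
  have G: "linear ?G"
    using linear_compose[OF matrix_vector_mul_linear[of M] F] by (simp add: o_def)
  have "Im (?H (?G x) (?G y)) = x \<bullet> (symp_form *v y)" for x y
    by (simp add: symp Sp4_real_inner[OF MSp])
  then obtain P Z where P: "invertible P" and Z: "Z \<in> siegel"
    and GP: "\<And>x. ?G x = P *v F_Z Z x" and HP: "\<And>u v. ?H (P *v u) (P *v v) = H_Z Z u v"
    using period_normal_form[OF G H] by metis
  obtain P' where P': "P' ** P = mat 1" "P ** P' = mat 1" using P by (auto simp: invertible_def)
  let ?k' = "\<lambda>u. P' *v ?k (P *v u)"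
  have kG: "?k (?G x) = ?G (transpose (N_beta d ** g) *v x)" for x
    by (simp add: K matrix_vector_mul_assoc KM)
  have k': "?k' (F_Z Z x) = F_Z Z (transpose (N_beta d ** g) *v x)" for x
  proof -
    have "?k' (F_Z Z x) = P' *v (P *v F_Z Z (transpose (N_beta d ** g) *v x))"
      by (simp only: GP[symmetric] kG)
    then show ?thesis by (simp add: matrix_vector_mul_assoc P')
  qed
  have real: "hat_siegel d Z = siegel_act g Z"
    using eq_siegel_act_iff[where k = ?k', OF d Z Gamma_N_Sp4[OF g] k'] antilinear_matrix_comp[OF anti]
    by blast
  have bijP: "bij ((*v) P)" using P invertible_eq_bij by blast
  have linP: "linear ((*v) P)"
    by (rule linear_complex_imp_real[OF matrix_vector_mul_linear_gen])
  note Minv = symp_inv[OF MSp]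
  have PL: "(*v) P ` L_Z Z = ?L"
  proof -
    have "(*v) P ` L_Z Z = ?F ` ((*v) M ` int_vecs)"
      by (simp add: L_Z_def image_image GP)
    also have "(*v) M ` int_vecs = int_vecs"
    proof
      show "(*v) M ` int_vecs \<subseteq> int_vecs"
        using int_vecs_matrix_mult[OF principal_congruence_int_mat[OF M]] by blast
      show "int_vecs \<subseteq> (*v) M ` int_vecs"
      proof
        fix x :: "real^(2+2)" assume "x \<in> int_vecs"
        then have "symp_inv M *v x \<in> int_vecs"
          using int_vecs_matrix_mult[OF principal_congruence_int_mat[OF principal_congruence_inv[OF M]]] by blast
        moreover have "x = M *v (symp_inv M *v x)"
          by (simp add: matrix_vector_mul_assoc Minv)
        ultimately show "x \<in> (*v) M ` int_vecs" by blast
      qed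
    qed
    finally show ?thesis by (simp add: L)
  qed
  obtain E' where E': "int_mat E'" "M = mat 1 + real N *\<^sub>R E'"
    using M by (auto simp: principal_congruence_iff)
  have "surface_iso (A_Z d N Z g) S ((*v) P)"
  proof (rule surface_iso_of_matrix[OF P])
    show "(*v) P ` lat (A_Z d N Z g) = ?L" by (simp add: A_Z_def PL)
    show "?H (P *v u) (P *v v) = herm (A_Z d N Z g) u v" for u v by (simp add: A_Z_def HP)
    show "P *v kap (A_Z d N Z g) u = ?k (P *v u)" for u
    proof -
      obtain x where x: "u = F_Z Z x" using bij_F_Z[OF Z] by (metis bij_pointE)
      have "P *v kappa_Z d Z g u = ?k (?G x)"
        by (simp only: x kappa_Z_F_Z[OF Z] GP[symmetric] kG)
      then show ?thesis by (simp add: A_Z_def x GP)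
    qed
    show "(*v) P ` lev (A_Z d N Z g) i = lev S i" for i
    proof -
      let ?e = "(1 / real N) *\<^sub>R axis i 1 :: real^(2+2)"
      have "?G ?e - (1 / real N) *\<^sub>R b i = ?F (E' *v axis i 1)"
        using N0 by (simp add: E'(2) matrix_vector_mult_add_rdistrib linear_add[OF F]
            scaleR_matrix_vector_assoc[symmetric] matrix_vector_mult_scaleR linear_scale[OF F] scaleR_add_right)
      also have "\<dots> \<in> ?L"
        unfolding mem by (intro int_vecs_matrix_mult E' int_vecs_closed)
      finally have "torus_pt ?L (P *v F_Z Z ?e) = torus_pt ?L ((1 / real N) *\<^sub>R b i)"
        by (simp only: torus_pt_eq_iff[OF grp] GP)
      then show ?thesis
        by (simp add: A_Z_def image_torus_pt[OF linP bijP PL] lev)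
    qed
  qed
  then show ?thesis using that Z g real by blast
qed

section \<open>Orbits, real points and the bijection\<close>

lemma orbit_rel_iff:
  assumes "d \<noteq> 0" "Z \<in> siegel"
  shows "W \<in> orbit_rel d N `` {Z} \<longleftrightarrow> (\<exists>h\<in>Gamma_N d N. W = siegel_act h Z)"
  using assms Gamma_N_Sp4 siegel_act_siegel by (auto simp: orbit_rel_def)

lemma equiv_orbit_rel:
  assumes d: "d \<noteq> 0"
  shows "equiv siegel (orbit_rel d N)"
proof (rule equivI)
  show "refl_on siegel (orbit_rel d N)"
    using siegel_act_1 Gamma_N_1[OF d] by (auto simp: refl_on_def orbit_rel_def intro!: bexI[of _ "mat 1"])
  show "sym (orbit_rel d N)"
    using siegel_act_symp_inv Gamma_N_Sp4 Gamma_N_inv[OF d]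
    by (auto simp: sym_def orbit_rel_def) (metis)
  show "trans (orbit_rel d N)"
    using siegel_act_mult Gamma_N_Sp4 Gamma_N_mult[OF d]
    by (auto simp: trans_def orbit_rel_def) (metis)
  show "orbit_rel d N \<subseteq> siegel \<times> siegel"
    by (auto simp: orbit_rel_def)
qed

text \<open>A fixed orbit contains hat Z along with Z. Conversely the hat maps the orbit of a real
  point into itself, and, being an involution, onto itself.\<close>

lemma X_real_iff:
  assumes d: "d < 0"
  shows "c \<in> X_real d N \<longleftrightarrow>
    (\<exists>Z\<in>siegel. c = orbit_rel d N `` {Z} \<and> (\<exists>g\<in>Gamma_N d N. hat_siegel d Z = siegel_act g Z))"
proof
  have d0: "d \<noteq> 0" using d by simp
  {
    assume c: "c \<in> X_real d N"
    then obtain Z where Z: "Z \<in> siegel" "c = orbit_rel d N `` {Z}"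
      by (auto simp: X_real_def X_quot_def elim: quotientE)
    have "Z \<in> c" using equiv_class_self[OF equiv_orbit_rel[OF d0] Z(1)] Z(2) by simp
    then have "hat_siegel d Z \<in> c" using c by (auto simp: X_real_def X_involution_def)
    then have "\<exists>g\<in>Gamma_N d N. hat_siegel d Z = siegel_act g Z"
      unfolding Z(2) by (rule iffD1[OF orbit_rel_iff[OF d0 Z(1)]])
    then show "\<exists>Z\<in>siegel. c = orbit_rel d N `` {Z} \<and> (\<exists>g\<in>Gamma_N d N. hat_siegel d Z = siegel_act g Z)"
      using Z by blast
  }
  assume "\<exists>Z\<in>siegel. c = orbit_rel d N `` {Z} \<and> (\<exists>g\<in>Gamma_N d N. hat_siegel d Z = siegel_act g Z)"
  then obtain Z g where Z: "Z \<in> siegel" and c: "c = orbit_rel d N `` {Z}"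
    and g: "g \<in> Gamma_N d N" and real: "hat_siegel d Z = siegel_act g Z" by blast
  have hat: "hat_siegel d (siegel_act h Z) = siegel_act (hat_Sp d h ** g) Z" if "h \<in> Gamma_N d N" for h
    using that g Z d d0 Gamma_N_Sp4
    by (simp add: hat_siegel_act siegel_act_mult hat_Sp_Sp4_real real)
  have sub: "hat_siegel d W \<in> c" if "W \<in> c" for W
    using that hat Gamma_N_mult[OF d0 Gamma_N_hat[OF d0] g] unfolding c orbit_rel_iff[OF d0 Z] by metis
  have "hat_siegel d ` c = c"
  proof
    show "hat_siegel d ` c \<subseteq> c" using sub by blast
    show "c \<subseteq> hat_siegel d ` c"
    proof
      fix W assume "W \<in> c"
      then show "W \<in> hat_siegel d ` c"
        by (intro image_eqI[of _ _ "hat_siegel d W"] sub) (simp_all add: hat_siegel_hat_siegel[OF d])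
    qed
  qed
  then show "c \<in> X_real d N"
    using Z by (auto simp: X_real_def X_quot_def X_involution_def c intro: quotientI)
qed

theorem theorem7p5:
  fixes d :: int and N :: nat
  assumes "d < 0" and "squarefree d"
    and "principal_domain (quadratic_integers d)"
    and "N \<ge> 3"
    and "d mod 4 = 1 \<Longrightarrow> even N"
  shows "\<exists>\<Phi>. bij_betw \<Phi> (X_real d N) (moduli_space d N) \<and>
           (\<forall>Z\<in>siegel. \<forall>\<gamma>\<in>Gamma_N d N. hat_siegel d Z = siegel_act \<gamma> Z \<longrightarrow>
              \<Phi> (orbit_rel d N `` {Z}) = moduli_rel d N `` {A_Z d N Z \<gamma>})"
proof -
  note d = assms(1) and N = assms(4)
  have d0: "d \<noteq> 0" using d by simp
  define real_pt where "real_pt Z g \<longleftrightarrow> Z \<in> siegel \<and> g \<in> Gamma_N d N \<and> hat_siegel d Z = siegel_act g Z" for Z g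
  have obj: "A_Z d N Z g \<in> moduli_objects d N" if "real_pt Z g" for Z g
    using that A_Z_moduli_objects[OF d N assms(5)] by (simp add: real_pt_def)
  note eqM = equiv_moduli_rel[of d N] and eqO = equiv_orbit_rel[OF d0, of N]
  \<comment> \<open>From left to right this makes the class independent of the choice of Z and g;
    from right to left it is injectivity.\<close>
  have key: "orbit_rel d N `` {Z} = orbit_rel d N `` {W} \<longleftrightarrow>
      moduli_rel d N `` {A_Z d N Z g} = moduli_rel d N `` {A_Z d N W g'}"
    if "real_pt Z g" "real_pt W g'" for Z g W g'
  proof
    assume "orbit_rel d N `` {Z} = orbit_rel d N `` {W}"
    then have "W \<in> orbit_rel d N `` {Z}"
      using that equiv_class_self[OF eqO, of W] by (simp add: real_pt_def)
    then obtain h where "h \<in> Gamma_N d N" "W = siegel_act h Z"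
      by (auto simp: orbit_rel_def)
    then have "\<exists>f. surface_iso (A_Z d N W g') (A_Z d N Z g) f"
      using that A_Z_surface_iso[OF d N] by (auto simp: real_pt_def)
    then have "(A_Z d N W g', A_Z d N Z g) \<in> moduli_rel d N"
      using that obj by (simp add: moduli_rel_iff)
    then show "moduli_rel d N `` {A_Z d N Z g} = moduli_rel d N `` {A_Z d N W g'}"
      using equiv_class_eq[OF eqM] by metis
  next
    assume "moduli_rel d N `` {A_Z d N Z g} = moduli_rel d N `` {A_Z d N W g'}"
    then have "(A_Z d N Z g, A_Z d N W g') \<in> moduli_rel d N"
      using eq_equiv_class[OF _ eqM] obj that by metis
    then obtain f where f: "surface_iso (A_Z d N Z g) (A_Z d N W g') f"
      by (auto simp: moduli_rel_iff)
    have "\<exists>h\<in>Gamma_N d N. Z = siegel_act h W"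
      using that by (intro orbit_of_surface_iso[OF d N _ _ _ _ f]) (simp_all add: real_pt_def)
    then obtain h where "h \<in> Gamma_N d N" "Z = siegel_act h W" by blast
    then have "(W, Z) \<in> orbit_rel d N"
      using that by (auto simp: orbit_rel_def real_pt_def)
    then show "orbit_rel d N `` {Z} = orbit_rel d N `` {W}"
      using equiv_class_eq[OF eqO] by metis
  qed
  have real_cases: "\<exists>Z g. real_pt Z g \<and> c = orbit_rel d N `` {Z}" if "c \<in> X_real d N" for c
    using that unfolding X_real_iff[OF d] real_pt_def by blast
  define \<Phi> where "\<Phi> c = (SOME m. \<exists>Z g. real_pt Z g \<and> c = orbit_rel d N `` {Z} \<and>
      m = moduli_rel d N `` {A_Z d N Z g})" for c
  have \<Phi>: "\<Phi> (orbit_rel d N `` {Z}) = moduli_rel d N `` {A_Z d N Z g}" if "real_pt Z g" for Z g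
    unfolding \<Phi>_def
  proof (rule some_equality)
    fix m
    assume "\<exists>Z' g'. real_pt Z' g' \<and> orbit_rel d N `` {Z} = orbit_rel d N `` {Z'} \<and>
        m = moduli_rel d N `` {A_Z d N Z' g'}"
    then show "m = moduli_rel d N `` {A_Z d N Z g}" using key that by blast
  qed (use that in blast)
  have "bij_betw \<Phi> (X_real d N) (moduli_space d N)"
    unfolding bij_betw_def
  proof (intro conjI subset_antisym)
    show "inj_on \<Phi> (X_real d N)"
    proof (rule inj_onI)
      fix c c' assume c: "c \<in> X_real d N" "c' \<in> X_real d N" "\<Phi> c = \<Phi> c'"
      obtain Z g W g' where "real_pt Z g" "c = orbit_rel d N `` {Z}"
        "real_pt W g'" "c' = orbit_rel d N `` {W}"
        using real_cases[OF c(1)] real_cases[OF c(2)] by blast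
      then show "c = c'" using c(3) \<Phi> key by simp
    qed
    show "\<Phi> ` X_real d N \<subseteq> moduli_space d N"
    proof
      fix m assume "m \<in> \<Phi> ` X_real d N"
      then obtain Z g where "real_pt Z g" "m = moduli_rel d N `` {A_Z d N Z g}"
        using real_cases \<Phi> by fastforce
      then show "m \<in> moduli_space d N"
        unfolding moduli_space_def using obj by (blast intro: quotientI)
    qed
    show "moduli_space d N \<subseteq> \<Phi> ` X_real d N"
    proof
      fix m assume "m \<in> moduli_space d N"
      then obtain S where S: "S \<in> moduli_objects d N" "m = moduli_rel d N `` {S}"
        by (auto simp: moduli_space_def elim: quotientE)
      obtain Z g f where Z: "real_pt Z g" and f: "surface_iso (A_Z d N Z g) S f"
        using moduli_object_iso_A_Z[OF d assms(2) N S(1)] unfolding real_pt_def by blast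
      have "(A_Z d N Z g, S) \<in> moduli_rel d N"
        using f obj[OF Z] S(1) by (auto simp: moduli_rel_iff)
      then have "m = moduli_rel d N `` {A_Z d N Z g}"
        using equiv_class_eq[OF eqM] S(2) by metis
      moreover have "orbit_rel d N `` {Z} \<in> X_real d N"
        using Z unfolding X_real_iff[OF d] real_pt_def by blast
      ultimately show "m \<in> \<Phi> ` X_real d N" using \<Phi>[OF Z] by (metis imageI)
    qed
  qed
  then show ?thesis
    using \<Phi> by (intro exI[of _ \<Phi>]) (simp add: real_pt_def)
qed

end
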